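(* Let $n\ge2$, let $G=\mathcal B_{n+1}$ be the Artin group of type $A_n$ with standard generators $s_1,\dots,s_n$, let $M$ be the submonoid of $G$ generated by $s_1,\dots,s_n$, and let $\Delta=(s_1\cdots s_n)^{n+1}$. Let $G_1$ (resp. $M_1$) be the subgroup (resp. submonoid) generated by $s_2,\dots,s_n$, with $\Delta_1=(s_2\cdots s_n)^n$, and let $H$ (resp. $N$) be the subgroup (resp. submonoid) generated by $s_1,\dots,s_{n-1}$, with $\Lambda=(s_1\cdots s_{n-1})^n$. Then, with respect to the Garside structure $(G,M,\Delta)$, the pair $(H,G_1)$ is a Dehornoy structure.
   Context: The Artin group of type $A_n$ (braid group $\mathcal B_{n+1}$) is $G=\langle s_1,\dots,s_n\mid s_is_js_i=s_js_is_j\text{ for }|i-j|=1,\ s_is_j=s_js_i\text{ for }|i-j|\ge2\rangle$. For $\alpha,\beta\in G$: $\alpha\le_R\beta$ iff $\beta\alpha^{-1}\in M$. It is known that $(G,M,\Delta)$ is a Garside structure, that $(G_1,M_1,\Delta_1)$ and $(H,N,\Lambda)$ are parabolic substructures of it, that $\Delta$ is central in $G$ and $\Delta_1$ is central in $G_1$, and $M_1\cup N$ generates $M$. An element $a\in M$ is unmovable if $\Delta\not\le_R a$. Every $\alpha\in G$ is uniquely $\alpha=a\Delta^k$ with $a\in M$ unmovable and $k\in\mathbb Z$ (the $\Delta$-form of $\alpha$). Depth. For $K\in\{M_1,N\}$ and $a\in M$, $\tau_K(a)$ denotes the unique $b\in K$ with $\{c\in K\mid c\le_R a\}=\{c\in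 K\mid c\le_R b\}$. Every $a\in M\setminus\{1\}$ is uniquely $a=a_p\cdots a_2a_1$ with $a_p\ne1$, $a_i=\tau_{M_1}(a_p\cdots a_i)$ for $i$ odd and $a_i=\tau_N(a_p\cdots a_i)$ for $i$ even; set $\mathrm{bh}(a)=p$ and $\mathrm{bh}(1)=1$. The depth is $\mathrm{dpt}(a)=(\mathrm{bh}(a)-1)/2$ if $\mathrm{bh}(a)$ is odd and $\mathrm{bh}(a)/2$ if $\mathrm{bh}(a)$ is even. Dehornoy structure. An element $\alpha\in G$ with $\Delta$-form $\alpha=a\Delta^{-k}$ is $(H,G_1)$-negative if $k\ge1$ and $\mathrm{dpt}(a)<\mathrm{dpt}(\Delta^k)$; $\alpha$ is $(H,G_1)$-positive if $\alpha^{-1}$ is $(H,G_1)$-negative. Let $P$ be the set of $(H,G_1)$-positive elements; $P^{-1}$ is then the set of $(H,G_1)$-negative elements. The pair $(H,G_1)$ is a Dehornoy structure if (a) $PP\subset P$, (b) $G_1PG_1\subset P$, (c) $G=P\sqcup P^{-1}\sqcup G_1$ (disjoint union). *)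

theory Defs
  imports "HOL-Algebra.Generated_Groups"
begin

section \<open>Groups given by generators and relations\<close>

text \<open>A letter \<open>(x, True)\<close> stands for the generator \<open>x\<close>, and \<open>(x, False)\<close> for its formal inverse.\<close>

type_synonym 'x gword = "('x \<times> bool) list"

definition gwords :: "'x set \<Rightarrow> 'x gword set" where
  "gwords X = lists (X \<times> UNIV)"

inductive_set word_rel :: "'x set \<Rightarrow> ('x gword \<times> 'x gword) set \<Rightarrow> ('x gword \<times> 'x gword) set"
  for X :: "'x set" and R :: "('x gword \<times> 'x gword) set"
where
  refl: "w \<in> gwords X \<Longrightarrow> (w, w) \<in> word_rel X R"
| sym: "(u, v) \<in> word_rel X R \<Longrightarrow> (v, u) \<in> word_rel X R"
| trans: "(u, v) \<in> word_rel X R \<Longrightarrow> (v, w) \<in> word_rel X R \<Longrightarrow> (u, w) \<in> word_rel X R"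
| append: "(u, u') \<in> word_rel X R \<Longrightarrow> (v, v') \<in> word_rel X R \<Longrightarrow> (u @ v, u' @ v') \<in> word_rel X R"
| cancel: "x \<in> X \<Longrightarrow> ([(x, b), (x, \<not> b)], []) \<in> word_rel X R"
| relator: "(u, v) \<in> R \<Longrightarrow> u \<in> gwords X \<Longrightarrow> v \<in> gwords X \<Longrightarrow> (u, v) \<in> word_rel X R"

definition word_class :: "'x set \<Rightarrow> ('x gword \<times> 'x gword) set \<Rightarrow> 'x gword \<Rightarrow> 'x gword set" where
  "word_class X R w = word_rel X R `` {w}"

definition presented_group ::
  "'x set \<Rightarrow> ('x gword \<times> 'x gword) set \<Rightarrow> 'x gword set monoid" where
  "presented_group X R =
    \<lparr> carrier = gwords X // word_rel X R,
      mult = (\<lambda>A B. \<Union>u\<in>A. \<Union>v\<in>B. word_class X R (u @ v)),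
      one = word_class X R [] \<rparr>"

lemma gwords_append: "u \<in> gwords X \<Longrightarrow> v \<in> gwords X \<Longrightarrow> u @ v \<in> gwords X"
  by (simp add: gwords_def)

lemma word_rel_gwords:
  assumes "(u, v) \<in> word_rel X R"
  shows "u \<in> gwords X \<and> v \<in> gwords X"
  using assms by (induction) (auto simp: gwords_def)

lemma equiv_word_rel: "equiv (gwords X) (word_rel X R)"
proof (rule equivI)
  show "word_rel X R \<subseteq> gwords X \<times> gwords X"
    by (auto dest: word_rel_gwords)
  show "refl_on (gwords X) (word_rel X R)"
    by (simp add: refl_on_def word_rel.refl)
  show "sym (word_rel X R)"
    by (rule symI) (rule word_rel.sym)
  show "Relation.trans (word_rel X R)"
    by (rule transI) (rule word_rel.trans)
qed

lemma carrier_presented_group: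
  "carrier (presented_group X R) = word_class X R ` gwords X"
  by (auto simp: presented_group_def quotient_def word_class_def)

lemma one_presented_group: "\<one>\<^bsub>presented_group X R\<^esub> = word_class X R []"
  by (simp add: presented_group_def)

lemma word_class_eq_iff:
  assumes "u \<in> gwords X" "v \<in> gwords X"
  shows "word_class X R u = word_class X R v \<longleftrightarrow> (u, v) \<in> word_rel X R"
  unfolding word_class_def
  using eq_equiv_class_iff[OF equiv_word_rel assms] .

lemma mult_presented_group:
  assumes "u \<in> gwords X" "v \<in> gwords X"
  shows "word_class X R u \<otimes>\<^bsub>presented_group X R\<^esub> word_class X R v = word_class X R (u @ v)"
proof -
  have "word_class X R (u' @ v') = word_class X R (u @ v)"
    if "u' \<in> word_class X R u" "v' \<in> word_class X R v" for u' v'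
  proof -
    have "(u @ v, u' @ v') \<in> word_rel X R"
      using that by (auto simp: word_class_def intro: word_rel.append)
    then show ?thesis
      unfolding word_class_def by (metis equiv_class_eq equiv_word_rel)
  qed
  moreover have "u \<in> word_class X R u" "v \<in> word_class X R v"
    using assms by (auto simp: word_class_def intro: word_rel.refl)
  ultimately have "(\<Union>u'\<in>word_class X R u. \<Union>v'\<in>word_class X R v. word_class X R (u' @ v')) =
      word_class X R (u @ v)"
    by blast
  then show ?thesis
    by (simp add: presented_group_def)
qed

lemma inverse_word:
  assumes "w \<in> gwords X"
  shows "(rev (map (\<lambda>(x, b). (x, \<not> b)) w) @ w, []) \<in> word_rel X R"
  using assms
proof (induction w)
  case Nil
  then show ?case by (auto intro: word_rel.refl simp: gwords_def)
next
  case (Cons a w)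
  obtain x b where a: "a = (x, b)" by (cases a)
  let ?r = "rev (map (\<lambda>(x, b). (x, \<not> b)) w)"
  have mem: "w \<in> gwords X" "x \<in> X" "?r \<in> gwords X"
    using Cons.prems a by (auto simp: gwords_def)
  have "([(x, \<not> b), (x, b)], []) \<in> word_rel X R"
    using word_rel.cancel[OF mem(2), of "\<not> b" R] by simp
  then have "(?r @ [(x, \<not> b), (x, b)] @ w, ?r @ [] @ w) \<in> word_rel X R"
    using mem by (intro word_rel.append word_rel.refl) auto
  then show ?case
    using word_rel.trans[OF _ Cons.IH[OF mem(1)]] by (simp add: a)
qed

lemma group_presented_group: "group (presented_group X R)"
proof (rule groupI)
  show "\<one>\<^bsub>presented_group X R\<^esub> \<in> carrier (presented_group X R)"
    by (auto simp: one_presented_group carrier_presented_group gwords_def)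
next
  fix x assume "x \<in> carrier (presented_group X R)"
  then obtain w where w: "w \<in> gwords X" "x = word_class X R w"
    by (auto simp: carrier_presented_group)
  let ?r = "rev (map (\<lambda>(x, b). (x, \<not> b)) w)"
  have r: "?r \<in> gwords X" using w(1) by (auto simp: gwords_def)
  have nil: "[] \<in> gwords X" by (simp add: gwords_def)
  have "word_class X R ?r \<otimes>\<^bsub>presented_group X R\<^esub> x = word_class X R (?r @ w)"
    unfolding w(2) by (rule mult_presented_group[OF r w(1)])
  also have "\<dots> = \<one>\<^bsub>presented_group X R\<^esub>"
    using inverse_word[OF w(1), of R] word_rel_gwords[OF inverse_word[OF w(1), of R]]
    by (simp add: one_presented_group word_class_eq_iff)
  finally show "\<exists>y\<in>carrier (presented_group X R).
      y \<otimes>\<^bsub>presented_group X R\<^esub> x = \<one>\<^bsub>presented_group X R\<^esub>"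
    using r by (auto simp: carrier_presented_group)
  show "\<one>\<^bsub>presented_group X R\<^esub> \<otimes>\<^bsub>presented_group X R\<^esub> x = x"
    unfolding one_presented_group w(2) using mult_presented_group[OF nil w(1)] by simp
next
  fix x y assume "x \<in> carrier (presented_group X R)" "y \<in> carrier (presented_group X R)"
  then show "x \<otimes>\<^bsub>presented_group X R\<^esub> y \<in> carrier (presented_group X R)"
    by (auto simp: carrier_presented_group mult_presented_group intro: gwords_append)
next
  fix x y z
  assume "x \<in> carrier (presented_group X R)" "y \<in> carrier (presented_group X R)"
    "z \<in> carrier (presented_group X R)"
  then obtain u v w where w: "u \<in> gwords X" "v \<in> gwords X" "w \<in> gwords X"
    "x = word_class X R u" "y = word_class X R v" "z = word_class X R w"
    by (auto simp: carrier_presented_group)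
  moreover have "u @ v \<in> gwords X" "v @ w \<in> gwords X"
    using w by (auto simp: gwords_def)
  ultimately show "x \<otimes>\<^bsub>presented_group X R\<^esub> y \<otimes>\<^bsub>presented_group X R\<^esub> z =
      x \<otimes>\<^bsub>presented_group X R\<^esub> (y \<otimes>\<^bsub>presented_group X R\<^esub> z)"
    by (simp add: mult_presented_group)
qed

section \<open>The Artin group of type A (braid group)\<close>

definition artin_A_relations :: "nat \<Rightarrow> (nat gword \<times> nat gword) set" where
  "artin_A_relations n =
    {([(i, True), (j, True), (i, True)], [(j, True), (i, True), (j, True)]) | i j.
       i \<in> {1..n} \<and> j \<in> {1..n} \<and> \<bar>int i - int j\<bar> = 1} \<union>
    {([(i, True), (j, True)], [(j, True), (i, True)]) | i j.
       i \<in> {1..n} \<and> j \<in> {1..n} \<and> \<bar>int i - int j\<bar> \<ge> 2}"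

definition artin_A :: "nat \<Rightarrow> nat gword set monoid" where
  "artin_A n = presented_group {1..n} (artin_A_relations n)"

definition artin_gen :: "nat \<Rightarrow> nat \<Rightarrow> nat gword set" where
  "artin_gen n i = word_class {1..n} (artin_A_relations n) [(i, True)]"

section \<open>Submonoids and products of lists\<close>

inductive_set monoid_generate :: "('a, 'b) monoid_scheme \<Rightarrow> 'a set \<Rightarrow> 'a set"
  for G and S where
  one: "\<one>\<^bsub>G\<^esub> \<in> monoid_generate G S"
| incl: "x \<in> S \<Longrightarrow> x \<in> monoid_generate G S"
| mult: "x \<in> monoid_generate G S \<Longrightarrow> y \<in> monoid_generate G S \<Longrightarrow>
    x \<otimes>\<^bsub>G\<^esub> y \<in> monoid_generate G S"

definition list_mult :: "('a, 'b) monoid_scheme \<Rightarrow> 'a list \<Rightarrow> 'a" where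
  "list_mult G xs = foldr (mult G) xs \<one>\<^bsub>G\<^esub>"

section \<open>Order, depth and Dehornoy structures\<close>

definition le_R :: "('a, 'b) monoid_scheme \<Rightarrow> 'a set \<Rightarrow> 'a \<Rightarrow> 'a \<Rightarrow> bool" where
  "le_R G M \<alpha> \<beta> \<longleftrightarrow> \<beta> \<otimes>\<^bsub>G\<^esub> inv\<^bsub>G\<^esub> \<alpha> \<in> M"

definition unmovable :: "('a, 'b) monoid_scheme \<Rightarrow> 'a set \<Rightarrow> 'a \<Rightarrow> 'a \<Rightarrow> bool" where
  "unmovable G M \<Delta> a \<longleftrightarrow> a \<in> M \<and> \<not> le_R G M \<Delta> a"

definition Delta_form :: "('a, 'b) monoid_scheme \<Rightarrow> 'a set \<Rightarrow> 'a \<Rightarrow> 'a \<Rightarrow> 'a \<Rightarrow> int \<Rightarrow> bool" where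
  "Delta_form G M \<Delta> \<alpha> a k \<longleftrightarrow> unmovable G M \<Delta> a \<and> \<alpha> = a \<otimes>\<^bsub>G\<^esub> \<Delta> [^]\<^bsub>G\<^esub> k"

definition tau :: "('a, 'b) monoid_scheme \<Rightarrow> 'a set \<Rightarrow> 'a set \<Rightarrow> 'a \<Rightarrow> 'a" where
  "tau G M K a = (THE b. b \<in> K \<and> {c \<in> K. le_R G M c a} = {c \<in> K. le_R G M c b})"

text \<open>
  The list \<open>as\<close> is \<open>[a\<^sub>1, \<dots>, a\<^sub>p]\<close>, whereas the product is \<open>a\<^sub>p \<cdots> a\<^sub>1\<close>. The element \<open>as ! i\<close>
  is \<open>a\<^sub>i\<^sub>+\<^sub>1\<close>, so \<open>M\<^sub>1\<close> is used at even positions, and \<open>a\<^sub>p \<cdots> a\<^sub>i\<^sub>+\<^sub>1\<close> is the product of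
  \<open>rev (drop i as)\<close>.
\<close>

definition alternating_form ::
  "('a, 'b) monoid_scheme \<Rightarrow> 'a set \<Rightarrow> 'a set \<Rightarrow> 'a set \<Rightarrow> 'a \<Rightarrow> 'a list \<Rightarrow> bool" where
  "alternating_form G M M1 N a as \<longleftrightarrow>
     as \<noteq> [] \<and> last as \<noteq> \<one>\<^bsub>G\<^esub> \<and> a = list_mult G (rev as) \<and>
     (\<forall>i<length as. as ! i = tau G M (if even i then M1 else N) (list_mult G (rev (drop i as))))"

definition bh :: "('a, 'b) monoid_scheme \<Rightarrow> 'a set \<Rightarrow> 'a set \<Rightarrow> 'a set \<Rightarrow> 'a \<Rightarrow> nat" where
  "bh G M M1 N a =
     (if a = \<one>\<^bsub>G\<^esub> then 1 else length (THE as. alternating_form G M M1 N a as))"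

definition dpt :: "('a, 'b) monoid_scheme \<Rightarrow> 'a set \<Rightarrow> 'a set \<Rightarrow> 'a set \<Rightarrow> 'a \<Rightarrow> nat" where
  "dpt G M M1 N a =
     (if odd (bh G M M1 N a) then (bh G M M1 N a - 1) div 2 else bh G M M1 N a div 2)"

definition HG1_negative ::
  "('a, 'b) monoid_scheme \<Rightarrow> 'a set \<Rightarrow> 'a \<Rightarrow> 'a set \<Rightarrow> 'a set \<Rightarrow> 'a \<Rightarrow> bool" where
  "HG1_negative G M \<Delta> M1 N \<alpha> \<longleftrightarrow>
     (\<exists>a (k::nat). Delta_form G M \<Delta> \<alpha> a (- int k) \<and> k \<ge> 1 \<and>
        dpt G M M1 N a < dpt G M M1 N (\<Delta> [^]\<^bsub>G\<^esub> k))"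

definition HG1_positives ::
  "('a, 'b) monoid_scheme \<Rightarrow> 'a set \<Rightarrow> 'a \<Rightarrow> 'a set \<Rightarrow> 'a set \<Rightarrow> 'a set" where
  "HG1_positives G M \<Delta> M1 N = {\<alpha> \<in> carrier G. HG1_negative G M \<Delta> M1 N (inv\<^bsub>G\<^esub> \<alpha>)}"

text \<open>
  Here \<open>(G, M, \<Delta>)\<close> is the ambient Garside structure and \<open>(H, N, \<Lambda>)\<close>, \<open>(G1, M1, \<Delta>1)\<close> are
  two parabolic substructures. Positivity depends on the substructures only through the
  monoids \<open>N\<close> and \<open>M1\<close>; the components \<open>H\<close>, \<open>\<Lambda>\<close>, \<open>\<Delta>1\<close> merely record the remaining data of the triples.
\<close>

definition dehornoy_structure ::
  "('a, 'b) monoid_scheme \<Rightarrow> 'a set \<Rightarrow> 'a \<Rightarrow> 'a set \<Rightarrow> 'a set \<Rightarrow> 'a \<Rightarrow> 'a set \<Rightarrow> 'a set \<Rightarrow> 'a \<Rightarrow> bool"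
where
  "dehornoy_structure G M \<Delta> H N \<Lambda> G1 M1 \<Delta>1 \<longleftrightarrow>
     (let P = HG1_positives G M \<Delta> M1 N in
        P <#>\<^bsub>G\<^esub> P \<subseteq> P \<and>
        G1 <#>\<^bsub>G\<^esub> P <#>\<^bsub>G\<^esub> G1 \<subseteq> P \<and>
        carrier G = P \<union> (set_inv\<^bsub>G\<^esub> P) \<union> G1 \<and>
        P \<inter> (set_inv\<^bsub>G\<^esub> P) = {} \<and> P \<inter> G1 = {} \<and> (set_inv\<^bsub>G\<^esub> P) \<inter> G1 = {})"

end

theory Submission
  imports Defs
begin

text \<open>Positive braids act on a linear order, here the reduced words in a free product of groups
  of order two. The action preserves the order and never moves a point down; the generators
  other than \<open>s\<^sub>1\<close> fix the base point. Between the images of the base point under the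
  powers of the central element lie further points, and together they form an increasing
  sequence \<open>pt j\<close> whose members are fixed in turn by \<open>M\<^sub>1\<close> and by \<open>N\<close>. The key fact is that a positive
  braid keeps the base point below \<open>pt j\<close>, \<open>j > 0\<close>, exactly if it is a product of \<open>j + 1\<close> factors
  taken alternately from \<open>M\<^sub>1\<close> and \<open>N\<close>, the rightmost one from \<open>M\<^sub>1\<close>. Since the alternating form
  is greedy, the depth of \<open>a\<close> is at most \<open>k \<ge> 1\<close> if and only if \<open>a\<close> moves the base point less
  far than \<open>\<Delta>\<^sup>k\<close> does. Hence
  the negative elements are those that move the base point down and \<open>G\<^sub>1\<close> is its stabiliser,
  so the three axioms hold for the same reason as for any action on a linear order.\<close>

section \<open>The positive braid monoid\<close>

text \<open>The hard direction of the key fact turns an inequality between points into a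
  factorisation. Letters are removed from the left of a braid; a letter outside the wanted factor
  either commutes past it or starts a whole ladder \<open>s l * ... * s (Suc k)\<close>, which
  conjugates one parabolic submonoid into its neighbour. Ladders lead out of
  \<open>M\<^sub>1\<close> and \<open>N\<close>, so the induction (\<open>HH\<close>) runs over all
  proper interval submonoids and over intermediate points \<open>pp j k\<close>. The letter just
  below an interval is handled by the same statement for the reversed numbering of the generators,
  which exchanges \<open>M\<^sub>1\<close> and \<open>N\<close> and shifts the points by one. The
  points come from the factorisation \<open>\<Delta> =
  (s\<^sub>1...s\<^sub>n)(s\<^sub>n...s\<^sub>1)\<Delta>\<^sub>1\<close>:
  \<open>\<Delta>\<^sub>1\<close> fixes the base point, and the two ladders carry it to
  \<open>pt 1\<close> and then to \<open>pt 2\<close>. A second obstacle is that the group is known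
  only through a presentation. Positive braids are built separately, with cancellation, and the map
  to the group is shown to be injective by writing group elements as fractions whose denominators
  are powers of \<Delta>.\<close>

definition adj :: "nat \<Rightarrow> nat \<Rightarrow> bool" where
  "adj i j \<longleftrightarrow> j = Suc i \<or> i = Suc j"

definition far :: "nat \<Rightarrow> nat \<Rightarrow> bool" where
  "far i j \<longleftrightarrow> i \<noteq> j \<and> \<not> adj i j"

text \<open>Garside's lemma is built into the rules: two words are identified if their first letters
  can be completed to a common right multiple. Left cancellation is then immediate.\<close>

inductive peq :: "nat list \<Rightarrow> nat list \<Rightarrow> bool" (infix "\<approx>" 50) where
  Nil: "[] \<approx> []"
| same: "X \<approx> Y \<Longrightarrow> i # X \<approx> i # Y"
| adj: "adj i j \<Longrightarrow> X \<approx> j # i # Z \<Longrightarrow> Y \<approx> i # j # Z \<Longrightarrow> i # X \<approx> j # Y"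
| far: "far i j \<Longrightarrow> X \<approx> j # Z \<Longrightarrow> Y \<approx> i # Z \<Longrightarrow> i # X \<approx> j # Y"

lemma adj_sym: "adj i j \<Longrightarrow> adj j i"
  and far_sym: "far i j \<Longrightarrow> far j i"
  by (auto simp: adj_def far_def)

lemma letter_cases:
  obtains "i = j" | "adj i j" | "far i j"
  by (auto simp: far_def)

lemma adj_far_disj: "adj i j \<Longrightarrow> i \<noteq> j" "far i j \<Longrightarrow> i \<noteq> j" "adj i j \<Longrightarrow> \<not> far i j"
  by (auto simp: adj_def far_def)

lemma peq_length: "X \<approx> Y \<Longrightarrow> length X = length Y"
  by (induction rule: peq.induct) auto

lemma peq_set: "X \<approx> Y \<Longrightarrow> set X = set Y"
  by (induction rule: peq.induct) auto

lemma peq_refl [simp, intro]: "X \<approx> X"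
  by (induction X) (auto intro: peq.intros)

lemma peq_sym: "X \<approx> Y \<Longrightarrow> Y \<approx> X"
  by (induction rule: peq.induct) (auto intro: peq.intros adj_sym far_sym)

lemma peq_append_right: "X \<approx> Y \<Longrightarrow> X @ W \<approx> Y @ W"
  by (induction rule: peq.induct) (auto intro: peq.intros)

lemma peq_append_left: "X \<approx> Y \<Longrightarrow> W @ X \<approx> W @ Y"
  by (induction W) (auto intro: peq.intros)

lemma peq_Cons_same: "i # X \<approx> i # Y \<Longrightarrow> X \<approx> Y"
  by (erule peq.cases) (auto simp: adj_def far_def)

lemma peq_Cons_adj: "i # X \<approx> j # Y \<Longrightarrow> adj i j \<Longrightarrow> \<exists>Z. X \<approx> j # i # Z \<and> Y \<approx> i # j # Z"
  by (erule peq.cases) (auto simp: adj_def far_def)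

lemma peq_Cons_far: "i # X \<approx> j # Y \<Longrightarrow> far i j \<Longrightarrow> \<exists>Z. X \<approx> j # Z \<and> Y \<approx> i # Z"
  by (erule peq.cases) (auto simp: adj_def far_def)

text \<open>Lets the last three rules of \<open>peq\<close> be handled as one:
  \<open>i # lcm_word i j\<close> and \<open>j # lcm_word j i\<close> are the two sides of the
  relation between the letters.\<close>

definition lcm_word :: "nat \<Rightarrow> nat \<Rightarrow> nat list" where
  "lcm_word i j = (if i = j then [] else if adj i j then [j, i] else [j])"

lemma lcm_word_simps [simp]:
  "lcm_word i i = []" "adj i j \<Longrightarrow> lcm_word i j = [j, i]" "far i j \<Longrightarrow> lcm_word i j = [j]"
  "adj i j \<Longrightarrow> lcm_word j i = [i, j]" "far i j \<Longrightarrow> lcm_word j i = [i]"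
  by (auto simp: lcm_word_def adj_def far_def)

lemma peq_Cons_lcm:
  assumes "i # X \<approx> j # Y"
  shows "\<exists>Z. X \<approx> lcm_word i j @ Z \<and> Y \<approx> lcm_word j i @ Z"
  using assms by (cases rule: peq.cases) auto

lemma peq_Cons_lcmI:
  assumes "i \<noteq> j \<or> X \<approx> Y" "X \<approx> lcm_word i j @ Z" "Y \<approx> lcm_word j i @ Z"
  shows "i # X \<approx> j # Y"
  by (rule letter_cases[of i j]) (use assms in \<open>auto intro: peq.intros simp: adj_far_disj\<close>)

lemma peq_braid: "adj i j \<Longrightarrow> i # j # i # Z \<approx> j # i # j # Z"
  by (auto intro: peq.adj)

lemma peq_swap: "far i j \<Longrightarrow> i # j # Z \<approx> j # i # Z"
  by (auto intro: peq.far)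

text \<open>Before transitivity is available, single moves can only be strung together in the
  closure of \<open>peq\<close>. The letters \<open>a\<close> and \<open>f\<close> in the names say
  whether the pairs (i,j), (j,k), (i,k) are adjacent or far. The chains rewrite completions found
  through the middle letter \<open>j\<close> into direct completions of \<open>i\<close> and
  \<open>k\<close> with a common tail.\<close>

lemma chain_aaf1:
  assumes "adj i j" "adj j k" "far i k"
  shows "peq\<^sup>*\<^sup>* (j # i # k # j # i # T) (k # j # k # i # j # T)"
proof -
  have a: "j # i # k # j # i # T \<approx> j # k # i # j # i # T"
    and b: "j # k # i # j # i # T \<approx> j # k # j # i # j # T"
    and c: "j # k # j # i # j # T \<approx> k # j # k # i # j # T"
    using assms by (auto intro!: peq.same intro: peq_braid peq_swap adj_sym far_sym)
  show ?thesis using a b c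
    by (meson r_into_rtranclp rtranclp.rtrancl_into_rtrancl)
qed

lemma chain_aaf2:
  assumes "adj i j" "adj j k" "far i k"
  shows "peq\<^sup>*\<^sup>* (j # k # i # j # k # T) (i # j # k # i # j # T)"
proof -
  have a: "j # k # i # j # k # T \<approx> j # i # k # j # k # T"
    and b: "j # i # k # j # k # T \<approx> j # i # j # k # j # T"
    and c: "j # i # j # k # j # T \<approx> i # j # i # k # j # T"
    and d: "i # j # i # k # j # T \<approx> i # j # k # i # j # T"
    using assms by (auto intro!: peq.same intro: peq_braid peq_swap adj_sym far_sym)
  show ?thesis using a b c d
    by (meson r_into_rtranclp rtranclp.rtrancl_into_rtrancl)
qed

lemma chain_afa1:
  assumes "adj i j" "adj i k" "far j k"
  shows "peq\<^sup>*\<^sup>* (j # i # k # i # j # T) (k # i # j # i # k # T)"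
proof -
  have a: "j # i # k # i # j # T \<approx> j # k # i # k # j # T"
    and b: "j # k # i # k # j # T \<approx> k # j # i # k # j # T"
    and c: "k # j # i # k # j # T \<approx> k # j # i # j # k # T"
    and d: "k # j # i # j # k # T \<approx> k # i # j # i # k # T"
    using assms by (auto intro!: peq.same intro: peq_braid peq_swap adj_sym far_sym)
  show ?thesis using a b c d
    by (meson r_into_rtranclp rtranclp.rtrancl_into_rtrancl)
qed

lemma chain_afa2:
  assumes "adj i j" "adj i k" "far j k"
  shows "peq\<^sup>*\<^sup>* (j # i # k # j # i # T) (i # k # j # i # k # T)"
proof -
  have a: "j # i # k # j # i # T \<approx> j # i # j # k # i # T"
    and b: "j # i # j # k # i # T \<approx> i # j # i # k # i # T"
    and c: "i # j # i # k # i # T \<approx> i # j # k # i # k # T"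
    and d: "i # j # k # i # k # T \<approx> i # k # j # i # k # T"
    using assms by (auto intro!: peq.same intro: peq_braid peq_swap adj_sym far_sym)
  show ?thesis using a b c d
    by (meson r_into_rtranclp rtranclp.rtrancl_into_rtrancl)
qed

lemma chain_aff:
  assumes "adj i j" "far j k" "far i k"
  shows "peq\<^sup>*\<^sup>* (j # i # k # T) (k # j # i # T)"
proof -
  have a: "j # i # k # T \<approx> j # k # i # T"
    and b: "j # k # i # T \<approx> k # j # i # T"
    using assms by (auto intro!: peq.same intro: peq_braid peq_swap adj_sym far_sym)
  show ?thesis using a b
    by (meson r_into_rtranclp rtranclp.rtrancl_into_rtrancl)
qed

lemma chain_ffa1:
  assumes "adj i k" "far i j" "far j k"
  shows "peq\<^sup>*\<^sup>* (j # k # i # T) (k # i # j # T)"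
proof -
  have a: "j # k # i # T \<approx> k # j # i # T"
    and b: "k # j # i # T \<approx> k # i # j # T"
    using assms by (auto intro!: peq.same intro: peq_braid peq_swap adj_sym far_sym)
  show ?thesis using a b
    by (meson r_into_rtranclp rtranclp.rtrancl_into_rtrancl)
qed

text \<open>Three different first letters are compared here, and the braid relations among them matter
  nowhere else.\<close>

lemma peq_trans: "X \<approx> Y \<Longrightarrow> Y \<approx> Z \<Longrightarrow> X \<approx> Z"
proof (induction "length X" arbitrary: X Y Z rule: less_induct)
  case less
  have T: "A \<approx> C" if "A \<approx> B" "B \<approx> C" "length A < length X" for A B C
    using less.hyps[of A B C] that by simp
  have TS: "A \<approx> C" if "peq\<^sup>*\<^sup>* B C" "A \<approx> B" "length A < length X" for A B C
    using that by (induction rule: rtranclp_induct) (auto intro: T)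
  show ?case
  proof (cases X)
    case Nil
    then show ?thesis using less.prems peq_length by fastforce
  next
    case X: (Cons i X1)
    obtain j Y1 where Y: "Y = j # Y1" using less.prems(1) X peq_length by (cases Y) fastforce+
    obtain k Z1 where Z: "Z = k # Z1" using less.prems(2) Y peq_length by (cases Z) fastforce+
    have len: "length X = Suc (length X1)" "length Y1 = length X1" "length Z1 = length X1"
      using less.prems X Y Z peq_length[of X Y] peq_length[of Y Z] by auto
    obtain U where U: "X1 \<approx> lcm_word i j @ U" "Y1 \<approx> lcm_word j i @ U"
      using peq_Cons_lcm less.prems(1) X Y by blast
    obtain V where V: "Y1 \<approx> lcm_word j k @ V" "Z1 \<approx> lcm_word k j @ V"
      using peq_Cons_lcm less.prems(2) Y Z by blast
    have lU: "length (lcm_word i j @ U) = length X1" "length (lcm_word j i @ U) = length X1"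
      and lV: "length (lcm_word j k @ V) = length X1" "length (lcm_word k j @ V) = length X1"
      using U V len by (auto dest!: peq_length)
    \<comment> \<open>Both words complete the tail \<open>Y1\<close> of the middle word. Being
      shorter, they can be compared, and the cases extend this to a common multiple of all the first
      letters.\<close>
    have UV: "lcm_word j i @ U \<approx> lcm_word j k @ V"
      using T[OF peq_sym[OF U(2)] V(1)] lU len by simp
    have C: "A \<approx> w @ C" if "A \<approx> w @ B" "B \<approx> C" "length A \<le> length X1" for A B C w
      using T[OF that(1) peq_append_left[OF that(2)]] that len by simp
    have S: "A \<approx> C" if "A \<approx> B" "peq\<^sup>*\<^sup>* B C" "length A = length X1" for A B C
      using TS[OF that(2,1)] that len by simp
    consider "i = j" | "j = k" | "i = k" | "i \<noteq> j" "j \<noteq> k" "i \<noteq> k" by blast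
    then have "i # X1 \<approx> k # Z1"
    proof cases
      assume "i = j"
      then have "U \<approx> lcm_word j k @ V" using UV by simp
      then have "X1 \<approx> lcm_word i k @ V" using C[of X1 "[]" U] U \<open>i = j\<close> by simp
      with V(2) \<open>i = j\<close> show ?thesis
        by (intro peq_Cons_lcmI[where Z = V]) (auto intro: T[OF _ peq_sym] simp: len)
    next
      assume "j = k"
      then have "V \<approx> lcm_word j i @ U" using peq_sym[OF UV] by simp
      then have "Z1 \<approx> lcm_word k i @ U" using C[of Z1 "[]" V] V \<open>j = k\<close> len by simp
      with U(1) \<open>j = k\<close> show ?thesis
        by (intro peq_Cons_lcmI[where Z = U]) (auto intro: T[OF _ peq_sym] simp: len)
    next
      assume "i = k"
      have "U \<approx> V" if "w @ U \<approx> w @ V" for w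
        using that by (induction w) (auto dest: peq_Cons_same)
      then have "U \<approx> V" using UV \<open>i = k\<close> by blast
      then have "X1 \<approx> lcm_word k j @ V" using C U \<open>i = k\<close> by simp
      then have "X1 \<approx> Z1" using T[OF _ peq_sym[OF V(2)]] len by simp
      then show ?thesis using \<open>i = k\<close> by (simp add: peq.same)
    next
      assume ne: "i \<noteq> j" "j \<noteq> k" "i \<noteq> k"
      consider "adj i j" "adj j k" "far i k" | "adj i j" "far j k" "adj i k"
        | "far i j" "adj j k" "adj i k" | "adj i j" "far j k" "far i k"
        | "far i j" "adj j k" "far i k" | "far i j" "far j k" "adj i k"
        | "far i j" "far j k" "far i k"
      proof -
        have "\<not> (adj i j \<and> adj j k \<and> adj i k)" by (auto simp: adj_def)
        then show thesis using ne that unfolding far_def by blast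
      qed
      then show ?thesis
      proof cases
        case 1
        then have "i # j # U \<approx> k # j # V" using UV by simp
        then obtain Q where Q: "j # U \<approx> k # Q" "j # V \<approx> i # Q"
          using peq_Cons_far 1 by blast
        obtain R where R: "U \<approx> k # j # R" "Q \<approx> j # k # R" using peq_Cons_adj[OF Q(1)] 1 by blast
        obtain S' where S': "V \<approx> i # j # S'" "Q \<approx> j # i # S'"
          using peq_Cons_adj[OF Q(2)] 1 adj_sym by blast
        have "j # k # R \<approx> j # i # S'"
          using T[OF peq_sym[OF R(2)] S'(2)] R S' lU 1 by (auto dest!: peq_length simp: len)
        then obtain T' where T': "R \<approx> i # T'" "S' \<approx> k # T'"
          using peq_Cons_far[of k R i S'] 1 far_sym peq_Cons_same by blast
        \<comment> \<open>With its first letter restored, this is the least common multiple of three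
          consecutive generators, of length six, followed by \<open>T'\<close>.\<close>
        have "X1 \<approx> [j, i, k, j, i] @ T'"
          using C[of X1 "[j, i, k, j]" R "i # T'"] C[OF U(1) R(1)] T'(1) 1 by simp
        moreover have "Z1 \<approx> [j, k, i, j, k] @ T'"
          using C[of Z1 "[j, k, i, j]" S' "k # T'"] C[OF V(2) S'(1)] T'(2) 1 len by simp
        ultimately show ?thesis
          using chain_aaf1[OF 1] chain_aaf2[OF 1] len 1
          by (intro peq_Cons_lcmI[OF disjI1[OF ne(3)], where Z = "j # k # i # j # T'"]) (auto intro: S)
      next
        case 2
        then have "i # j # U \<approx> k # V" using UV by simp
        then obtain Q where Q: "j # U \<approx> k # i # Q" "V \<approx> i # k # Q"
          using peq_Cons_adj 2 by blast
        obtain R where R: "U \<approx> k # R" "i # Q \<approx> j # R" using peq_Cons_far[OF Q(1)] 2 by blast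
        obtain S' where S': "Q \<approx> j # i # S'" "R \<approx> i # j # S'"
          using peq_Cons_adj[OF R(2)] 2 by blast
        have "X1 \<approx> [j, i, k, i, j] @ S'"
          using C[of X1 "[j, i, k]" R "i # j # S'"] C[OF U(1) R(1)] S'(2) 2 by simp
        moreover have "Z1 \<approx> [j, i, k, j, i] @ S'"
          using C[of Z1 "[j, i, k]" Q "j # i # S'"] C[OF V(2) Q(2)] S'(1) 2 len by simp
        ultimately show ?thesis
          using chain_afa1[of i j k] chain_afa2[of i j k] len 2
          by (intro peq_Cons_lcmI[OF disjI1[OF ne(3)], where Z = "j # i # k # S'"]) (auto intro: S)
      next
        case 3
        then have "i # U \<approx> k # j # V" using UV by simp
        then obtain Q where Q: "U \<approx> k # i # Q" "j # V \<approx> i # k # Q"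
          using peq_Cons_adj 3 by blast
        obtain R where R: "V \<approx> i # R" "k # Q \<approx> j # R"
          using peq_Cons_far[OF Q(2)] 3 far_sym by blast
        obtain S' where S': "Q \<approx> j # k # S'" "R \<approx> k # j # S'"
          using peq_Cons_adj[OF R(2)] 3 adj_sym by blast
        have "X1 \<approx> [j, k, i, j, k] @ S'"
          using C[of X1 "[j, k, i]" Q "j # k # S'"] C[OF U(1) Q(1)] S'(1) 3 by simp
        moreover have "Z1 \<approx> [j, k, i, k, j] @ S'"
          using C[of Z1 "[j, k, i]" R "k # j # S'"] C[OF V(2) R(1)] S'(2) 3 len by simp
        ultimately show ?thesis
          using chain_afa1[of k j i] chain_afa2[of k j i] len 3 adj_sym far_sym
          by (intro peq_Cons_lcmI[OF disjI1[OF ne(3)], where Z = "j # k # i # S'"]) (auto intro: S)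
      next
        case 4
        then have "i # j # U \<approx> k # V" using UV by simp
        then obtain Q where Q: "j # U \<approx> k # Q" "V \<approx> i # Q" using peq_Cons_far 4 by blast
        obtain R where R: "U \<approx> k # R" "Q \<approx> j # R" using peq_Cons_far[OF Q(1)] 4 by blast
        have "X1 \<approx> [j, i, k] @ R" using C[OF U(1) R(1)] 4 by simp
        moreover have "Z1 \<approx> [j, i, j] @ R"
          using C[of Z1 "[j, i]" Q "j # R"] C[OF V(2) Q(2)] R(2) 4 len by simp
        ultimately show ?thesis
          using chain_aff[of i j k] r_into_rtranclp[of peq, OF peq_braid[of j i R]] len 4 adj_sym
          by (intro peq_Cons_lcmI[OF disjI1[OF ne(3)], where Z = "j # i # R"]) (auto intro: S)
      next
        case 5
        then have "i # U \<approx> k # j # V" using UV by simp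
        then obtain Q where Q: "U \<approx> k # Q" "j # V \<approx> i # Q" using peq_Cons_far 5 by blast
        obtain R where R: "V \<approx> i # R" "Q \<approx> j # R"
          using peq_Cons_far[OF Q(2)] 5 far_sym by blast
        have "X1 \<approx> [j, k, j] @ R"
          using C[of X1 "[j, k]" Q "j # R"] C[OF U(1) Q(1)] R(2) 5 by simp
        moreover have "Z1 \<approx> [j, k, i] @ R" using C[OF V(2) R(1)] 5 len by simp
        ultimately show ?thesis
          using chain_aff[of k j i] r_into_rtranclp[of peq, OF peq_braid[of j k R]] len 5 adj_sym far_sym
          by (intro peq_Cons_lcmI[OF disjI1[OF ne(3)], where Z = "j # k # R"]) (auto intro: S)
      next
        case 6
        then have "i # U \<approx> k # V" using UV by simp
        then obtain Q where Q: "U \<approx> k # i # Q" "V \<approx> i # k # Q" using peq_Cons_adj 6 by blast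
        have "X1 \<approx> [j, k, i] @ Q" using C[OF U(1) Q(1)] 6 by simp
        moreover have "Z1 \<approx> [j, i, k] @ Q" using C[OF V(2) Q(2)] 6 len by simp
        ultimately show ?thesis
          using chain_ffa1[of i k j] chain_ffa1[of k i j] len 6 adj_sym far_sym
          by (intro peq_Cons_lcmI[OF disjI1[OF ne(3)], where Z = "j # Q"]) (auto intro: S)
      next
        case 7
        then have "i # U \<approx> k # V" using UV by simp
        then obtain Q where Q: "U \<approx> k # Q" "V \<approx> i # Q" using peq_Cons_far 7 by blast
        have "X1 \<approx> [j, k] @ Q" using C[OF U(1) Q(1)] 7 by simp
        moreover have "Z1 \<approx> [j, i] @ Q" using C[OF V(2) Q(2)] 7 len by simp
        ultimately show ?thesis
          using r_into_rtranclp[of peq, OF peq_swap[of j k Q]] r_into_rtranclp[of peq, OF peq_swap[of j i Q]] len 7 far_sym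
          by (intro peq_Cons_lcmI[OF disjI1[OF ne(3)], where Z = "j # Q"]) (auto intro: S)
      qed
    qed
    then show ?thesis by (simp add: X Z)
  qed
qed

lemma peq_append: "X \<approx> X' \<Longrightarrow> Y \<approx> Y' \<Longrightarrow> X @ Y \<approx> X' @ Y'"
  by (meson peq_append_left peq_append_right peq_trans)

text \<open>The defining relations are symmetric under reversal. This carries left cancellation and
  the analysis of first letters over to last letters.\<close>

lemma peq_rev: "X \<approx> Y \<Longrightarrow> rev X \<approx> rev Y"
proof (induction rule: peq.induct)
  case (adj i j X Z Y)
  have "rev (i # X) \<approx> rev Z @ [i, j, i]" "rev (j # Y) \<approx> rev Z @ [j, i, j]"
    using peq_append_right[OF adj.IH(1), of "[i]"] peq_append_right[OF adj.IH(2), of "[j]"] by simp_all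
  moreover have "rev Z @ [i, j, i] \<approx> rev Z @ [j, i, j]"
    using peq_append_left[OF peq_braid[OF adj.hyps(1), of "[]"]] by simp
  ultimately show ?case by (meson peq_sym peq_trans)
next
  case (far i j X Z Y)
  have "rev (i # X) \<approx> rev Z @ [j, i]" "rev (j # Y) \<approx> rev Z @ [i, j]"
    using peq_append_right[OF far.IH(1), of "[i]"] peq_append_right[OF far.IH(2), of "[j]"] by simp_all
  moreover have "rev Z @ [j, i] \<approx> rev Z @ [i, j]"
    using peq_append_left[OF peq_swap[OF far_sym[OF far.hyps(1)], of "[]"]] by simp
  ultimately show ?case by (meson peq_sym peq_trans)
qed (use peq_append_right in \<open>auto intro: peq.intros\<close>)

\<comment> \<open>The monoid of positive braids, its length and support, and right divisors\<close>
quotient_type pbraid = "nat list" / peq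
  by (intro equivpI reflpI sympI transpI) (auto intro: peq_sym peq_trans)

instantiation pbraid :: monoid_mult
begin

lift_definition one_pbraid :: pbraid is "[]" .

lift_definition times_pbraid :: "pbraid \<Rightarrow> pbraid \<Rightarrow> pbraid" is "(@)"
  by (rule peq_append)

instance
  by standard (transfer; simp)+

end

lift_definition gen :: "nat \<Rightarrow> pbraid" is "\<lambda>i. [i]" .

lift_definition len :: "pbraid \<Rightarrow> nat" is length
  by (rule peq_length)

lift_definition supp :: "pbraid \<Rightarrow> nat set" is set
  by (rule peq_set)

lemma len_simps [simp]: "len 1 = 0" "len (x * y) = len x + len y" "len (gen i) = 1"
  by (transfer; simp)+

lemma supp_simps [simp]: "supp 1 = {}" "supp (x * y) = supp x \<union> supp y" "supp (gen i) = {i}"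
  by (transfer; simp)+

lemma len_0_iff [simp]: "len x = 0 \<longleftrightarrow> x = 1"
  by transfer (auto elim: peq.cases)

lemma gen_braid: "adj i j \<Longrightarrow> gen i * gen j * gen i = gen j * gen i * gen j"
  by transfer (auto intro: peq.adj)

lemma gen_commute: "far i j \<Longrightarrow> gen i * gen j = gen j * gen i"
  by transfer (auto intro: peq.far)

lemma pbraid_left_cases:
  obtains "x = 1" | i y where "x = gen i * y" "i \<in> supp x"
proof -
  have "x = 1 \<or> (\<exists>i y. x = gen i * y \<and> i \<in> supp x)"
  proof transfer
    fix x :: "nat list"
    show "x \<approx> [] \<or> (\<exists>i y. x \<approx> [i] @ y \<and> i \<in> set x)" by (cases x) auto
  qed
  then show ?thesis using that by blast
qed

lemma pbraid_right_cases:
  obtains "x = 1" | i y where "x = y * gen i" "i \<in> supp x"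
proof -
  have "x = 1 \<or> (\<exists>i y. x = y * gen i \<and> i \<in> supp x)"
  proof transfer
    fix x :: "nat list"
    show "x \<approx> [] \<or> (\<exists>i y. x \<approx> y @ [i] \<and> i \<in> set x)" by (cases x rule: rev_cases) auto
  qed
  then show ?thesis using that by blast
qed

lemma gen_left_cancel: "gen i * x = gen i * y \<Longrightarrow> x = y"
  by transfer (auto dest: peq_Cons_same)

lemma gen_right_cancel: "x * gen i = y * gen i \<Longrightarrow> x = y"
proof transfer
  fix x y :: "nat list" and i
  assume "x @ [i] \<approx> y @ [i]"
  then have "i # rev x \<approx> i # rev y" using peq_rev by fastforce
  then have "rev (rev x) \<approx> rev (rev y)" using peq_rev peq_Cons_same by blast
  then show "x \<approx> y" by simp
qed

lemma pbraid_right_cancel: "x * (z :: pbraid) = y * z \<longleftrightarrow> x = y"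
proof
  show "x * z = y * z \<Longrightarrow> x = y"
  proof (induction "len z" arbitrary: z)
    case (Suc k)
    show ?case
    proof (cases z rule: pbraid_right_cases)
      case (2 i w)
      then have "(x * w) * gen i = (y * w) * gen i" using Suc.prems by (simp add: mult.assoc)
      then show ?thesis using gen_right_cancel Suc.hyps(1)[of w] Suc.hyps(2) 2 by fastforce
    qed (use Suc.prems in simp)
  qed simp
qed simp

lemma gen_right_adj:
  assumes "adj i j" "x * gen i = y * gen j"
  shows "\<exists>z. x = z * gen i * gen j \<and> y = z * gen j * gen i"
  using assms(2)
proof (transfer fixing: i j)
  fix x y
  assume "x @ [i] \<approx> y @ [j]"
  then have "i # rev x \<approx> j # rev y" using peq_rev by fastforce
  then obtain Z where "rev x \<approx> j # i # Z" "rev y \<approx> i # j # Z" using peq_Cons_adj assms(1) by blast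
  then have "rev (rev x) \<approx> rev (j # i # Z)" "rev (rev y) \<approx> rev (i # j # Z)" by (auto simp only: intro: peq_rev)
  then have "x \<approx> (rev Z @ [i]) @ [j] \<and> y \<approx> (rev Z @ [j]) @ [i]" by simp
  then show "\<exists>z. x \<approx> (z @ [i]) @ [j] \<and> y \<approx> (z @ [j]) @ [i]" by blast
qed

lemma gen_right_far:
  assumes "far i j" "x * gen i = y * gen j"
  shows "\<exists>z. x = z * gen j \<and> y = z * gen i"
  using assms(2)
proof (transfer fixing: i j)
  fix x y
  assume "x @ [i] \<approx> y @ [j]"
  then have "i # rev x \<approx> j # rev y" using peq_rev by fastforce
  then obtain Z where "rev x \<approx> j # Z" "rev y \<approx> i # Z" using peq_Cons_far assms(1) by blast
  then have "rev (rev x) \<approx> rev (j # Z)" "rev (rev y) \<approx> rev (i # Z)" by (auto simp only: intro: peq_rev)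
  then have "x \<approx> rev Z @ [j] \<and> y \<approx> rev Z @ [i]" by simp
  then show "\<exists>z. x \<approx> z @ [j] \<and> y \<approx> z @ [i]" by blast
qed

text \<open>The left factor need not lie in the parabolic submonoid: if it has no right divisor
  among its generators, such a right divisor of the product comes from the right factor.\<close>

lemma right_divisor_parabolic:
  assumes y: "\<And>k w. k \<in> I \<Longrightarrow> y \<noteq> w * gen k"
  shows "supp b \<subseteq> I \<Longrightarrow> i \<in> I \<Longrightarrow> y * b = w * gen i \<Longrightarrow> \<exists>b'. b = b' * gen i"
proof (induction "len b" arbitrary: b i w rule: less_induct)
  case less
  show ?case
  proof (cases b rule: pbraid_right_cases)
    case 1
    then show ?thesis using less.prems y by auto
  next
    case (2 j b')
    have j: "j \<in> I" "supp b' \<subseteq> I" using 2 less.prems(1) by auto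
    have eq: "(y * b') * gen j = w * gen i" using less.prems(3) 2 by (simp add: mult.assoc)
    show ?thesis
    proof (cases rule: letter_cases[of i j])
      case 1
      then show ?thesis using \<open>b = b' * gen j\<close> by blast
    next
      case adj: 2
      then obtain z where z: "y * b' = z * gen j * gen i" using gen_right_adj[OF adj_sym eq] by blast
      obtain c where c: "b' = c * gen i" using less.hyps[of b' i] j less.prems z 2 by fastforce
      have "y * c = z * gen j" using z gen_right_cancel[of "y * c" i "z * gen j"] by (simp add: c mult.assoc)
      then obtain d where "c = d * gen j" using less.hyps[of c j] j less.prems c 2 by fastforce
      then have "b = d * (gen j * gen i * gen j)" using c 2 by (simp add: mult.assoc)
      also have "\<dots> = (d * gen i * gen j) * gen i" using gen_braid[OF adj] by (simp add: mult.assoc)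
      finally show ?thesis by blast
    next
      case 3
      then obtain z where z: "y * b' = z * gen i" using gen_right_far[OF far_sym eq] by blast
      obtain c where c: "b' = c * gen i" using less.hyps[of b' i] j less.prems z 2 by fastforce
      then have "b = (c * gen j) * gen i" using 2 gen_commute[OF 3] by (simp add: mult.assoc)
      then show ?thesis by blast
    qed
  qed
qed

lemma right_divisor_parabolic_general:
  assumes y: "\<And>k w. k \<in> I \<Longrightarrow> y \<noteq> w * gen k"
  shows "supp b \<subseteq> I \<Longrightarrow> supp c \<subseteq> I \<Longrightarrow> y * b = w * c \<Longrightarrow> \<exists>b'. b = b' * c"
proof (induction "len c" arbitrary: b c rule: less_induct)
  case less
  show ?case
  proof (cases c rule: pbraid_right_cases)
    case 1
    then show ?thesis by simp
  next
    case (2 i c')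
    then obtain b' where b': "b = b' * gen i"
      using right_divisor_parabolic[of I y b i "w * c'"] y less.prems by (auto simp: mult.assoc)
    have "(y * b') * gen i = (w * c') * gen i" using less.prems(3) b' 2 by (simp add: mult.assoc)
    then have "y * b' = w * c'" by (rule gen_right_cancel)
    then obtain b'' where "b' = b'' * c'" using less.hyps[of c' b'] less.prems b' 2 by auto
    then show ?thesis using b' 2 by (auto simp: mult.assoc)
  qed
qed

text \<open>A right divisor of maximal length leaves a left factor without right divisors in
  \<open>I\<close>, as such a letter could be added to it. Then
  \<open>right_divisor_parabolic_general\<close> makes it the greatest. This is the existence behind
  \<open>tau\<close>.\<close>

lemma greatest_parabolic_right_divisor:
  obtains y b where "a = y * b" "supp b \<subseteq> I"
    "\<And>z c. supp c \<subseteq> I \<Longrightarrow> a = z * c \<Longrightarrow> \<exists>b'. b = b' * c"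
proof -
  let ?P = "\<lambda>b. supp b \<subseteq> I \<and> (\<exists>y. a = y * b)"
  have "?P 1" by simp
  moreover have "\<forall>b. ?P b \<longrightarrow> len b < Suc (len a)" by auto
  ultimately obtain b where b: "?P b" "\<And>c. ?P c \<Longrightarrow> len c \<le> len b"
    using ex_has_greatest_nat[of ?P 1 len "Suc (len a)"] by auto
  then obtain y where y: "a = y * b" by blast
  have "y \<noteq> w * gen k" if "k \<in> I" for k w
  proof
    assume "y = w * gen k"
    then have "a = w * (gen k * b)" using y by (simp add: mult.assoc)
    then show False using b(2)[of "gen k * b"] b(1) that by auto
  qed
  from right_divisor_parabolic_general[OF this] show ?thesis
    using that[of y b] y b(1) by metis
qed

section \<open>Ladders\<close>

text \<open>The family \<open>s\<close> is a parameter so that results can be read again with the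
  numbering \<open>i \<mapsto> n + 1 - i\<close>.\<close>

inductive_set sub :: "(nat \<Rightarrow> pbraid) \<Rightarrow> nat set \<Rightarrow> pbraid set" for s I where
  one [intro, simp]: "1 \<in> sub s I"
| step [intro]: "i \<in> I \<Longrightarrow> a \<in> sub s I \<Longrightarrow> s i * a \<in> sub s I"

lemma sub_gen [intro]: "i \<in> I \<Longrightarrow> s i \<in> sub s I"
  using sub.step[OF _ sub.one, of i I s] by simp

lemma sub_mult [intro]: "a \<in> sub s I \<Longrightarrow> b \<in> sub s I \<Longrightarrow> a * b \<in> sub s I"
  by (induction rule: sub.induct) (auto simp: mult.assoc)

lemma sub_mono: "a \<in> sub s I \<Longrightarrow> I \<subseteq> J \<Longrightarrow> a \<in> sub s J"
  by (induction rule: sub.induct) auto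

lemma sub_cong: "(\<And>i. i \<in> I \<Longrightarrow> s i = t (f i)) \<Longrightarrow> f ` I \<subseteq> J \<Longrightarrow> a \<in> sub s I \<Longrightarrow> a \<in> sub t J"
  by (rotate_tac 2, induction rule: sub.induct) auto

text \<open>Intervals are open at \<open>k\<close> and closed at \<open>l\<close>, so that products
  over neighbouring intervals are glued at the common bound.\<close>

definition up :: "(nat \<Rightarrow> pbraid) \<Rightarrow> nat \<Rightarrow> nat \<Rightarrow> pbraid" where
  "up s k l = prod_list (map s [Suc k..<Suc l])"

definition dn :: "(nat \<Rightarrow> pbraid) \<Rightarrow> nat \<Rightarrow> nat \<Rightarrow> pbraid" where
  "dn s k l = prod_list (map s (rev [Suc k..<Suc l]))"

lemma up_self [simp]: "up s k k = 1" and dn_self [simp]: "dn s k k = 1"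
  by (simp_all add: up_def dn_def)

lemma up_Suc: "k \<le> l \<Longrightarrow> up s k (Suc l) = up s k l * s (Suc l)"
  and dn_Suc: "k \<le> l \<Longrightarrow> dn s k (Suc l) = s (Suc l) * dn s k l"
  by (simp_all add: up_def dn_def)

lemma up_rec: "k < l \<Longrightarrow> up s k l = s (Suc k) * up s (Suc k) l"
  and dn_rec: "k < l \<Longrightarrow> dn s k l = dn s (Suc k) l * s (Suc k)"
  by (simp_all add: up_def dn_def upt_rec[of "Suc k" "Suc l"] del: upt_Suc)

lemma up_split: "k \<le> m \<Longrightarrow> m \<le> l \<Longrightarrow> up s k l = up s k m * up s m l"
  and dn_split: "k \<le> m \<Longrightarrow> m \<le> l \<Longrightarrow> dn s k l = dn s m l * dn s k m"
  using upt_add_eq_append[of "Suc k" "Suc m" "l - m"]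
  by (simp_all add: up_def dn_def del: upt_Suc)

lemma up_in_sub [intro, simp]: "up s k l \<in> sub s {k<..l}"
  and dn_in_sub [intro, simp]: "dn s k l \<in> sub s {k<..l}"
proof -
  have "prod_list (map s xs) \<in> sub s I" if "set xs \<subseteq> I" for xs I
    using that by (induction xs) auto
  note * = this
  show "up s k l \<in> sub s {k<..l}" "dn s k l \<in> sub s {k<..l}"
    unfolding up_def dn_def by (rule *; auto)+
qed

locale braid_generators =
  fixes n :: nat and s :: "nat \<Rightarrow> pbraid"
  assumes n_ge: "n \<ge> 2"
    and braid: "i \<in> {0<..n} \<Longrightarrow> j \<in> {0<..n} \<Longrightarrow> adj i j \<Longrightarrow> s i * s j * s i = s j * s i * s j"
    and commute: "i \<in> {0<..n} \<Longrightarrow> j \<in> {0<..n} \<Longrightarrow> far i j \<Longrightarrow> s i * s j = s j * s i"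
    and len_s: "i \<in> {0<..n} \<Longrightarrow> len (s i) = 1"
begin

lemma commute_sub:
  assumes "a \<in> sub s J" "i \<in> {0<..n}" "J \<subseteq> {0<..n}" "\<And>j. j \<in> J \<Longrightarrow> far i j"
  shows "s i * a = a * s i"
  using assms(1)
proof (induction rule: sub.induct)
  case (step j a)
  have "s i * (s j * a) = s j * (s i * a)"
    using commute[of i j] step(1) assms by (auto simp flip: mult.assoc)
  then show ?case by (simp add: step.IH mult.assoc)
qed simp

text \<open>\<open>s i\<close> commutes past the letters above \<open>Suc i\<close>, one braid
  relation turns it into \<open>s (Suc i)\<close>, and that commutes past the letters below
  \<open>i\<close>.\<close>

lemma dn_shift:
  assumes "k < i" "i < l" "l \<le> n"
  shows "s i * dn s k l = dn s k l * s (Suc i)"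
proof -
  obtain h where h: "i = Suc h" using assms by (cases i) auto
  have split: "dn s k l = dn s (Suc i) l * (s (Suc i) * s i) * dn s k h"
    using assms h dn_split[of k "Suc i" l s] by (simp add: dn_Suc mult.assoc)
  have 1: "s i * dn s (Suc i) l = dn s (Suc i) l * s i"
    using assms by (intro commute_sub[of _ "{Suc i<..l}"]) (auto simp: far_def adj_def)
  have 2: "s (Suc i) * dn s k h = dn s k h * s (Suc i)"
    using assms h by (intro commute_sub[of _ "{k<..h}"]) (auto simp: far_def adj_def)
  have 3: "s i * (s (Suc i) * s i) = (s (Suc i) * s i) * s (Suc i)"
    using braid[of i "Suc i"] assms by (simp add: adj_def mult.assoc)
  have "s i * dn s k l = dn s (Suc i) l * (s i * (s (Suc i) * s i)) * dn s k h"
    by (simp add: split 1 flip: mult.assoc)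
  also have "\<dots> = dn s (Suc i) l * (s (Suc i) * s i) * (s (Suc i) * dn s k h)"
    by (simp add: 3 mult.assoc)
  also have "\<dots> = dn s k l * s (Suc i)" by (simp add: split 2 mult.assoc)
  finally show ?thesis .
qed

lemma up_shift:
  assumes "k < i" "i < l" "l \<le> n"
  shows "up s k l * s i = s (Suc i) * up s k l"
proof -
  obtain h where h: "i = Suc h" using assms by (cases i) auto
  have split: "up s k l = up s k h * (s i * s (Suc i)) * up s (Suc i) l"
    using assms h up_split[of k "Suc i" l s] by (simp add: up_Suc mult.assoc)
  have 1: "s i * up s (Suc i) l = up s (Suc i) l * s i"
    using assms by (intro commute_sub[of _ "{Suc i<..l}"]) (auto simp: far_def adj_def)
  have 2: "s (Suc i) * up s k h = up s k h * s (Suc i)"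
    using assms h by (intro commute_sub[of _ "{k<..h}"]) (auto simp: far_def adj_def)
  have 3: "s i * s (Suc i) * s i = s (Suc i) * (s i * s (Suc i))"
    using braid[of i "Suc i"] assms by (simp add: adj_def mult.assoc)
  have "up s k l * s i = up s k h * (s i * s (Suc i)) * (up s (Suc i) l * s i)"
    by (simp add: split mult.assoc)
  also have "\<dots> = up s k h * (s i * s (Suc i) * s i) * up s (Suc i) l"
    by (simp add: 1[symmetric] mult.assoc)
  also have "\<dots> = (up s k h * s (Suc i)) * (s i * s (Suc i)) * up s (Suc i) l"
    by (subst 3) (simp add: mult.assoc)
  also have "\<dots> = s (Suc i) * up s k l" by (simp add: split 2[symmetric] mult.assoc)
  finally show ?thesis .
qed

text \<open>Conjugation by a ladder moves an interval submonoid by one place. This lemma and its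
  three variants carry a factor across a ladder in either direction.\<close>

lemma dn_shift_sub:
  assumes "a \<in> sub s {k<..<l}" "l \<le> n"
  shows "\<exists>b \<in> sub s {Suc k<..l}. a * dn s k l = dn s k l * b"
  using assms(1)
proof (induction rule: sub.induct)
  case (step i a)
  then obtain b where b: "b \<in> sub s {Suc k<..l}" "a * dn s k l = dn s k l * b" by blast
  have "s i * a * dn s k l = s i * dn s k l * b" by (simp add: b mult.assoc)
  also have "\<dots> = dn s k l * (s (Suc i) * b)" using dn_shift step(1) assms(2) by (simp add: mult.assoc)
  finally show ?case using b step(1) by (intro bexI[of _ "s (Suc i) * b"]) auto
qed (auto intro: bexI[of _ 1])

lemma dn_unshift_sub:
  assumes "b \<in> sub s {Suc k<..l}" "l \<le> n"
  shows "\<exists>a \<in> sub s {k<..<l}. dn s k l * b = a * dn s k l"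
  using assms(1)
proof (induction rule: sub.induct)
  case (step i b)
  then obtain a where a: "a \<in> sub s {k<..<l}" "dn s k l * b = a * dn s k l" by blast
  obtain h where h: "i = Suc h" using step(1) by (cases i) auto
  have "dn s k l * (s i * b) = s h * (dn s k l * b)"
    using dn_shift[of k h l] step(1) assms(2) h by (simp flip: mult.assoc)
  also have "\<dots> = s h * a * dn s k l" by (simp add: a mult.assoc)
  finally show ?case using a step(1) h by (intro bexI[of _ "s h * a"]) auto
qed (auto intro: bexI[of _ 1])

lemma up_shift_sub:
  assumes "a \<in> sub s {k<..<l}" "l \<le> n"
  shows "\<exists>b \<in> sub s {Suc k<..l}. up s k l * a = b * up s k l"
  using assms(1)
proof (induction rule: sub.induct)
  case (step i a)
  then obtain b where b: "b \<in> sub s {Suc k<..l}" "up s k l * a = b * up s k l" by blast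
  have "up s k l * (s i * a) = s (Suc i) * (up s k l * a)"
    using up_shift[of k i l] step(1) assms(2) by (simp flip: mult.assoc)
  also have "\<dots> = s (Suc i) * b * up s k l" by (simp add: b mult.assoc)
  finally show ?case using b step(1) by (intro bexI[of _ "s (Suc i) * b"]) auto
qed (auto intro: bexI[of _ 1])

lemma up_unshift_sub:
  assumes "b \<in> sub s {Suc k<..l}" "l \<le> n"
  shows "\<exists>a \<in> sub s {k<..<l}. b * up s k l = up s k l * a"
  using assms(1)
proof (induction rule: sub.induct)
  case (step i b)
  then obtain a where a: "a \<in> sub s {k<..<l}" "b * up s k l = up s k l * a" by blast
  obtain h where h: "i = Suc h" using step(1) by (cases i) auto
  have "s i * b * up s k l = s i * up s k l * a" by (simp add: a mult.assoc)
  also have "\<dots> = up s k l * (s h * a)"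
    using up_shift[of k h l] step(1) assms(2) h by (simp flip: mult.assoc)
  finally show ?case using a step(1) h by (intro bexI[of _ "s h * a"]) auto
qed (auto intro: bexI[of _ 1])

lemma flip: "braid_generators n (\<lambda>i. s (Suc n - i))"
  by unfold_locales
    (use n_ge in \<open>auto intro!: braid commute len_s[unfolded One_nat_def] simp: adj_def far_def\<close>)

end

section \<open>Positive braids acting on a line\<close>

locale positive_action =
  fixes act :: "pbraid \<Rightarrow> 'x::linorder \<Rightarrow> 'x"
  assumes act_one [simp]: "act 1 x = x"
    and act_mult: "act (a * b) x = act a (act b x)"
    and act_mono: "x < y \<Longrightarrow> act a x < act a y"
    and act_ge: "x \<le> act a x"
begin

lemma act_less_iff [simp]: "act a x < act a y \<longleftrightarrow> x < y"
  by (metis act_mono less_asym linorder_less_linear)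

lemma act_le_iff [simp]: "act a x \<le> act a y \<longleftrightarrow> x \<le> y"
  by (simp flip: not_less)

lemma act_eq_iff [simp]: "act a x = act a y \<longleftrightarrow> x = y"
  by (simp add: order_eq_iff)

lemma act_fix: "a \<in> sub s I \<Longrightarrow> (\<And>i. i \<in> I \<Longrightarrow> act (s i) x = x) \<Longrightarrow> act a x = x"
  by (induction rule: sub.induct) (auto simp: act_mult)

end

text \<open>The base point is kept apart from the sequence \<open>pt\<close>: it stays in place when
  reversing the numbering shifts the sequence (\<open>flip_line\<close>), and it may later be any of
  its members (\<open>rebase\<close>). \<open>not_between\<close> settles the empty braid in the
  inductions.\<close>

locale braid_line = positive_action act + braid_generators n s
  for act :: "pbraid \<Rightarrow> 'x::linorder \<Rightarrow> 'x" and n s +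
  fixes x0 :: 'x and pt :: "int \<Rightarrow> 'x"
  assumes fix_even: "even j \<Longrightarrow> i \<in> {1<..n} \<Longrightarrow> act (s i) (pt j) = pt j"
    and fix_odd: "odd j \<Longrightarrow> i \<in> {0<..<n} \<Longrightarrow> act (s i) (pt j) = pt j"
    and next_even: "even j \<Longrightarrow> act (dn s 0 n) (pt j) = pt (j + 1)"
    and next_odd: "odd j \<Longrightarrow> act (up s 0 n) (pt j) = pt (j + 1)"
    and pt_less: "pt j < pt (j + 1)"
    and not_between: "x0 \<le> pt j \<or> pt (j + 1) \<le> x0"
begin

abbreviation M where "M \<equiv> sub s {0<..n}"

text \<open>The points \<open>pp j n, \<dots>, pp j 0\<close> lead from \<open>pt (j - 1)\<close> up to \<open>pt j\<close> for even \<open>j\<close>.\<close>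

definition pp :: "int \<Rightarrow> nat \<Rightarrow> 'x" where
  "pp j k = act (up s k n) (pt (j - 1))"

lemma pp_0: "even j \<Longrightarrow> pp j 0 = pt j" and pp_n: "pp j n = pt (j - 1)"
  using next_odd[of "j - 1"] by (auto simp: pp_def)

lemma pp_step: "k < n \<Longrightarrow> act (s (Suc k)) (pp j (Suc k)) = pp j k"
  by (simp add: pp_def up_rec[of k n] act_mult)

text \<open>Crossing the product that defines \<open>pp j k\<close>, the letter stays the same if
  \<open>i < k\<close> and becomes \<open>s (i - 1)\<close> otherwise. Either letter fixes
  \<open>pt (j - 1)\<close>, whose index is odd.\<close>

lemma pp_fix:
  assumes "even j" "k \<le> n" "i \<in> {0<..n}" "i \<noteq> k" "i \<noteq> Suc k"
  shows "act (s i) (pp j k) = pp j k"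
proof (cases "i < k")
  case True
  have "s i * up s k n = up s k n * s i"
    using assms True by (intro commute_sub[of _ "{k<..n}"]) (auto simp: far_def adj_def)
  then show ?thesis
    using fix_odd[of "j - 1" i] assms True by (simp add: pp_def flip: act_mult) (simp add: act_mult)
next
  case False
  then obtain h where h: "i = Suc h" "k < h" using assms by (cases i) auto
  have "s i * up s k n = up s k n * s h" using up_shift[of k h n] h assms by simp
  then show ?thesis
    using fix_odd[of "j - 1" h] assms h by (simp add: pp_def flip: act_mult) (simp add: act_mult)
qed

lemma pp_ge: "pt (j - 1) \<le> pp j k"
  by (simp add: pp_def act_ge)

lemma pp_antimono: "k \<le> l \<Longrightarrow> l \<le> n \<Longrightarrow> pp j l \<le> pp j k"
  by (simp add: pp_def up_split[of k l n] act_mult act_ge)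

text \<open>The induction statement. A proper interval fixes \<open>pt j\<close> (if
  \<open>0 < k\<close>) or \<open>pt (j + 1)\<close> (if \<open>k = 0\<close>), which bounds the
  orbit of \<open>pp j k\<close>. For the whole interval \<open>{0<..n}\<close> the orbit contains
  every later point of the sequence, and \<open>b = 1\<close> with \<open>x0 = pt (j + 1)\<close>
  would be a counterexample.\<close>

definition HH :: "pbraid \<Rightarrow> bool" where
  "HH b \<longleftrightarrow> (\<forall>j k l a. even j \<longrightarrow> k < l \<longrightarrow> l \<le> n \<longrightarrow> (0 < k \<or> l < n) \<longrightarrow> a \<in> sub s {k<..l} \<longrightarrow> b \<in> M \<longrightarrow>
     act b x0 < act a (pp j k) \<longrightarrow>
     (\<exists>a' \<in> sub s {k<..l}. \<exists>u \<in> M. b = a' * u \<and> act u x0 \<le> pp j k))"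

lemma HH_D:
  assumes "HH b" "even j" "k < l" "l \<le> n" "0 < k \<or> l < n" "a \<in> sub s {k<..l}" "b \<in> M"
    "act b x0 < act a (pp j k)"
  obtains a' u where "a' \<in> sub s {k<..l}" "u \<in> M" "b = a' * u" "act u x0 \<le> pp j k"
  using assms(1)[unfolded HH_def, rule_format, OF assms(2-8)] that by blast

lemma M_cases:
  assumes "b \<in> M"
  obtains "b = 1" | t b' where "t \<in> {0<..n}" "b' \<in> M" "b = s t * b'" "len b = Suc (len b')"
  using assms by (cases rule: sub.cases) (auto simp: len_s)

lemma sub_M: "a \<in> sub s {k<..l} \<Longrightarrow> l \<le> n \<Longrightarrow> a \<in> M"
  by (erule sub_mono) auto

lemma act_le_mult: "act b x \<le> act (a * b) x"
  by (simp add: act_mult act_ge)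

text \<open>The ladder s_l ... s_(k+1) is the obstruction to lowering the level from l to l-1.\<close>

lemma ladder_split:
  assumes HH: "\<And>b. len b \<le> L \<Longrightarrow> HH b"
    and j: "even j"
  shows "len b \<le> L \<Longrightarrow> b \<in> M \<Longrightarrow> k < l \<Longrightarrow> l \<le> n \<Longrightarrow> 0 < k \<or> l < n \<Longrightarrow>
    act b x0 < act (dn s k l) (pp j k) \<Longrightarrow>
    (\<exists>a \<in> sub s {k<..<l}. \<exists>u \<in> M. b = a * u \<and> act u x0 \<le> pp j k) \<or>
    (\<exists>a \<in> sub s {k<..<l}. \<exists>x \<in> M. b = a * dn s k l * x \<and> act x x0 < pp j k)"
proof (induction l arbitrary: b)
  case (Suc l)
  have low: "(\<exists>a \<in> sub s {k<..<Suc l}. \<exists>u \<in> M. a0 * u0 = a * u \<and> act u x0 \<le> pp j k) \<or>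
    (\<exists>a \<in> sub s {k<..<Suc l}. \<exists>x \<in> M. a0 * u0 = a * dn s k (Suc l) * x \<and> act x x0 < pp j k)"
    (is "?G (a0 * u0)")
    if "a0 \<in> sub s {k<..Suc l}" "u0 \<in> M" "act u0 x0 \<le> pp j k" "len (a0 * u0) \<le> L"
      "act (a0 * u0) x0 < act (dn s k (Suc l)) (pp j k)" for a0 u0
    using that
  \<comment> \<open>The letters of the factor are restored one by one on the left. Only
    \<open>Suc l\<close> lies outside \<open>{k<..<Suc l}\<close> and can force a ladder.\<close>
  proof (induction a0 rule: sub.induct)
    case one
    then show ?case by (intro disjI1 bexI[of _ 1] bexI[of _ u0]) auto
  next
    case (step t a)
    let ?b = "a * u0"
    have bM: "?b \<in> M" using sub_mult[OF sub_M[OF step.hyps(2) Suc.prems(4)] step.prems(1)] .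
    have lenb: "len ?b \<le> L" using step.prems by (simp add: mult.assoc)
    show ?case
    proof (cases "t = Suc l")
      case False
      have "act ?b x0 < act (dn s k (Suc l)) (pp j k)"
        using step.prems(4) act_le_mult[of ?b x0 "s t"] by (simp add: mult.assoc)
      then have "?G ?b" using step.IH step.prems lenb by simp
      then show ?thesis
      proof (elim disjE bexE conjE)
        fix c u assume "c \<in> sub s {k<..<Suc l}" "u \<in> M" "?b = c * u" "act u x0 \<le> pp j k"
        then show ?thesis using False step.hyps(1)
          by (intro disjI1 bexI[of _ "s t * c"] bexI[of _ u]) (auto simp: mult.assoc)
      next
        fix c x assume "c \<in> sub s {k<..<Suc l}" "x \<in> M" "?b = c * dn s k (Suc l) * x" "act x x0 < pp j k"
        then show ?thesis using False step.hyps(1)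
          by (intro disjI2 bexI[of _ "s t * c"] bexI[of _ x]) (auto simp: mult.assoc)
      qed
    next
      case t: True
      \<comment> \<open>\<open>s (Suc l)\<close> is also the first letter of the ladder, so it
        cancels and leaves the bound required at level \<open>l\<close>.\<close>
      have "act (s (Suc l)) (act ?b x0) < act (s (Suc l)) (act (dn s k l) (pp j k))"
        using step.prems(4) t Suc.prems(3) by (simp add: dn_Suc act_mult)
      then have less: "act ?b x0 < act (dn s k l) (pp j k)" by simp
      show ?thesis
      proof (cases "k = l")
        case True
        then show ?thesis using less bM t
          by (intro disjI2 bexI[of _ 1] bexI[of _ ?b]) (auto simp: dn_Suc mult.assoc)
      next
        case False
        then have kl: "k < l" using Suc.prems by simp
        have comm: "s (Suc l) * c = c * s (Suc l)" if "c \<in> sub s {k<..<l}" for c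
          using that Suc.prems by (intro commute_sub[of _ "{k<..<l}"]) (auto simp: far_def adj_def)
        have "(\<exists>a \<in> sub s {k<..<l}. \<exists>u \<in> M. ?b = a * u \<and> act u x0 \<le> pp j k) \<or>
          (\<exists>a \<in> sub s {k<..<l}. \<exists>x \<in> M. ?b = a * dn s k l * x \<and> act x x0 < pp j k)"
          using Suc.IH[of ?b] lenb bM kl Suc.prems less by simp
        then show ?thesis
        proof (elim disjE bexE conjE)
          fix c u assume c: "c \<in> sub s {k<..<l}" "u \<in> M" "?b = c * u" "act u x0 \<le> pp j k"
          have "act (s (Suc l) * u) x0 \<le> act (s (Suc l)) (pp j k)" using c by (simp add: act_mult)
          also have "\<dots> = pp j k" using pp_fix j kl Suc.prems by simp
          finally have "act (s (Suc l) * u) x0 \<le> pp j k" .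
          moreover have "s t * a * u0 = c * (s (Suc l) * u)"
            using comm[OF c(1)] c(3) t by (metis mult.assoc)
          moreover have "c \<in> sub s {k<..<Suc l}" using c(1) by (rule sub_mono) auto
          ultimately show ?thesis using c(2) Suc.prems
            by (intro disjI1 bexI[of _ c] bexI[of _ "s (Suc l) * u"]) auto
        next
          fix c x assume c: "c \<in> sub s {k<..<l}" "x \<in> M" "?b = c * dn s k l * x" "act x x0 < pp j k"
          have "s t * a * u0 = c * dn s k (Suc l) * x"
            using comm[OF c(1)] c(3) t kl by (simp add: dn_Suc) (metis mult.assoc)
          moreover have "c \<in> sub s {k<..<Suc l}" using c(1) by (rule sub_mono) auto
          ultimately show ?thesis using c by (intro disjI2 bexI[of _ c] bexI[of _ x]) auto
        qed
      qed
    qed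
  qed
  obtain a u where "a \<in> sub s {k<..Suc l}" "u \<in> M" "b = a * u" "act u x0 \<le> pp j k"
    using HH_D[OF HH j Suc.prems(3-5) dn_in_sub Suc.prems(2,6)] Suc.prems(1) by blast
  then show ?case using low[of a u] Suc.prems by simp
qed simp

end

section \<open>Reversing the numbering of the generators\<close>

lemma up_flip: "l \<le> n \<Longrightarrow> up (\<lambda>i. s (Suc n - i)) k l = dn s (n - l) (n - k)"
  and dn_flip: "l \<le> n \<Longrightarrow> dn (\<lambda>i. s (Suc n - i)) k l = up s (n - l) (n - k)"
proof -
  have *: "map (\<lambda>i. s (Suc n - i)) [Suc k..<Suc l] = map s (rev [Suc (n - l)..<Suc (n - k)])" if "l \<le> n"
  proof (rule nth_equalityI)
    fix i assume "i < length (map (\<lambda>i. s (Suc n - i)) [Suc k..<Suc l])"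
    then show "map (\<lambda>i. s (Suc n - i)) [Suc k..<Suc l] ! i = map s (rev [Suc (n - l)..<Suc (n - k)]) ! i"
      using that by (auto simp: rev_nth simp del: upt_Suc intro!: arg_cong[of _ _ s])
  qed (use that in auto)
  show "l \<le> n \<Longrightarrow> up (\<lambda>i. s (Suc n - i)) k l = dn s (n - l) (n - k)"
    unfolding up_def dn_def by (simp only: *)
  show "l \<le> n \<Longrightarrow> dn (\<lambda>i. s (Suc n - i)) k l = up s (n - l) (n - k)"
    unfolding up_def dn_def rev_map[symmetric] by (simp only: * rev_map[symmetric] rev_rev_ident)
qed

lemma sub_flip: "l \<le> n \<Longrightarrow> sub (\<lambda>i. s (Suc n - i)) {k<..l} = sub s {n - l<..n - k}"
proof (intro equalityI subsetI)
  fix a assume "l \<le> n" "a \<in> sub (\<lambda>i. s (Suc n - i)) {k<..l}"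
  then show "a \<in> sub s {n - l<..n - k}"
    by (elim sub_cong[rotated 2, where f = "\<lambda>i. Suc n - i"]) auto
next
  fix a assume "l \<le> n" "a \<in> sub s {n - l<..n - k}"
  then show "a \<in> sub (\<lambda>i. s (Suc n - i)) {k<..l}"
    by (elim sub_cong[rotated 2, where f = "\<lambda>i. Suc n - i"]) auto
qed

lemma (in braid_generators) up_mult_up:
  "k \<le> m \<Longrightarrow> m < n \<Longrightarrow> up s k n * up s k m = up s (Suc k) (Suc m) * up s k n"
proof (induction m)
  case (Suc m)
  show ?case
  proof (cases "k = Suc m")
    case False
    then have km: "k \<le> m" using Suc.prems by simp
    have "up s k n * up s k (Suc m) = (up s k n * up s k m) * s (Suc m)"
      using km by (simp add: up_Suc mult.assoc)
    also have "\<dots> = up s (Suc k) (Suc m) * (up s k n * s (Suc m))"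
      using Suc.IH km Suc.prems by (simp add: mult.assoc)
    also have "\<dots> = up s (Suc k) (Suc (Suc m)) * up s k n"
      using up_shift[of k "Suc m" n] km Suc.prems by (simp add: up_Suc[of "Suc k" "Suc m"] mult.assoc)
    finally show ?thesis .
  qed simp
qed simp

context braid_line
begin

text \<open>Reversal exchanges \<open>M\<^sub>1\<close> with \<open>N\<close> and \<open>up\<close>
  with \<open>dn\<close>, which has the effect of shifting the index by one. Statements for even
  \<open>j\<close> thus yield those for odd \<open>j\<close>.\<close>

lemma flip_line: "braid_line act n (\<lambda>i. s (Suc n - i)) x0 (\<lambda>j. pt (j + 1))"
proof -
  interpret F: braid_generators n "\<lambda>i. s (Suc n - i)" by (rule flip)
  show ?thesis
  proof unfold_locales
    fix j i
    show "even j \<Longrightarrow> i \<in> {1<..n} \<Longrightarrow> act (s (Suc n - i)) (pt (j + 1)) = pt (j + 1)"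
      by (rule fix_odd) auto
    show "odd j \<Longrightarrow> i \<in> {0<..<n} \<Longrightarrow> act (s (Suc n - i)) (pt (j + 1)) = pt (j + 1)"
      by (rule fix_even) auto
    show "even j \<Longrightarrow> act (dn (\<lambda>i. s (Suc n - i)) 0 n) (pt (j + 1)) = pt (j + 1 + 1)"
      using next_odd[of "j + 1"] by (simp add: dn_flip)
    show "odd j \<Longrightarrow> act (up (\<lambda>i. s (Suc n - i)) 0 n) (pt (j + 1)) = pt (j + 1 + 1)"
      using next_even[of "j + 1"] by (simp add: up_flip)
    show "pt (j + 1) < pt (j + 1 + 1)" by (rule pt_less)
    show "x0 \<le> pt (j + 1) \<or> pt (j + 1 + 1) \<le> x0" by (rule not_between)
  qed
qed

lemma pp_fix_sub:
  assumes "even j" "k \<le> n" "a \<in> sub s I" "I \<subseteq> {0<..n} - {k, Suc k}"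
  shows "act a (pp j k) = pp j k"
  using assms by (intro act_fix[OF assms(3)] pp_fix) auto

text \<open>The first letter of \<open>b\<close> is absorbed if it lies in the interval, and
  commutes past it if it is far away. For the letter just above, the ladder
  \<open>dn s k (Suc l)\<close> carries the problem to the interval one place higher and to the
  point \<open>pp j (Suc k)\<close>.\<close>

lemma HH_step_right:
  assumes IH: "\<And>b'. len b' < len b \<Longrightarrow> HH b'"
    and j: "even j" and kl: "k < l" "l \<le> n" "0 < k \<or> l < n"
    and a0: "a0 \<in> sub s {k<..l}" and less: "act b x0 < act a0 (pp j k)"
    and t: "t \<in> {0<..n}" "t \<noteq> k" and b: "b = s t * b'" and b': "b' \<in> M"
  shows "\<exists>a \<in> sub s {k<..l}. \<exists>u \<in> M. b = a * u \<and> act u x0 \<le> pp j k"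
proof -
  have len: "len b = Suc (len b')" using b t by (simp add: len_s)
  then have HHb': "HH b'" using IH by simp
  consider "t \<in> {k<..l}" | "t < k \<or> Suc l < t" | "t = Suc l" using t by force
  then show ?thesis
  proof cases
    case 1
    have "act b' x0 < act a0 (pp j k)" using less act_le_mult[of b' x0 "s t"] b by simp
    then obtain a u where "a \<in> sub s {k<..l}" "u \<in> M" "b' = a * u" "act u x0 \<le> pp j k"
      using HH_D[OF HHb' j kl a0 b'] by metis
    then show ?thesis using 1 b by (intro bexI[of _ "s t * a"] bexI[of _ u]) (auto simp: mult.assoc)
  next
    case 2
    have comm: "s t * a = a * s t" if "a \<in> sub s {k<..l}" for a
      using that 2 t kl by (intro commute_sub[OF that]) (auto simp: far_def adj_def)
    have fix_t: "act (s t) (pp j k) = pp j k" using pp_fix[OF j, of k t] kl t 2 by auto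
    have "act (s t) (act b' x0) < act (a0 * s t) (pp j k)"
      using less b fix_t by (simp add: act_mult)
    then have "act b' x0 < act a0 (pp j k)" by (simp flip: comm[OF a0] add: act_mult)
    then obtain a u where au: "a \<in> sub s {k<..l}" "u \<in> M" "b' = a * u" "act u x0 \<le> pp j k"
      using HH_D[OF HHb' j kl a0 b'] by metis
    have "act (s t) (act u x0) \<le> act (s t) (pp j k)" using au(4) by simp
    then have "act (s t * u) x0 \<le> pp j k" using fix_t by (simp add: act_mult)
    moreover have "b = a * (s t * u)" using au(3) b comm[OF au(1)] by (metis mult.assoc)
    ultimately show ?thesis using au t by (intro bexI[of _ a] bexI[of _ "s t * u"]) auto
  next
    case 3
    then have l: "Suc l \<le> n" using t by simp
    let ?v = "dn s k (Suc l)"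
    have v: "?v = s (Suc l) * dn s k l" using kl by (simp add: dn_Suc)
    have "{k<..l} = {k<..<Suc l}" by auto
    then obtain b0 where b0: "b0 \<in> sub s {Suc k<..Suc l}" "a0 * ?v = ?v * b0"
      using dn_shift_sub[of a0 k "Suc l"] a0 l by auto
    have fix_pp: "act b0 (pp j k) = pp j k"
      by (rule pp_fix_sub[OF j _ b0(1)]) (use kl l in auto)
    \<comment> \<open>Inserting the ladder only raises the point, and the ladder turns
      \<open>a0\<close> into \<open>b0\<close>, which fixes \<open>pp j k\<close>. So the arbitrary
      \<open>a0\<close> gives way to the ladder alone.\<close>
    have "act a0 (pp j k) \<le> act (a0 * ?v) (pp j k)" by (simp add: act_mult act_ge)
    also have "\<dots> = act ?v (pp j k)" by (simp add: b0(2) act_mult fix_pp)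
    finally have "act b x0 < act ?v (pp j k)" using less by simp
    then have b'_less: "act b' x0 < act (dn s k l) (pp j k)" using b 3 v by (simp add: act_mult)
    have comm: "s (Suc l) * a = a * s (Suc l)" if "a \<in> sub s {k<..<l}" for a
      using that l by (intro commute_sub[OF that]) (auto simp: far_def adj_def)
    have wide: "a \<in> sub s {k<..l}" if "a \<in> sub s {k<..<l}" for a
      using that by (rule sub_mono) auto
    from ladder_split[of "len b'" j, OF _ j _ b' kl b'_less]
    have "(\<exists>a \<in> sub s {k<..<l}. \<exists>u \<in> M. b' = a * u \<and> act u x0 \<le> pp j k) \<or>
      (\<exists>a \<in> sub s {k<..<l}. \<exists>x \<in> M. b' = a * dn s k l * x \<and> act x x0 < pp j k)"
      using IH len by simp
    then show ?thesis
    proof (elim disjE bexE conjE)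
      fix a u assume au: "a \<in> sub s {k<..<l}" "u \<in> M" "b' = a * u" "act u x0 \<le> pp j k"
      have "act (s (Suc l)) (act u x0) \<le> act (s (Suc l)) (pp j k)" using au(4) by simp
      also have "\<dots> = pp j k" using pp_fix j kl l by simp
      finally have "act (s (Suc l) * u) x0 \<le> pp j k" by (simp add: act_mult)
      moreover have "b = a * (s (Suc l) * u)" using au(3) b 3 comm[OF au(1)] by (metis mult.assoc)
      ultimately show ?thesis using au l wide
        by (intro bexI[of _ a] bexI[of _ "s (Suc l) * u"]) auto
    next
      fix a x assume ax: "a \<in> sub s {k<..<l}" "x \<in> M" "b' = a * dn s k l * x" "act x x0 < pp j k"
      have b_eq: "b = a * (?v * x)" using ax(3) b 3 comm[OF ax(1)] v by (metis mult.assoc)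
      have "?v = dn s (Suc k) (Suc l) * s (Suc k)" using kl by (simp add: dn_rec)
      moreover have "{Suc k<..Suc l} \<subseteq> {0<..n} - {k, Suc k}" using l by auto
      ultimately have v_pp: "act ?v (pp j (Suc k)) = pp j k"
        using pp_step[of k j] kl pp_fix_sub[OF j _ dn_in_sub, of k "Suc k" "Suc l"] l
        by (simp add: act_mult)
      have "act (?v * x) x0 < act a0 (pp j k)"
        using less act_le_mult[of "?v * x" x0 a] b_eq by simp
      also have "\<dots> = act (?v * b0) (pp j (Suc k))"
        by (simp flip: b0(2) v_pp add: act_mult)
      finally have x_less: "act x x0 < act b0 (pp j (Suc k))" by (simp add: act_mult)
      have "len x < len b" using len ax(3) by simp
      \<comment> \<open>This is the statement for a shorter braid one place higher; as
        \<open>Suc k\<close> is positive, the interval is admissible even if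
        \<open>Suc l = n\<close>.\<close>
      then obtain a3 u3 where u3: "a3 \<in> sub s {Suc k<..Suc l}" "u3 \<in> M" "x = a3 * u3"
          "act u3 x0 \<le> pp j (Suc k)"
        using HH_D[OF IH j _ l _ b0(1) ax(2) x_less] kl by auto
      obtain a4 where a4: "a4 \<in> sub s {k<..<Suc l}" "?v * a3 = a4 * ?v"
        using dn_unshift_sub[OF u3(1) l] by blast
      have "a4 \<in> sub s {k<..l}" using a4(1) by (rule sub_mono) auto
      moreover have "b = (a * a4) * (?v * u3)" using b_eq u3(3) a4(2) by (metis mult.assoc)
      moreover have "act ?v (act u3 x0) \<le> act ?v (pp j (Suc k))" using u3(4) by simp
      moreover have "?v \<in> M" by (rule sub_M[OF dn_in_sub l])
      ultimately show ?thesis using wide[OF ax(1)] u3(2) v_pp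
        by (intro bexI[of _ "a * a4"] bexI[of _ "?v * u3"]) (auto simp: act_mult)
    qed
  qed
qed

text \<open>The letter just below the interval does not commute with it. In the reversed numbering
  \<open>pp j k\<close> is reached by a ladder from \<open>pt (j - 1)\<close>, so
  \<open>ladder_split\<close> applies there. The price is a factor from all of
  \<open>{k<..n}\<close>; the gain is the smaller point \<open>pt (j - 1)\<close>.\<close>

lemma HH_step_left:
  assumes IHF: "\<And>b'. len b' < len b \<Longrightarrow> braid_line.HH act n (\<lambda>i. s (Suc n - i)) x0 (\<lambda>j. pt (j + 1)) b'"
    and j: "even j" and kl: "0 < k" "k < l" "l \<le> n"
    and a0: "a0 \<in> sub s {k<..l}" and less: "act b x0 < act a0 (pp j k)"
    and b: "b = s k * b'" and b': "b' \<in> M"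
  shows "\<exists>c \<in> sub s {k<..n}. \<exists>w \<in> M. b = c * w \<and> act w x0 \<le> pt (j - 1)"
proof -
  define s' where "s' = (\<lambda>i. s (Suc n - i))"
  define pt' where "pt' = (\<lambda>j. pt (j + 1))"
  interpret F: braid_line act n s' x0 pt' unfolding s'_def pt'_def by (rule flip_line)
  have len: "len b = Suc (len b')" using b kl by (simp add: len_s)
  have HHF: "F.HH y" if "len y \<le> len b'" for y
    using IHF[of y] that len by (simp add: s'_def pt'_def)
  have MF: "F.M = M" using sub_flip[of n n s 0] by (simp add: s'_def)
  have j': "even (j - 2)" using j by simp
  define d where "d = pt (j - 1)"
  have d0: "F.pp (j - 2) 0 = d" using F.pp_0[OF j'] by (simp add: pt'_def d_def algebra_simps)
  have fix_d: "act a d = d" if "a \<in> sub s {i<..<n}" for a i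
    using that j by (intro act_fix[OF that]) (auto simp: d_def intro!: fix_odd)
  obtain h where h: "k = Suc h" using kl by (cases k) auto
  have hn: "Suc h < n" using kl h by simp
  \<comment> \<open>Passing to the next higher point \<open>pp j h\<close> removes
    \<open>a0\<close>, which fixes it, and lets \<open>s k\<close> cancel.\<close>
  have "act b x0 < pp j h"
  proof -
    note less
    also have "act a0 (pp j k) \<le> act a0 (pp j h)" using pp_antimono[of h k j] h kl by simp
    also have "\<dots> = pp j h" by (rule pp_fix_sub[OF j _ a0]) (use kl h in auto)
    finally show ?thesis .
  qed
  also have "pp j h = act (s k) (pp j k)" using pp_step[of h j] h kl by simp
  finally have "act b' x0 < pp j k" using b by (simp add: act_mult)
  also have "pp j k = act (dn s' 0 (n - k)) (F.pp (j - 2) 0)"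
    using dn_flip[of "n - k" n s 0, folded s'_def] kl by (simp add: pp_def d0) (simp add: d_def)
  finally have b'_less: "act b' x0 < act (dn s' 0 (n - k)) (F.pp (j - 2) 0)" .
  have "{0<..<n - k} = {0<..n - Suc k}" by auto
  then have sub1: "sub s' {0<..<n - k} = sub s {Suc k<..n}"
    using sub_flip[of "n - Suc k" n s 0] kl by (simp add: s'_def)
  have comm: "s k * a = a * s k" if "a \<in> sub s {Suc k<..n}" for a
    using that kl by (intro commute_sub[OF that]) (auto simp: far_def adj_def)
  have wide: "a \<in> sub s {k<..n}" if "a \<in> sub s {Suc k<..n}" for a
    using that by (rule sub_mono) auto
  from F.ladder_split[of "len b'" "j - 2" b' 0 "n - k", OF HHF j' order_refl _ _ _ _ b'_less]
  have "(\<exists>a \<in> sub s {Suc k<..n}. \<exists>u \<in> M. b' = a * u \<and> act u x0 \<le> d) \<or>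
    (\<exists>a \<in> sub s {Suc k<..n}. \<exists>x \<in> M. b' = a * up s k n * x \<and> act x x0 < d)"
    using kl b' dn_flip[of "n - k" n s 0] by (simp add: MF d0 sub1) (simp add: s'_def)
  then show ?thesis
  proof (elim disjE bexE conjE)
    fix c u assume cu: "c \<in> sub s {Suc k<..n}" "u \<in> M" "b' = c * u" "act u x0 \<le> d"
    have "act (s k) (act u x0) \<le> act (s k) d" using cu(4) by simp
    also have "\<dots> = d" by (rule fix_d[of _ 0]) (use kl in auto)
    finally have "act (s k * u) x0 \<le> d" by (simp add: act_mult)
    moreover have "b = c * (s k * u)" using cu(3) b comm[OF cu(1)] by (metis mult.assoc)
    ultimately show ?thesis using cu wide kl
      by (intro bexI[of _ c] bexI[of _ "s k * u"]) (auto simp: d_def)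
  next
    fix c x assume cx: "c \<in> sub s {Suc k<..n}" "x \<in> M" "b' = c * up s k n * x" "act x x0 < d"
    let ?U = "up s h n" and ?V = "up s h (n - 1)"
    have U1: "?U = s k * up s k n" using h kl by (simp add: up_rec)
    have U2: "?U = ?V * s n" using up_Suc[of h "n - 1" s] hn by simp
    have b_eq: "b = c * (?U * x)" using cx(3) b comm[OF cx(1)] U1 by (metis mult.assoc)
    \<comment> \<open>In the reversed numbering \<open>p\<close> precedes \<open>d\<close>: the last
      letter \<open>s n\<close> of \<open>?U\<close> leads from \<open>p\<close> to
      \<open>d\<close>, and the other letters of \<open>?U\<close> fix \<open>d\<close>.\<close>
    define p where "p = F.pp (j - 2) 1"
    have "act (s n) p = d"
      using F.pp_step[of 0 "j - 2"] d0 hn by (simp add: p_def s'_def)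
    moreover have V: "?V \<in> sub s {h<..<n}" by (rule sub_mono[OF up_in_sub]) (use hn in auto)
    ultimately have Up: "act ?U p = d" using fix_d[OF V] by (simp add: U2 act_mult)
    have "pp j k = act (up s k n * ?U) p" by (simp add: pp_def d_def[symmetric] act_mult Up)
    \<comment> \<open>With \<open>?U\<close> in front it can be cancelled from the inequality for
      \<open>x\<close>.\<close>
    also have "up s k n * ?U = ?U * ?V" using up_mult_up[of h "n - 1"] hn h by simp
    finally have pp_eq: "pp j k = act (?U * ?V) p" .
    have "a0 \<in> sub s {Suc h<..n}" using a0 by (rule sub_mono) (use kl h in auto)
    then obtain a1 where a1: "a1 \<in> sub s {h<..<n}" "a0 * ?U = ?U * a1"
      using up_unshift_sub by blast
    have "act (?U * x) x0 < act a0 (pp j k)"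
      using less act_le_mult[of "?U * x" x0 c] b_eq by simp
    also have "\<dots> = act (a0 * ?U * ?V) p" by (simp add: pp_eq act_mult)
    also have "\<dots> = act ?U (act (a1 * ?V) p)" by (simp add: a1(2) act_mult)
    finally have x_less: "act x x0 < act (a1 * ?V) p" by (simp add: act_mult)
    have "a1 * ?V \<in> sub s {h<..<n}" using a1 V by blast
    moreover have "{h<..<n} = {h<..n - 1}" using hn by auto
    then have sub2: "sub s' {1<..n - h} = sub s {h<..<n}"
      using sub_flip[of "n - h" n s 1] hn by (simp add: s'_def)
    ultimately have aV: "a1 * ?V \<in> sub s' {1<..n - h}" by simp
    have "F.HH x" by (rule HHF) (use cx in simp)
    moreover have "1 < n - h" using hn by simp
    ultimately obtain a4 u where a4: "a4 \<in> sub s {h<..<n}" "u \<in> M" "x = a4 * u" "act u x0 \<le> p"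
      using F.HH_D[OF _ j' _ _ _ aV _ x_less[unfolded p_def]] cx(2) sub2 MF
      by (auto simp: p_def)
    obtain a5 where a5: "a5 \<in> sub s {k<..n}" "?U * a4 = a5 * ?U"
      using up_shift_sub[OF a4(1)] h by auto
    have "act ?U (act u x0) \<le> act ?U p" using a4(4) by simp
    then have "act (?U * u) x0 \<le> d" using Up by (simp add: act_mult)
    moreover have "b = (c * a5) * (?U * u)" using b_eq a4(3) a5(2) by (metis mult.assoc)
    moreover have "?U * u \<in> M" using sub_M[OF up_in_sub] a4(2) by blast
    ultimately show ?thesis using wide[OF cx(1)] a5(1)
      by (intro bexI[of _ "c * a5"] bexI[of _ "?U * u"]) (auto simp: d_def)
  qed
qed

lemma HH_step:
  assumes IH: "\<And>b'. len b' < len b \<Longrightarrow> HH b'"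
    and IHF: "\<And>b'. len b' < len b \<Longrightarrow> braid_line.HH act n (\<lambda>i. s (Suc n - i)) x0 (\<lambda>j. pt (j + 1)) b'"
  shows "HH b"
  unfolding HH_def
proof (intro allI impI)
  fix j k l a0
  assume j: "even j" and kl: "k < l" "l \<le> n" "0 < k \<or> l < n" and a0: "a0 \<in> sub s {k<..l}"
    and bM: "b \<in> M" and less: "act b x0 < act a0 (pp j k)"
  show "\<exists>a \<in> sub s {k<..l}. \<exists>u \<in> M. b = a * u \<and> act u x0 \<le> pp j k"
  proof (cases "act b x0 \<le> pp j k")
    case True
    then show ?thesis using bM by (intro bexI[of _ 1] bexI[of _ b]) auto
  next
    case False
    then have gt: "pp j k < act b x0" by simp
    from bM show ?thesis
    proof (cases rule: M_cases)
      case 1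
      \<comment> \<open>For \<open>b = 1\<close> the bound on the orbit puts \<open>x0\<close>
        strictly between two consecutive points.\<close>
      have "\<exists>i. pt i < x0 \<and> x0 < pt (i + 1)"
      proof (cases "k = 0")
        case True
        then have "act a0 (pp j k) = act a0 (pt j)" using pp_0[OF j] by simp
        also have "\<dots> \<le> act a0 (pt (j + 1))" using pt_less[of j] by simp
        also have "\<dots> = pt (j + 1)"
          by (rule act_fix[OF a0]) (use fix_odd[of "j + 1"] j kl True in auto)
        finally show ?thesis using 1 less gt True pp_0[OF j] by (intro exI[of _ j]) simp
      next
        case False
        have "act a0 (pp j k) \<le> act a0 (pp j 0)" using pp_antimono[of 0 k j] kl by simp
        also have "\<dots> = pp j 0" by (rule pp_fix_sub[OF j _ a0]) (use kl False in auto)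
        finally have "x0 < pt j" using 1 less pp_0[OF j] by simp
        moreover have "pt (j - 1) < x0" using gt 1 pp_ge[of j k] by simp
        ultimately show ?thesis by (intro exI[of _ "j - 1"]) simp
      qed
      then show ?thesis using not_between leD by metis
    next
      case (2 t b')
      show ?thesis
      proof (cases "t = k")
        case False
        then show ?thesis using HH_step_right[OF IH j kl a0 less] 2 by blast
      next
        case True
        \<comment> \<open>This factorisation serves to find another first letter: \<open>c\<close>
          cannot be 1, since \<open>b\<close> moves \<open>x0\<close> above \<open>pp j k\<close>,
          and its letters exceed \<open>k\<close>, so \<open>HH_step_right\<close> applies.\<close>
        then obtain c w where cw: "c \<in> sub s {k<..n}" "w \<in> M" "b = c * w" "act w x0 \<le> pt (j - 1)"
          using HH_step_left[OF IHF j _ kl(1,2) a0 less _ 2(2)] 2 by auto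
        from cw(1) show ?thesis
        proof (cases rule: sub.cases)
          case one
          then have "act b x0 \<le> pp j k" using cw pp_ge[of j k] by (auto intro: order_trans)
          then show ?thesis using gt by simp
        next
          case (step t' c')
          have "c' * w \<in> M" using sub_M[OF step(3)] cw(2) by blast
          moreover have "b = s t' * (c' * w)" using cw(3) step by (simp add: mult.assoc)
          ultimately show ?thesis using HH_step_right[OF IH j kl a0 less, of t'] step(2) by auto
        qed
      qed
    qed
  qed
qed

end

text \<open>A line and its reversal share one induction on the length, since each step for one uses
  shorter braids for the other.\<close>

lemma (in positive_action) HH_all: "braid_line act n s x0 pt \<Longrightarrow> braid_line.HH act n s x0 pt b"
proof (induction "len b" arbitrary: b s pt rule: less_induct)
  case less
  interpret braid_line act n s x0 pt by fact
  show ?case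
    by (rule HH_step) (use less flip_line in blast)+
qed

section \<open>Descending from one point of the sequence to the previous one\<close>

context braid_line
begin

lemma HH: "HH b"
  using HH_all braid_line_axioms .

text \<open>Strengthens \<open>HH\<close> for \<open>k = 0\<close> and \<open>l = n - 1\<close>: the
  bound \<open>pt (j + 1)\<close> lies above the whole orbit of \<open>pt j\<close> under
  \<open>N\<close>.\<close>

definition lower_even :: "pbraid \<Rightarrow> bool" where
  "lower_even b \<longleftrightarrow> (\<forall>j. even j \<longrightarrow> b \<in> M \<longrightarrow> act b x0 < pt (j + 1) \<longrightarrow>
     (\<exists>a \<in> sub s {0<..<n}. \<exists>u \<in> M. b = a * u \<and> act u x0 \<le> pt j))"

lemma lower_step:
  assumes IH: "\<And>b'. len b' < len b \<Longrightarrow> lower_even b'"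
    and IHF: "\<And>b'. len b' < len b \<Longrightarrow>
      braid_line.lower_even act n (\<lambda>i. s (Suc n - i)) x0 (\<lambda>j. pt (j + 1)) b'"
  shows "lower_even b"
  unfolding lower_even_def
proof (intro allI impI)
  fix j :: int
  assume j: "even j" and bM: "b \<in> M" and less: "act b x0 < pt (j + 1)"
  from bM show "\<exists>a \<in> sub s {0<..<n}. \<exists>u \<in> M. b = a * u \<and> act u x0 \<le> pt j"
  proof (cases rule: M_cases)
    case 1
    then show ?thesis using less not_between[of j] by (intro bexI[of _ 1]) auto
  next
    case (2 t b')
    show ?thesis
    proof (cases "t = n")
      case False
      have "act b' x0 < pt (j + 1)" using less act_le_mult[of b' x0 "s t"] 2 by simp
      then obtain a u where "a \<in> sub s {0<..<n}" "u \<in> M" "b' = a * u" "act u x0 \<le> pt j"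
        using IH[of b'] 2 j unfolding lower_even_def by auto
      then show ?thesis using 2 False
        by (intro bexI[of _ "s t * a"] bexI[of _ u]) (auto simp: mult.assoc)
    next
      case t: True
      have nn: "Suc (n - 1) = n" "0 < n - 1" "n - 1 < n" using n_ge by auto
      have v: "dn s 0 n = s n * dn s 0 (n - 1)" using dn_Suc[of 0 "n - 1" s] nn by simp
      \<comment> \<open>\<open>pt (j + 1)\<close> is the full ladder applied to \<open>pt j\<close>;
        the top letter of that ladder cancels.\<close>
      have "act (s n) (act b' x0) < act (s n) (act (dn s 0 (n - 1)) (pp j 0))"
        using less 2 t v next_even[OF j] pp_0[OF j] by (simp flip: act_mult)
      then have b'_less: "act b' x0 < act (dn s 0 (n - 1)) (pp j 0)" by simp
      have comm: "s n * a = a * s n" if "a \<in> sub s {0<..<n - 1}" for a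
        using that n_ge by (intro commute_sub[OF that]) (auto simp: far_def adj_def)
      have wide: "a \<in> sub s {0<..<n}" if "a \<in> sub s {0<..<n - 1}" for a
        using that by (rule sub_mono) auto
      from ladder_split[of "len b'" j b' 0 "n - 1", OF HH j order_refl 2(2) nn(2) _ _ b'_less]
      have "(\<exists>a \<in> sub s {0<..<n - 1}. \<exists>u \<in> M. b' = a * u \<and> act u x0 \<le> pp j 0) \<or>
        (\<exists>a \<in> sub s {0<..<n - 1}. \<exists>x \<in> M. b' = a * dn s 0 (n - 1) * x \<and> act x x0 < pp j 0)"
        using nn by simp
      then show ?thesis
      proof (elim disjE bexE conjE)
        fix a u assume au: "a \<in> sub s {0<..<n - 1}" "u \<in> M" "b' = a * u" "act u x0 \<le> pp j 0"
        have "act (s n) (act u x0) \<le> act (s n) (pt j)" using au(4) pp_0[OF j] by simp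
        also have "\<dots> = pt j" using fix_even[OF j, of n] n_ge by simp
        finally have "act (s n * u) x0 \<le> pt j" by (simp add: act_mult)
        moreover have "b = a * (s n * u)" using au(3) 2 t comm[OF au(1)] by (metis mult.assoc)
        ultimately show ?thesis using au wide n_ge
          by (intro bexI[of _ a] bexI[of _ "s n * u"]) auto
      next
        fix a x assume ax: "a \<in> sub s {0<..<n - 1}" "x \<in> M" "b' = a * dn s 0 (n - 1) * x"
          "act x x0 < pp j 0"
        define s' where "s' = (\<lambda>i. s (Suc n - i))"
        define pt' where "pt' = (\<lambda>j. pt (j + 1))"
        interpret F: braid_line act n s' x0 pt' unfolding s'_def pt'_def by (rule flip_line)
        have b_eq: "b = a * (dn s 0 n * x)" using ax(3) 2 t comm[OF ax(1)] v by (metis mult.assoc)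
        have MF: "F.M = M" using sub_flip[of n n s 0] by (simp add: s'_def)
        have "{0<..<n} = {0<..n - 1}" by auto
        then have KF: "sub s' {0<..<n} = sub s {Suc 0<..n}"
          using sub_flip[of "n - 1" n s 0] n_ge by (simp add: s'_def)
        \<comment> \<open>In the reversed numbering \<open>x\<close> gives up a factor from
          \<open>M\<^sub>1\<close>, which the ladder turns into one from \<open>N\<close>.\<close>
        have "F.lower_even x" using IHF[of x] 2 ax(3) by (simp add: s'_def pt'_def)
        note low = this[unfolded F.lower_even_def MF KF, rule_format, of "j - 2"]
        have "act x x0 < pt' (j - 2 + 1)" using ax(4) pp_0[OF j] by (simp add: pt'_def)
        then obtain m u where mu: "m \<in> sub s {Suc 0<..n}" "u \<in> M" "x = m * u"
            "act u x0 \<le> pt (j - 1)"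
          using low j ax(2) by (auto simp: pt'_def)
        obtain m' where m': "m' \<in> sub s {0<..<n}" "dn s 0 n * m = m' * dn s 0 n"
          using dn_unshift_sub[OF mu(1)] by auto
        \<comment> \<open>\<open>s 1\<close> fixes \<open>pt (j - 1)\<close> and the other letters
          of the ladder fix \<open>pt j\<close>, so the ladder lifts the remainder at most to
          \<open>pt j\<close>.\<close>
        have "act (s 1) (act u x0) \<le> act (s 1) (pt (j - 1))" using mu(4) by simp
        also have "\<dots> = pt (j - 1)" using fix_odd[of "j - 1" 1] j n_ge by simp
        also have "\<dots> \<le> pt j" using pt_less[of "j - 1"] by simp
        finally have "act (dn s 1 n) (act (s 1) (act u x0)) \<le> act (dn s 1 n) (pt j)" by simp
        also have "\<dots> = pt j"
          by (rule act_fix[OF dn_in_sub]) (use j in \<open>auto intro!: fix_even\<close>)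
        finally have "act (dn s 0 n * u) x0 \<le> pt j"
          using dn_rec[of 0 n s] n_ge by (simp add: act_mult)
        moreover have "b = (a * m') * (dn s 0 n * u)" using b_eq mu(3) m'(2) by (metis mult.assoc)
        ultimately show ?thesis using wide[OF ax(1)] m'(1) mu(2)
          by (intro bexI[of _ "a * m'"] bexI[of _ "dn s 0 n * u"]) auto
      qed
    qed
  qed
qed

end

lemma (in positive_action) lower_all:
  "braid_line act n s x0 pt \<Longrightarrow> braid_line.lower_even act n s x0 pt b"
proof (induction "len b" arbitrary: b s pt rule: less_induct)
  case less
  interpret braid_line act n s x0 pt by fact
  show ?case
    by (rule lower_step) (use less flip_line in blast)+
qed

section \<open>Alternating products and the points they can reach\<close>

definition par :: "nat \<Rightarrow> int \<Rightarrow> nat set" where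
  "par n j = (if even j then {1<..n} else {0<..<n})"

text \<open>The ladder that leads from \<open>pt (j - 1)\<close> to \<open>pt j\<close>.\<close>

definition ladder :: "(nat \<Rightarrow> pbraid) \<Rightarrow> nat \<Rightarrow> int \<Rightarrow> pbraid" where
  "ladder s n j = (if even j then up s 0 n else dn s 0 n)"

text \<open>Factors may be 1, and \<open>m\<close> counts those to the left of the rightmost one. So
  \<open>Suc m\<close> factors occur, and the sets increase with \<open>m\<close>.\<close>

fun chain :: "(nat \<Rightarrow> pbraid) \<Rightarrow> nat \<Rightarrow> int \<Rightarrow> nat \<Rightarrow> pbraid set" where
  "chain s n i 0 = sub s (par n i)"
| "chain s n i (Suc m) = {c * u | c u. c \<in> sub s (par n (i + int m + 1)) \<and> u \<in> chain s n i m}"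

context braid_line
begin

lemma lower:
  assumes "b \<in> M" "act b x0 < pt (j + 1)"
  shows "\<exists>a \<in> sub s (par n (j + 1)). \<exists>u \<in> M. b = a * u \<and> act u x0 \<le> pt j"
proof (cases "even j")
  case True
  then show ?thesis using lower_all[OF braid_line_axioms, of b] assms
    unfolding lower_even_def by (simp add: par_def)
next
  case False
  define s' where "s' = (\<lambda>i. s (Suc n - i))"
  define pt' where "pt' = (\<lambda>j. pt (j + 1))"
  interpret F: braid_line act n s' x0 pt' unfolding s'_def pt'_def by (rule flip_line)
  have MF: "F.M = M" using sub_flip[of n n s 0] by (simp add: s'_def)
  have "{0<..<n} = {0<..n - 1}" by auto
  then have KF: "sub s' {0<..<n} = sub s {Suc 0<..n}"
    using sub_flip[of "n - 1" n s 0] n_ge by (simp add: s'_def)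
  have "act b x0 < pt' (j - 1 + 1)" using assms by (simp add: pt'_def)
  then show ?thesis
    using lower_all[OF F.braid_line_axioms, of b, unfolded F.lower_even_def MF KF, rule_format, of "j - 1"]
      False assms(1) by (simp add: pt'_def par_def)
qed

text \<open>If \<open>s 1\<close> fixed the point, all generators would, and no ladder could lead to
  the next one.\<close>

lemma moved_even: "even j \<Longrightarrow> pt j < act (s 1) (pt j)"
proof (rule ccontr)
  assume j: "even j" and "\<not> pt j < act (s 1) (pt j)"
  then have "act (s 1) (pt j) = pt j" using act_ge[of "pt j" "s 1"] by simp
  then have "act (s i) (pt j) = pt j" if "i \<in> {0<..n}" for i
    using fix_even[OF j, of i] that by (cases "i = 1") auto
  then have "act (dn s 0 n) (pt j) = pt j" using act_fix[OF dn_in_sub] by blast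
  then show False using next_even[OF j] pt_less[of j] by simp
qed

text \<open>The case of equality in the descent. \<open>HH\<close> asks for a strict bound, so the
  point is raised by one more \<open>s 1\<close>. In the factor obtained, letters below the top of
  the ladder pass through it and then fix \<open>pt j\<close>, while the top letter cancels and
  shortens the ladder.\<close>

lemma ladder_eq_even:
  assumes j: "even j"
  shows "0 < l \<Longrightarrow> l < n \<Longrightarrow> b \<in> M \<Longrightarrow> act b x0 = act (dn s 0 l) (pt j) \<Longrightarrow>
    \<exists>u \<in> M. b = dn s 0 l * u \<and> act u x0 = pt j"
proof (induction l arbitrary: b)
  case (Suc l)
  let ?v = "dn s 0 (Suc l)"
  have gt: "pt j < act ?v (pt j)"
  proof -
    have "pt j < act (s 1) (pt j)" by (rule moved_even[OF j])
    also have "\<dots> \<le> act (dn s 1 (Suc l)) (act (s 1) (pt j))" by (rule act_ge)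
    also have "\<dots> = act ?v (pt j)" using dn_rec[of 0 "Suc l" s] by (simp add: act_mult)
    finally show ?thesis .
  qed
  have low: "\<exists>u \<in> M. a * u0 = ?v * u \<and> act u x0 = pt j"
    if "a \<in> sub s {0<..Suc l}" "u0 \<in> M" "act u0 x0 \<le> pt j" "act (a * u0) x0 = act ?v (pt j)" for a u0
    using that
  proof (induction a rule: sub.induct)
    case one
    then show ?case using gt by simp
  next
    case (step t a)
    have aM: "a * u0 \<in> M" using sub_mult[OF sub_M[OF step.hyps(2)] step.prems(1)] Suc.prems by simp
    show ?case
    proof (cases "t = Suc l")
      case False
      then have tl: "0 < t" "t < Suc l" using step.hyps by auto
      have shift: "s t * ?v = ?v * s (Suc t)" using dn_shift[of 0 t "Suc l"] tl Suc.prems by simp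
      have fix_t: "act (s (Suc t)) (pt j) = pt j" using fix_even[OF j, of "Suc t"] tl Suc.prems by simp
      then have "act (s t) (act ?v (pt j)) = act ?v (pt j)"
        using shift by (metis act_mult)
      then have "act (s t) (act (a * u0) x0) = act (s t) (act ?v (pt j))"
        using step.prems(3) by (simp add: act_mult mult.assoc)
      then obtain u where u: "u \<in> M" "a * u0 = ?v * u" "act u x0 = pt j"
        using step.IH[OF step.prems(1,2)] by auto
      have "s t * a * u0 = ?v * (s (Suc t) * u)" using u(2) shift by (metis mult.assoc)
      then show ?thesis using u fix_t tl Suc.prems
        by (intro bexI[of _ "s (Suc t) * u"]) (auto simp: act_mult)
    next
      case True
      have v: "?v = s (Suc l) * dn s 0 l" by (simp add: dn_Suc)
      have "act (s (Suc l)) (act (a * u0) x0) = act (s (Suc l)) (act (dn s 0 l) (pt j))"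
        using step.prems(3) True v by (simp add: act_mult)
      then have eq: "act (a * u0) x0 = act (dn s 0 l) (pt j)" by simp
      have "\<exists>u \<in> M. a * u0 = dn s 0 l * u \<and> act u x0 = pt j"
      proof (cases "l = 0")
        case True
        then show ?thesis using eq aM by auto
      next
        case False
        then show ?thesis using Suc.IH[OF _ _ aM eq] Suc.prems by simp
      qed
      then show ?thesis using True v by (auto simp: mult.assoc)
    qed
  qed
  have "act b x0 < act (?v * s 1) (pp j 0)"
    using Suc.prems(4) moved_even[OF j] pp_0[OF j] by (simp add: act_mult)
  moreover have "?v * s 1 \<in> sub s {0<..Suc l}" by (intro sub_mult dn_in_sub sub_gen) simp
  ultimately obtain a u where "a \<in> sub s {0<..Suc l}" "u \<in> M" "b = a * u" "act u x0 \<le> pp j 0"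
    using HH_D[OF HH j _ _ _ _ Suc.prems(3), of 0 "Suc l" "?v * s 1"] Suc.prems by auto
  then show ?case using low[of a u] Suc.prems pp_0[OF j] by simp
qed simp

lemma level_eq_even:
  assumes j: "even j" and x0: "x0 < pt (j + 1)"
  shows "b \<in> M \<Longrightarrow> act b x0 = pt (j + 1) \<Longrightarrow> \<exists>u \<in> M. b = dn s 0 n * u \<and> act u x0 = pt j"
proof (induction rule: sub.induct)
  case one
  then show ?case using x0 by simp
next
  case (step t b)
  show ?case
  proof (cases "t = n")
    case False
    then have t: "0 < t" "t < n" using step.hyps by auto
    have shift: "s t * dn s 0 n = dn s 0 n * s (Suc t)" using dn_shift[of 0 t n] t by simp
    have fix_t: "act (s (Suc t)) (pt j) = pt j" using fix_even[OF j, of "Suc t"] t by simp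
    have "act (s t) (pt (j + 1)) = pt (j + 1)" using fix_odd[of "j + 1" t] j t by simp
    then have "act (s t) (act b x0) = act (s t) (pt (j + 1))" using step.prems by (simp add: act_mult)
    then obtain u where u: "u \<in> M" "b = dn s 0 n * u" "act u x0 = pt j" using step.IH by auto
    have "s t * b = dn s 0 n * (s (Suc t) * u)" using u(2) shift by (metis mult.assoc)
    then show ?thesis using u fix_t t by (intro bexI[of _ "s (Suc t) * u"]) (auto simp: act_mult)
  next
    case True
    have v: "dn s 0 n = s n * dn s 0 (n - 1)" using dn_Suc[of 0 "n - 1" s] n_ge by simp
    have "act (s n) (act b x0) = act (s n) (act (dn s 0 (n - 1)) (pt j))"
      using step.prems True next_even[OF j] v by (simp add: act_mult)
    then obtain u where "u \<in> M" "b = dn s 0 (n - 1) * u" "act u x0 = pt j"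
      using ladder_eq_even[OF j _ _ step.hyps(2), of "n - 1"] n_ge by auto
    then show ?thesis using True v by (intro bexI[of _ u]) (auto simp: mult.assoc)
  qed
qed

lemma level_eq:
  assumes "x0 < pt (j + 1)" "b \<in> M" "act b x0 = pt (j + 1)"
  shows "\<exists>u \<in> M. b = ladder s n (j + 1) * u \<and> act u x0 = pt j"
proof (cases "even j")
  case True
  then show ?thesis using level_eq_even[OF True assms] by (simp add: ladder_def)
next
  case False
  define s' where "s' = (\<lambda>i. s (Suc n - i))"
  define pt' where "pt' = (\<lambda>j. pt (j + 1))"
  interpret F: braid_line act n s' x0 pt' unfolding s'_def pt'_def by (rule flip_line)
  have MF: "F.M = M" using sub_flip[of n n s 0] by (simp add: s'_def)
  have "\<exists>u \<in> M. b = dn s' 0 n * u \<and> act u x0 = pt' (j - 1)"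
    by (rule F.level_eq_even[unfolded MF]) (use False assms in \<open>auto simp: pt'_def\<close>)
  then show ?thesis using False dn_flip[of n n s 0] by (simp add: pt'_def ladder_def s'_def)
qed

lemma moved: "t \<in> {0<..n} \<Longrightarrow> act (s t) (pt j) = pt j \<Longrightarrow> t \<in> par n j"
proof (cases "even j")
  case True
  then show "t \<in> {0<..n} \<Longrightarrow> act (s t) (pt j) = pt j \<Longrightarrow> t \<in> par n j"
    using moved_even[OF True] by (cases "t = 1") (auto simp: par_def)
next
  case False
  interpret F: braid_line act n "\<lambda>i. s (Suc n - i)" x0 "\<lambda>j. pt (j + 1)" by (rule flip_line)
  show "t \<in> {0<..n} \<Longrightarrow> act (s t) (pt j) = pt j \<Longrightarrow> t \<in> par n j"
    using F.moved_even[of "j - 1"] False by (cases "t = n") (auto simp: par_def)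
qed

lemma fix_par: "a \<in> sub s (par n j) \<Longrightarrow> act a (pt j) = pt j"
  by (rule act_fix, assumption) (use fix_even[of j] fix_odd[of j] in \<open>auto simp: par_def split: if_splits\<close>)

text \<open>No letter moves a point down, so if a product fixes \<open>pt j\<close>, each of its
  letters does.\<close>

lemma stabilizer: "b \<in> M \<Longrightarrow> act b (pt j) = pt j \<Longrightarrow> b \<in> sub s (par n j)"
proof (induction rule: sub.induct)
  case (step t b)
  have "act b (pt j) \<le> act (s t) (act b (pt j))" by (rule act_ge)
  then have b: "act b (pt j) = pt j" using step.prems act_ge[of "pt j" b] by (simp add: act_mult)
  then show ?case using step moved[of t j] by (auto simp: act_mult)
qed simp

lemma pt_mono: "i < j \<Longrightarrow> pt i < pt j"
proof (induction j rule: int_gr_induct)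
  case base
  then show ?case using pt_less by simp
next
  case (step j)
  then show ?case using pt_less[of j] by simp
qed

lemma pt_mono_le: "i \<le> j \<Longrightarrow> pt i \<le> pt j"
  using pt_mono[of i j] by (cases "i = j") auto

lemma rebase: "braid_line act n s (pt i) pt"
proof unfold_locales
  fix j show "pt i \<le> pt j \<or> pt (j + 1) \<le> pt i"
    using pt_mono_le[of i j] pt_mono_le[of "j + 1" i] by linarith
qed (use fix_even fix_odd next_even next_odd pt_less in auto)

lemma par_subset: "par n j \<subseteq> {0<..n}"
  by (auto simp: par_def)

lemma chain_M: "b \<in> chain s n i m \<Longrightarrow> b \<in> M"
proof (induction m arbitrary: b)
  case 0
  then show ?case using sub_mono[OF _ par_subset] by simp
next
  case (Suc m)
  then show ?case using sub_mono[OF _ par_subset] by auto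
qed

lemma chain_absorb: "c \<in> sub s (par n (i + int m)) \<Longrightarrow> u \<in> chain s n i m \<Longrightarrow> c * u \<in> chain s n i m"
proof (cases m)
  case (Suc m')
  assume c: "c \<in> sub s (par n (i + int m))" and "u \<in> chain s n i m"
  then obtain d w where "d \<in> sub s (par n (i + int m))" "w \<in> chain s n i m'" "u = d * w"
    using Suc by (auto simp: add_ac)
  then have "c * d \<in> sub s (par n (i + int m))" "c * u = (c * d) * w" using c by (auto simp: mult.assoc)
  then show ?thesis using Suc \<open>w \<in> _\<close> by (auto simp: add_ac)
qed auto

lemma chain_Suc: "u \<in> chain s n i m \<Longrightarrow> u \<in> chain s n i (Suc m)"
  unfolding chain.simps mem_Collect_eq by (rule exI[of _ 1], rule exI[of _ u]) simp

text \<open>An end letter lies in one submonoid and the rest of the ladder in the other.\<close>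

lemma ladder_par: "ladder s n j \<in> (\<lambda>(a, b). a * b) ` (sub s (par n (j + 1)) \<times> sub s (par n j))"
proof (cases "even j")
  case True
  have "{1<..n} = par n j" using True by (simp add: par_def)
  then have "up s 1 n \<in> sub s (par n j)" using up_in_sub by metis
  moreover have "s 1 \<in> sub s (par n (j + 1))" using True n_ge by (auto simp: par_def)
  moreover have "ladder s n j = s 1 * up s 1 n" using True n_ge up_rec[of 0 n s] by (simp add: ladder_def)
  ultimately show ?thesis by force
next
  case False
  have "{0<..n - 1} = par n j" using False n_ge by (auto simp: par_def)
  then have "dn s 0 (n - 1) \<in> sub s (par n j)" using dn_in_sub by metis
  moreover have "s n \<in> sub s (par n (j + 1))" using False n_ge by (auto simp: par_def)
  moreover have "ladder s n j = s n * dn s 0 (n - 1)"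
    using False n_ge dn_Suc[of 0 "n - 1" s] by (simp add: ladder_def)
  ultimately show ?thesis by force
qed

lemma chain_eq:
  "b \<in> M \<Longrightarrow> act b (pt i) = pt (i + int m) \<Longrightarrow> b \<in> chain s n i (Suc m)"
proof (induction m arbitrary: b)
  case 0
  then have "b \<in> chain s n i 0" using stabilizer by simp
  then show ?case by (rule chain_Suc)
next
  case (Suc m)
  interpret B: braid_line act n s "pt i" pt by (rule rebase)
  obtain u where u: "u \<in> M" "b = ladder s n (i + int (Suc m)) * u" "act u (pt i) = pt (i + int m)"
    using B.level_eq[of "i + int m" b] Suc.prems pt_mono[of i "i + int m + 1"] by (auto simp: add_ac)
  obtain c d where cd: "c \<in> sub s (par n (i + int (Suc m) + 1))" "d \<in> sub s (par n (i + int (Suc m)))"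
      "ladder s n (i + int (Suc m)) = c * d"
    using ladder_par[of "i + int (Suc m)"] by auto
  \<comment> \<open>The right part of the ladder merges with the leftmost factor of
    \<open>u\<close>, so a whole ladder costs only one new factor.\<close>
  have "d * u \<in> chain s n i (Suc m)" using chain_absorb[OF cd(2)] Suc.IH[OF u(1,3)] by simp
  moreover have "b = c * (d * u)" using u(2) cd(3) by (simp add: mult.assoc)
  ultimately show ?case using cd(1) chain.simps(2)[of s n i "Suc m"] by blast
qed

lemma chain_less:
  "b \<in> M \<Longrightarrow> act b (pt i) < pt (i + int (Suc m)) \<Longrightarrow> b \<in> chain s n i (Suc m)"
proof (induction m arbitrary: b)
  case 0
  interpret B: braid_line act n s "pt i" pt by (rule rebase)
  obtain a u where au: "a \<in> sub s (par n (i + 1))" "u \<in> M" "b = a * u" "act u (pt i) \<le> pt i"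
    using B.lower[of b i] 0 by auto
  then have "u \<in> chain s n i 0" using stabilizer act_ge[of "pt i" u] by simp
  then show ?case using au by auto
next
  case (Suc m)
  interpret B: braid_line act n s "pt i" pt by (rule rebase)
  obtain a u where au: "a \<in> sub s (par n (i + int (Suc m) + 1))" "u \<in> M" "b = a * u"
      "act u (pt i) \<le> pt (i + int (Suc m))"
    using B.lower[of b "i + int (Suc m)"] Suc.prems by (auto simp: add_ac)
  show ?case
  \<comment> \<open>If \<open>u\<close> lands exactly on the point, the induction hypothesis does
    not apply. Then \<open>u\<close> has one factor more, and its leftmost one absorbs
    \<open>a\<close>.\<close>
  proof (cases "act u (pt i) = pt (i + int (Suc m))")
    case True
    then have "u \<in> chain s n i (Suc (Suc m))" by (rule chain_eq[OF au(2)])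
    then show ?thesis using au chain_absorb[of a i "Suc (Suc m)" u] by (simp add: add_ac)
  next
    case False
    then have "u \<in> chain s n i (Suc m)" using Suc.IH[of u] au by simp
    then show ?thesis using au chain.simps(2)[of s n i "Suc m"] by blast
  qed
qed

lemma act_chain: "b \<in> chain s n i m \<Longrightarrow> act b (pt i) \<le> pt (i + int m) \<and> (0 < m \<longrightarrow> act b (pt i) < pt (i + int m))"
proof (induction m arbitrary: b)
  case 0
  then show ?case using fix_par by simp
next
  case (Suc m)
  then obtain c u where cu: "c \<in> sub s (par n (i + int m + 1))" "u \<in> chain s n i m" "b = c * u" by auto
  have "act u (pt i) < pt (i + int m + 1)" using Suc.IH[OF cu(2)] pt_less[of "i + int m"] by auto
  then have "act c (act u (pt i)) < act c (pt (i + int m + 1))" by simp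
  then have "act b (pt i) < pt (i + int m + 1)" by (simp only: fix_par[OF cu(1)] cu(3) act_mult)
  then show ?case by (simp add: add_ac)
qed

text \<open>For \<open>m = 0\<close> the condition would be equality (\<open>stabilizer\<close>),
  hence the proviso.\<close>

theorem chain_iff: "0 < m \<Longrightarrow> b \<in> chain s n i m \<longleftrightarrow> b \<in> M \<and> act b (pt i) < pt (i + int m)"
  using chain_less[of b i "m - 1"] act_chain[of b i m] chain_M[of b i m] by auto

text \<open>Membership depends only on how far \<open>pt i\<close> is moved, and a left factor moves
  it at most as far as the product.\<close>

lemma chain_left_divisor: "a * e \<in> chain s n i m \<Longrightarrow> a \<in> M \<Longrightarrow> a \<in> chain s n i m"
proof -
  assume ae: "a * e \<in> chain s n i m" and a: "a \<in> M"
  have le: "act a (pt i) \<le> act (a * e) (pt i)" by (simp add: act_mult act_ge)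
  show ?thesis
  proof (cases "m = 0")
    case True
    then have "act a (pt i) = pt i" using ae fix_par le act_ge[of "pt i" a] by fastforce
    then show ?thesis using stabilizer a True by simp
  next
    case False
    then show ?thesis using chain_iff ae a le by auto
  qed
qed

text \<open>A fixed braid from \<open>pt i\<close> to \<open>pt (i + int m)\<close>. All positive
  braids in \<open>M\<close> with that image of \<open>pt i\<close> share it as a left factor, as
  \<open>act_eq_pt\<close> shows.\<close>

primrec ladders :: "int \<Rightarrow> nat \<Rightarrow> pbraid" where
  "ladders i 0 = 1"
| "ladders i (Suc m) = ladder s n (i + int (Suc m)) * ladders i m"

lemma act_eq_pt:
  "b \<in> M \<Longrightarrow> act b (pt i) = pt (i + int m) \<Longrightarrow> \<exists>u \<in> sub s (par n i). b = ladders i m * u"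
proof (induction m arbitrary: b)
  case 0
  then show ?case using stabilizer by simp
next
  case (Suc m)
  interpret B: braid_line act n s "pt i" pt by (rule rebase)
  obtain u where u: "u \<in> M" "b = ladder s n (i + int (Suc m)) * u" "act u (pt i) = pt (i + int m)"
    using B.level_eq[of "i + int m" b] Suc.prems pt_mono[of i "i + int m + 1"] by (auto simp: add_ac)
  then show ?case using Suc.IH[OF u(1,3)] by (auto simp: mult.assoc)
qed

end

section \<open>An ordered line with an action of the braid monoid\<close>

text \<open>The letters generate a free product of groups of order two, whose elements are the words
  without equal neighbours. The braid generators act on it by the Artin automorphisms that
  send \<open>x\<^sub>i\<close> to \<open>x\<^sub>i x\<^sub>i\<^sub>+\<^sub>1 x\<^sub>i\<close> and \<open>x\<^sub>i\<^sub>+\<^sub>1\<close> to \<open>x\<^sub>i\<close>.\<close>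

definition push :: "nat \<Rightarrow> nat list \<Rightarrow> nat list" where
  "push x w = (case w of [] \<Rightarrow> [x] | y # z \<Rightarrow> if x = y then z else x # w)"

abbreviation pushes :: "nat list \<Rightarrow> nat list \<Rightarrow> nat list" where
  "pushes u w \<equiv> foldr push u w"

lemma push_red [simp]: "distinct_adj w \<Longrightarrow> distinct_adj (push x w)"
  by (auto simp: push_def distinct_adj_Cons split: list.splits)

lemma pushes_red [simp]: "distinct_adj w \<Longrightarrow> distinct_adj (pushes u w)"
  by (induction u) auto

lemma push_push [simp]: "distinct_adj w \<Longrightarrow> push x (push x w) = w"
  by (auto simp: push_def distinct_adj_Cons split: list.splits)

definition img :: "nat \<Rightarrow> nat \<Rightarrow> nat list" where
  "img i x = (if x = i then [i, Suc i, i] else if x = Suc i then [i] else [x])"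

definition aut :: "nat \<Rightarrow> nat list \<Rightarrow> nat list" where
  "aut i w = foldr (\<lambda>x. pushes (img i x)) w []"

lemma aut_simps [simp]: "aut i [] = []" "aut i (x # w) = pushes (img i x) (aut i w)"
  by (simp_all add: aut_def)

lemma aut_red [simp]: "distinct_adj (aut i w)"
  by (induction w) auto

lemma aut_push: "aut i (push x w) = pushes (img i x) (aut i w)"
proof (cases "\<exists>z. w = x # z")
  case True
  then show ?thesis by (auto simp: push_def[of x w] img_def)
next
  case False
  then have "push x w = x # w" by (auto simp: push_def split: list.splits)
  then show ?thesis by simp
qed

lemma aut_pushes: "aut i (pushes u w) = pushes (concat (map (img i) u)) (aut i w)"
  by (induction u) (auto simp: aut_push)

lemma aut_braid: "aut i (aut (Suc i) (aut i w)) = aut (Suc i) (aut i (aut (Suc i) w))"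
proof (induction w)
  case (Cons x w)
  have "aut i (aut (Suc i) (aut i (x # w))) =
      pushes (concat (map (img i) (concat (map (img (Suc i)) (img i x))))) (aut i (aut (Suc i) (aut i w)))"
    by (simp add: aut_pushes)
  also have "\<dots> = pushes (concat (map (img (Suc i)) (concat (map (img i) (img (Suc i) x)))))
      (aut i (aut (Suc i) (aut i w)))"
  proof -
    \<comment> \<open>Both sides come from automorphisms, so comparing the images of a single letter
      is enough.\<close>
    consider "x = i" | "x = Suc i" | "x = Suc (Suc i)" | "x \<noteq> i" "x \<noteq> Suc i" "x \<noteq> Suc (Suc i)" by blast
    then show ?thesis by cases (simp_all add: img_def)
  qed
  finally show ?case by (simp add: aut_pushes Cons.IH)
qed simp

lemma aut_commute: "far i j \<Longrightarrow> aut i (aut j w) = aut j (aut i w)"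
proof (induction w)
  case (Cons x w)
  have "aut i (aut j (x # w)) = pushes (concat (map (img i) (img j x))) (aut i (aut j w))"
    by (simp add: aut_pushes)
  also have "\<dots> = pushes (concat (map (img j) (img i x))) (aut i (aut j w))"
    using Cons.prems by (auto simp: img_def far_def adj_def)
  finally show ?case using Cons by (simp add: aut_pushes)
qed simp

text \<open>On reduced words the automorphism is computed letter by letter, from left to right.
  The second function treats what follows a letter \<^term>\<open>i\<close> that has already been output.\<close>

fun trans :: "nat \<Rightarrow> nat list \<Rightarrow> nat list" and trans' :: "nat \<Rightarrow> nat list \<Rightarrow> nat list" where
  "trans i [] = []"
| "trans i (x # w) =
    (if x = i then i # trans' i w
     else if x = Suc i then (case w of [] \<Rightarrow> [i] | y # z \<Rightarrow> if y = i then trans' i z else i # trans i w)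
     else x # trans i w)"
| "trans' i [] = [Suc i, i]"
| "trans' i (x # w) = (if x = Suc i then Suc i # trans i w else Suc i # i # trans i (x # w))"

definition hdo :: "nat list \<Rightarrow> nat option" where
  "hdo w = (case w of [] \<Rightarrow> None | x # _ \<Rightarrow> Some x)"

lemma hdo_simps [simp]: "hdo [] = None" "hdo (x # w) = Some x"
  by (simp_all add: hdo_def)

lemma distinct_adj_hdo: "distinct_adj (x # w) \<longleftrightarrow> distinct_adj w \<and> hdo w \<noteq> Some x"
  by (cases w) auto

lemma push_eq_Cons: "hdo w \<noteq> Some x \<Longrightarrow> push x w = x # w"
  by (cases w) (auto simp: push_def)

lemma trans'_Cons: "\<exists>t. trans' i w = Suc i # t"
  by (cases w) auto

lemma hdo_trans' [simp]: "hdo (trans' i w) = Some (Suc i)"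
  using trans'_Cons[of i w] by auto

lemma trans_Suc: "trans i (Suc i # w) = (if hdo w = Some i then trans' i (tl w) else i # trans i w)"
  by (cases w) auto

declare trans.simps(2) [simp del]

lemma trans_same [simp]: "trans i (i # w) = i # trans' i w"
  and trans_other [simp]: "x \<noteq> i \<Longrightarrow> x \<noteq> Suc i \<Longrightarrow> trans i (x # w) = x # trans i w"
  by (simp_all add: trans.simps)

lemma hdo_trans: "hdo w \<noteq> Some (Suc i) \<Longrightarrow> hdo (trans i w) = hdo w"
  by (cases w; cases "hdo w = Some i") auto

lemma hdo_trans_Suc: "hdo (trans i (Suc i # w)) \<in> {Some i, Some (Suc i)}"
  by (simp add: trans_Suc)

lemma trans'_eq: "trans' i w = (if hdo w = Some (Suc i) then Suc i # trans i (tl w) else Suc i # i # trans i w)"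
  by (cases w) auto

text \<open>The image of the letter \<open>i\<close> ends in \<open>Suc i, i\<close>, which may
  cancel against what follows and is therefore held back; the second part accounts for these two
  letters.\<close>

lemma trans_eq_aut:
  "(distinct_adj w \<longrightarrow> trans i w = aut i w) \<and>
   (distinct_adj (i # w) \<longrightarrow> trans' i w = pushes [Suc i, i] (aut i w))"
proof (induction "length w" arbitrary: w rule: less_induct)
  case less
  have IH: "trans i v = aut i v" if "length v < length w" "distinct_adj v" for v
    using less that by blast
  have IH': "trans' i v = pushes [Suc i, i] (aut i v)" if "length v < length w" "distinct_adj (i # v)" for v
    using less that by blast
  have 1: "trans i w = aut i w" if red: "distinct_adj w"
  proof (cases w)
    case (Cons x v)
    have v: "distinct_adj v" "hdo v \<noteq> Some x" using red Cons by (auto simp: distinct_adj_hdo)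
    have eq: "trans i v = aut i v" using IH v Cons by simp
    consider "x = i" | "x = Suc i" | "x \<noteq> i" "x \<noteq> Suc i" by blast
    then show ?thesis
    proof cases
      case 1
      have "trans' i v = pushes [Suc i, i] (aut i v)" using IH'[of v] red Cons 1 by simp
      then have "aut i w = push i (trans' i v)" using Cons 1 by (simp add: img_def)
      then show ?thesis using Cons 1 by (simp add: push_eq_Cons)
    next
      case 2
      show ?thesis
      proof (cases "hdo v = Some i")
        case True
        then obtain z where z: "v = i # z" by (cases v) auto
        then have "trans' i z = pushes [Suc i, i] (aut i z)" using IH'[of z] red Cons by simp
        then show ?thesis using Cons 2 z by (simp add: img_def trans_Suc)
      next
        case False
        then have "hdo (trans i v) \<noteq> Some i" using hdo_trans v 2 by simp
        then show ?thesis using Cons 2 False eq by (simp add: img_def trans_Suc push_eq_Cons)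
      qed
    next
      case 3
      have "hdo (trans i v) \<noteq> Some x"
      proof (cases "hdo v = Some (Suc i)")
        case True
        then obtain z where "v = Suc i # z" by (cases v) auto
        then show ?thesis using hdo_trans_Suc[of i z] 3 by auto
      next
        case False
        then show ?thesis using hdo_trans v by simp
      qed
      then show ?thesis using Cons 3 eq by (simp add: img_def push_eq_Cons)
    qed
  qed simp
  have 2: "trans' i w = pushes [Suc i, i] (aut i w)" if red: "distinct_adj (i # w)"
  proof (cases "hdo w = Some (Suc i)")
    case True
    then obtain z where z: "w = Suc i # z" by (cases w) auto
    have red_z: "distinct_adj z" "hdo z \<noteq> Some (Suc i)" using red z by (auto simp: distinct_adj_hdo)
    then have "hdo (aut i z) \<noteq> Some (Suc i)" using hdo_trans IH z by (metis length_Cons lessI)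
    then show ?thesis using z IH[of z] red_z by (simp add: img_def push_eq_Cons)
  next
    case False
    have red_w: "distinct_adj w" "hdo w \<noteq> Some i" using red by (auto simp: distinct_adj_hdo)
    then have "hdo (aut i w) \<noteq> Some i" using 1 hdo_trans[OF False] by simp
    then show ?thesis using False 1 red_w by (simp add: trans'_eq push_eq_Cons)
  qed
  show ?case using 1 2 by blast
qed

section \<open>A linear order on words and its behaviour under the automorphisms\<close>

text \<open>The place of the next letter (or of the end of the word) after a given letter:
  the cyclic order of the letters with the end of the word at infinity, cut open at the given letter.\<close>

definition place :: "nat option \<Rightarrow> nat option \<Rightarrow> nat \<times> nat" where
  "place l m = (case m of None \<Rightarrow> (1, 0)
     | Some x \<Rightarrow> (case l of None \<Rightarrow> (0, x) | Some a \<Rightarrow> (if a < x then 0 else 2, x)))"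

definition before :: "nat option \<Rightarrow> nat option \<Rightarrow> nat option \<Rightarrow> bool" where
  "before l m m' \<longleftrightarrow> fst (place l m) < fst (place l m') \<or>
     fst (place l m) = fst (place l m') \<and> snd (place l m) < snd (place l m')"

text \<open>The parameter is the last common letter. This is the order given by a planar drawing of
  the Cayley tree of the free product, the end of a word counting as one more direction.\<close>

fun less_word :: "nat option \<Rightarrow> nat list \<Rightarrow> nat list \<Rightarrow> bool" where
  "less_word l [] [] \<longleftrightarrow> False"
| "less_word l [] (y # v) \<longleftrightarrow> before l None (Some y)"
| "less_word l (x # u) [] \<longleftrightarrow> before l (Some x) None"
| "less_word l (x # u) (y # v) \<longleftrightarrow> (if x = y then less_word (Some x) u v else before l (Some x) (Some y))"

lemma before_irrefl [simp]: "\<not> before l m m"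
  and before_trans: "before l m m' \<Longrightarrow> before l m' m'' \<Longrightarrow> before l m m''"
  by (auto simp: before_def place_def split: option.splits if_splits)

lemma before_total: "m \<noteq> m' \<Longrightarrow> before l m m' \<or> before l m' m"
  by (cases m; cases m'; cases l) (auto simp: before_def place_def)

lemma before_asym: "before l m m' \<Longrightarrow> \<not> before l m' m"
  using before_trans before_irrefl by blast

lemma less_word_irrefl [simp]: "\<not> less_word l u u"
  by (induction u arbitrary: l) auto

lemma less_word_trans: "less_word l u v \<Longrightarrow> less_word l v w \<Longrightarrow> less_word l u w"
proof (induction l u v arbitrary: w rule: less_word.induct)
  case (2 l y v)
  then show ?case by (cases w) (auto split: if_splits intro: before_trans dest: before_asym)
next
  case (3 l x u)
  then show ?case by (cases w) (auto split: if_splits intro: before_trans dest: before_asym)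
next
  case (4 l x u y v)
  then show ?case by (cases w) (auto split: if_splits intro: before_trans dest: before_asym)
qed simp

lemma less_word_total: "u \<noteq> v \<Longrightarrow> less_word l u v \<or> less_word l v u"
  by (induction l u v rule: less_word.induct) (use before_total in auto)

lemma less_word_hdo: "hdo u \<noteq> hdo v \<Longrightarrow> less_word l u v \<longleftrightarrow> before l (hdo u) (hdo v)"
  by (cases u; cases v) auto

context
  fixes i :: nat
begin

abbreviation outer :: "nat option \<Rightarrow> bool" where
  "outer m \<equiv> m \<noteq> Some i \<and> m \<noteq> Some (Suc i)"

text \<open>\<open>i\<close> and \<open>Suc i\<close> are neighbours in the cyclic order, so no
  other direction separates them. After \<open>i\<close> the letter \<open>Suc i\<close> comes
  first; after \<open>Suc i\<close> the letter \<open>i\<close> comes last.\<close>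

lemma before_adjacent:
  "outer l \<Longrightarrow> before l (Some i) (Some (Suc i))"
  "outer l \<Longrightarrow> outer m \<Longrightarrow> before l (Some (Suc i)) m \<longleftrightarrow> before l (Some i) m"
  "outer l \<Longrightarrow> outer m \<Longrightarrow> before l m (Some (Suc i)) \<longleftrightarrow> before l m (Some i)"
  "outer m \<Longrightarrow> before (Some i) (Some (Suc i)) m"
  "outer m \<Longrightarrow> before (Some (Suc i)) m (Some i)"
  "outer m \<Longrightarrow> outer m' \<Longrightarrow> before (Some (Suc i)) m m' \<longleftrightarrow> before (Some i) m m'"
  by (auto simp: before_def place_def split: option.splits if_splits)

lemma less_word_outer: "outer (hdo u) \<Longrightarrow> outer (hdo v) \<Longrightarrow>
    less_word (Some (Suc i)) u v \<longleftrightarrow> less_word (Some i) u v"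
  by (cases u; cases v) (auto simp: before_adjacent)

lemma hdo_cases:
  obtains z where "w = i # z" | z where "w = Suc i # z" | "outer (hdo w)"
  by (cases w) auto

lemma trans'_outer: "outer (hdo w) \<Longrightarrow> trans' i w = Suc i # i # trans i w"
  and hdo_trans_outer: "outer (hdo w) \<Longrightarrow> hdo (trans i w) = hdo w"
  and trans_Suc_outer: "outer (hdo w) \<Longrightarrow> trans i (Suc i # w) = i # trans i w"
  by (simp_all add: trans'_eq hdo_trans trans_Suc)

text \<open>The three parts are the possible states after a common prefix in which the last letter
  read is also the last letter written, so that the same order applies to both sides. If
  \<open>Suc i\<close> is read after an outer letter, the output depends on the next letter, and the
  proof looks one letter further.\<close>

lemma trans_mono:
  "(\<forall>l. outer l \<longrightarrow> distinct_adj u \<longrightarrow> distinct_adj v \<longrightarrow> less_word l u v \<longrightarrow>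
      less_word l (trans i u) (trans i v)) \<and>
   (distinct_adj (i # u) \<longrightarrow> distinct_adj (i # v) \<longrightarrow> less_word (Some i) u v \<longrightarrow>
      less_word (Some i) (trans' i u) (trans' i v)) \<and>
   (distinct_adj (Suc i # u) \<longrightarrow> distinct_adj (Suc i # v) \<longrightarrow> less_word (Some (Suc i)) u v \<longrightarrow>
      less_word (Some (Suc i)) (trans i u) (trans i v))"
proof (induction "length u" arbitrary: u v rule: less_induct)
  case less
  have IH1: "less_word l (trans i u') (trans i v')"
    if "length u' < length u" "outer l" "distinct_adj u'" "distinct_adj v'" "less_word l u' v'" for l u' v'
    using less that by blast
  have IH2: "less_word (Some i) (trans' i u') (trans' i v')"
    if "length u' < length u" "distinct_adj (i # u')" "distinct_adj (i # v')" "less_word (Some i) u' v'" for u' v'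
    using less that by blast
  have IH3: "less_word (Some (Suc i)) (trans i u') (trans i v')"
    if "length u' < length u" "distinct_adj (Suc i # u')" "distinct_adj (Suc i # v')"
      "less_word (Some (Suc i)) u' v'" for u' v'
    using less that by blast
  have both_outer: "less_word l (trans i u') (trans i v')"
    if "outer (hdo u')" "outer (hdo v')" "distinct_adj u'" "distinct_adj v'" "less_word l u' v'"
      "length u' \<le> length u" for l u' v'
  proof (cases "hdo u' = hdo v'")
    case True
    show ?thesis
    proof (cases u')
      case Nil
      then show ?thesis using True that(5) by (cases v') auto
    next
      case (Cons x u'')
      then obtain v'' where v'': "v' = x # v''" using True by (cases v') auto
      have "less_word (Some x) (trans i u'') (trans i v'')"
        using that Cons v'' by (intro IH1) (auto simp: distinct_adj_hdo)
      then show ?thesis using Cons v'' that(1) by simp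
    qed
  next
    case False
    then show ?thesis using that less_word_hdo by (simp add: hdo_trans_outer)
  qed
  have 3: "less_word (Some (Suc i)) (trans i u) (trans i v)"
    if red: "distinct_adj (Suc i # u)" "distinct_adj (Suc i # v)" and lt: "less_word (Some (Suc i)) u v"
  proof (cases u rule: hdo_cases)
    case u: (1 u')
    show ?thesis
    proof (cases v rule: hdo_cases)
      case v: (1 v')
      then show ?thesis using u lt red IH2[of u' v'] by (simp add: distinct_adj_hdo)
    next
      case 3
      then show ?thesis using lt u before_asym before_adjacent(5)[OF 3]
        by (simp add: less_word_hdo) (metis hdo_simps(2) less_word_hdo)
    qed (use red in \<open>auto simp: distinct_adj_hdo\<close>)
  next
    case u: 3
    show ?thesis
    proof (cases v rule: hdo_cases)
      case v: (1 v')
      then show ?thesis using u before_adjacent(5)[OF u]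
        by (subst less_word_hdo) (auto simp: hdo_trans_outer)
    next
      case 3
      then show ?thesis using u both_outer red lt by (auto simp: distinct_adj_hdo)
    qed (use red in \<open>auto simp: distinct_adj_hdo\<close>)
  qed (use red in \<open>auto simp: distinct_adj_hdo\<close>)
  have 2: "less_word (Some i) (trans' i u) (trans' i v)"
    if red: "distinct_adj (i # u)" "distinct_adj (i # v)" and lt: "less_word (Some i) u v"
  proof (cases u rule: hdo_cases)
    case u: (2 u')
    show ?thesis
    proof (cases v rule: hdo_cases)
      case v: (2 v')
      then show ?thesis using u lt red IH3[of u' v'] by (simp add: distinct_adj_hdo)
    next
      case v: 3
      have "less_word (Some (Suc i)) (trans i u') (i # trans i v)"
      proof (cases u' rule: hdo_cases)
        case (1 u'')
        have "less_word (Some i) (trans' i u'') (trans i v)"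
          using before_adjacent(4)[OF v] v by (subst less_word_hdo) (auto simp: hdo_trans_outer)
        then show ?thesis using 1 by simp
      next
        case 3
        then show ?thesis using before_adjacent(5)[OF 3]
          by (subst less_word_hdo) (auto simp: hdo_trans_outer)
      qed (use u red in \<open>auto simp: distinct_adj_hdo\<close>)
      then show ?thesis using u v by (simp add: trans'_outer)
    qed (use red in \<open>auto simp: distinct_adj_hdo\<close>)
  next
    case u: 3
    show ?thesis
    proof (cases v rule: hdo_cases)
      case v: (2 v')
      have "before (Some i) (hdo u) (hdo v)" using lt u v by (subst (asm) less_word_hdo) auto
      then show ?thesis using before_asym[OF before_adjacent(4)[OF u]] v by simp
    next
      case v: 3
      then show ?thesis using u both_outer[OF u v] red lt
        by (simp add: trans'_outer distinct_adj_hdo)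
    qed (use red in \<open>auto simp: distinct_adj_hdo\<close>)
  qed (use red in \<open>auto simp: distinct_adj_hdo\<close>)
  have 1: "less_word l (trans i u) (trans i v)"
    if l: "outer l" and red: "distinct_adj u" "distinct_adj v" and lt: "less_word l u v" for l
  proof (cases u rule: hdo_cases)
    case u: (1 u')
    show ?thesis
    proof (cases v rule: hdo_cases)
      case v: (1 v')
      then show ?thesis using u lt red IH2[of u' v'] by simp
    next
      case v: (2 v')
      show ?thesis
      proof (cases "hdo v' = Some i")
        case True
        then show ?thesis using u v before_adjacent(1)[OF l]
          by (subst less_word_hdo) (auto simp: trans_Suc)
      next
        case False
        then have v': "outer (hdo v')" using red v by (auto simp: distinct_adj_hdo)
        have "less_word (Some i) (trans' i u') (trans i v')"
          using before_adjacent(4)[OF v'] v' by (subst less_word_hdo) (auto simp: hdo_trans_outer)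
        then show ?thesis using u v v' by (simp add: trans_Suc_outer)
      qed
    next
      case v: 3
      have "before l (hdo u) (hdo v)" using lt u v by (subst (asm) less_word_hdo) auto
      then show ?thesis using u v by (subst less_word_hdo) (auto simp: hdo_trans_outer)
    qed
  next
    case u: (2 u')
    show ?thesis
    proof (cases v rule: hdo_cases)
      case v: (1 v')
      have "before l (hdo u) (hdo v)" using lt u v by (subst (asm) less_word_hdo) auto
      then show ?thesis using u v before_asym[OF before_adjacent(1)[OF l]] by simp
    next
      case v: (2 v')
      have lt': "less_word (Some (Suc i)) u' v'" using lt u v by simp
      show ?thesis
      proof (cases u' rule: hdo_cases)
        case u': (1 x)
        show ?thesis
        proof (cases v' rule: hdo_cases)
          case v': (1 y)
          have "less_word (Some i) (trans' i x) (trans' i y)"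
            using lt' u' v' u v red by (intro IH2) auto
          moreover obtain t t' where "trans' i x = Suc i # t" "trans' i y = Suc i # t'"
            using trans'_Cons by metis
          ultimately show ?thesis using u u' v v' by (simp add: trans_Suc)
        next
          case v': 3
          have "before (Some (Suc i)) (Some i) (hdo v')" using lt' u' v' by (subst (asm) less_word_hdo) auto
          then show ?thesis using before_asym[OF before_adjacent(5)[OF v']] by simp
        qed (use red v in \<open>auto simp: distinct_adj_hdo\<close>)
      next
        case u': 3
        show ?thesis
        proof (cases v' rule: hdo_cases)
          case v': (1 y)
          then show ?thesis using u u' v before_adjacent(1)[OF l]
            by (subst less_word_hdo) (auto simp: trans_Suc)
        next
          case v': 3
          have "less_word (Some i) (trans i u') (trans i v')"
            using less_word_outer[OF u' v'] lt' red u v u' v' by (intro both_outer) (auto simp: distinct_adj_hdo)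
          then show ?thesis using u u' v v' by (simp add: trans_Suc_outer)
        qed (use red v in \<open>auto simp: distinct_adj_hdo\<close>)
      qed (use red u in \<open>auto simp: distinct_adj_hdo\<close>)
    next
      case v: 3
      have "before l (hdo u) (hdo v)" using lt u v by (subst (asm) less_word_hdo) auto
      then have "before l (Some i) (hdo v)" "before l (Some (Suc i)) (hdo v)"
        using before_adjacent(2)[OF l v] u by auto
      then show ?thesis using u v hdo_trans_Suc[of i u']
        by (subst less_word_hdo) (auto simp: hdo_trans_outer)
    qed
  next
    case u: 3
    show ?thesis
    proof (cases v rule: hdo_cases)
      case v: (1 v')
      have "before l (hdo u) (hdo v)" using lt u v by (subst (asm) less_word_hdo) auto
      then show ?thesis using u v by (subst less_word_hdo) (auto simp: hdo_trans_outer)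
    next
      case v: (2 v')
      have "before l (hdo u) (hdo v)" using lt u v by (subst (asm) less_word_hdo) auto
      then have "before l (hdo u) (Some i)" "before l (hdo u) (Some (Suc i))"
        using before_adjacent(3)[OF l u] v by auto
      then show ?thesis using u v hdo_trans_Suc[of i v']
        by (subst less_word_hdo) (auto simp: hdo_trans_outer)
    next
      case v: 3
      then show ?thesis using u both_outer red lt by auto
    qed
  qed
  show ?case using 1 2 3 by blast
qed

text \<open>The fourth part serves words beginning with \<open>Suc i, i\<close>, whose image is
  \<open>trans'\<close> of the rest without the letter \<open>i\<close> that usually precedes
  it.\<close>

lemma trans_decreasing:
  "(\<forall>l. outer l \<longrightarrow> distinct_adj w \<longrightarrow> trans i w = w \<or> less_word l (trans i w) w) \<and>
   (distinct_adj (i # w) \<longrightarrow> trans' i w = w \<or> less_word (Some i) (trans' i w) w) \<and>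
   (distinct_adj (Suc i # w) \<longrightarrow> trans i w = w \<or> less_word (Some (Suc i)) (trans i w) w) \<and>
   (distinct_adj (i # w) \<longrightarrow> trans' i w = Suc i # i # w \<or> less_word (Some i) (trans' i w) (Suc i # i # w))"
proof (induction "length w" arbitrary: w rule: less_induct)
  case less
  have IH1: "trans i v = v \<or> less_word l (trans i v) v"
    if "length v < length w" "outer l" "distinct_adj v" for l v
    using less that by blast
  have IH2: "trans' i v = v \<or> less_word (Some i) (trans' i v) v"
    if "length v < length w" "distinct_adj (i # v)" for v
    using less that by blast
  have IH3: "trans i v = v \<or> less_word (Some (Suc i)) (trans i v) v"
    if "length v < length w" "distinct_adj (Suc i # v)" for v
    using less that by blast
  have IH4: "trans' i v = Suc i # i # v \<or> less_word (Some i) (trans' i v) (Suc i # i # v)"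
    if "length v < length w" "distinct_adj (i # v)" for v
    using less that by blast
  have outer: "trans i w = w \<or> less_word l (trans i w) w" if "outer (hdo w)" "distinct_adj w" for l
  proof (cases w)
    case (Cons x v)
    then show ?thesis using that IH1[of v "Some x"] by (auto simp: distinct_adj_hdo)
  qed simp
  have 1: "trans i w = w \<or> less_word l (trans i w) w" if l: "outer l" and red: "distinct_adj w" for l
  proof (cases w rule: hdo_cases)
    case (1 v)
    then show ?thesis using IH2[of v] red by auto
  next
    case (2 v)
    show ?thesis
    proof (cases "hdo v = Some i")
      case True
      then obtain z where z: "v = i # z" by (cases v) auto
      \<comment> \<open>Both words begin with \<open>Suc i\<close>, so their comparison does not
        depend on the preceding letter.\<close>
      obtain t where "trans' i z = Suc i # t" using trans'_Cons by blast
      then show ?thesis using IH4[of z] 2 z red by (auto simp: trans_Suc)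
    next
      case False
      then show ?thesis using 2 before_adjacent(1)[OF l] by (simp add: trans_Suc)
    qed
  qed (use outer red in auto)
  have 2: "trans' i w = w \<or> less_word (Some i) (trans' i w) w" if red: "distinct_adj (i # w)"
  proof (cases w rule: hdo_cases)
    case (2 v)
    then show ?thesis using IH3[of v] red by (auto simp: distinct_adj_hdo)
  next
    case 3
    then have "less_word (Some i) (trans' i w) w"
      using before_adjacent(4)[OF 3] by (subst less_word_hdo) auto
    then show ?thesis ..
  qed (use red in \<open>auto simp: distinct_adj_hdo\<close>)
  have 3: "trans i w = w \<or> less_word (Some (Suc i)) (trans i w) w" if red: "distinct_adj (Suc i # w)"
  proof (cases w rule: hdo_cases)
    case (1 v)
    then show ?thesis using IH2[of v] red by (auto simp: distinct_adj_hdo)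
  qed (use red outer in \<open>auto simp: distinct_adj_hdo\<close>)
  have 4: "trans' i w = Suc i # i # w \<or> less_word (Some i) (trans' i w) (Suc i # i # w)"
    if red: "distinct_adj (i # w)"
  proof (cases w rule: hdo_cases)
    case (2 v)
    show ?thesis
    proof (cases v rule: hdo_cases)
      case v: (1 z)
      then show ?thesis using IH4[of z] 2 red by (auto simp: distinct_adj_hdo)
    next
      case v: 3
      then have "less_word (Some (Suc i)) (trans i v) (i # w)"
        using before_adjacent(5)[OF v] by (subst less_word_hdo) (auto simp: hdo_trans_outer)
      then show ?thesis using 2 by simp
    qed (use red 2 in \<open>auto simp: distinct_adj_hdo\<close>)
  next
    case 3
    then show ?thesis using outer[of "Some i"] red by (auto simp: trans'_outer distinct_adj_hdo)
  qed (use red in \<open>auto simp: distinct_adj_hdo\<close>)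
  show ?case using 1 2 3 4 by blast
qed

end

text \<open>The order is reversed, so that the generators move every point up.\<close>

typedef line = "{w :: nat list. distinct_adj w}"
  by (rule exI[of _ "[]"]) simp

setup_lifting type_definition_line

instantiation line :: linorder
begin

lift_definition less_line :: "line \<Rightarrow> line \<Rightarrow> bool" is "\<lambda>u v. less_word None v u" .

definition less_eq_line :: "line \<Rightarrow> line \<Rightarrow> bool" where
  "x \<le> y \<longleftrightarrow> x = y \<or> x < y" for x y :: line

instance
proof
  fix x y z :: line
  have irrefl: "\<not> x < x" for x :: line by transfer simp
  have trans: "x < y \<Longrightarrow> y < z \<Longrightarrow> x < z" for x y z :: line
    by transfer (rule less_word_trans)
  have total: "x = y \<or> x < y \<or> y < x" by transfer (use less_word_total in blast)
  show "x < y \<longleftrightarrow> x \<le> y \<and> \<not> y \<le> x" using irrefl trans by (auto simp: less_eq_line_def)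
  show "x \<le> x" by (simp add: less_eq_line_def)
  show "x \<le> y \<Longrightarrow> y \<le> z \<Longrightarrow> x \<le> z" using trans by (auto simp: less_eq_line_def)
  show "x \<le> y \<Longrightarrow> y \<le> x \<Longrightarrow> x = y" using irrefl trans by (auto simp: less_eq_line_def)
  show "x \<le> y \<or> y \<le> x" using total by (auto simp: less_eq_line_def)
qed

end

lift_definition gen_act :: "nat \<Rightarrow> line \<Rightarrow> line" is aut
  by simp

lemma gen_act_braid: "adj i j \<Longrightarrow> gen_act i (gen_act j (gen_act i x)) = gen_act j (gen_act i (gen_act j x))"
  by transfer (auto simp: adj_def aut_braid)

lemma gen_act_commute: "far i j \<Longrightarrow> gen_act i (gen_act j x) = gen_act j (gen_act i x)"
  by transfer (rule aut_commute)

lemma gen_act_mono: "x < y \<Longrightarrow> gen_act i x < gen_act i y"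
proof transfer
  fix x y :: "nat list" and i
  assume "distinct_adj x" "distinct_adj y" "less_word None y x"
  then show "less_word None (aut i y) (aut i x)"
    using trans_mono[of i y x] trans_eq_aut[of x i] trans_eq_aut[of y i] by auto
qed

lemma gen_act_ge: "x \<le> gen_act i x"
  unfolding less_eq_line_def
proof transfer
  fix x :: "nat list" and i
  assume "distinct_adj x"
  then show "x = aut i x \<or> less_word None (aut i x) x"
    using trans_decreasing[of i x] trans_eq_aut[of x i] by auto
qed

lift_definition pact :: "pbraid \<Rightarrow> line \<Rightarrow> line" is "\<lambda>w x. foldr gen_act w x"
proof -
  fix u v :: "nat list"
  assume "u \<approx> v"
  then have "foldr gen_act u x = foldr gen_act v x" for x
    by (induction rule: peq.induct) (auto intro: gen_act_braid gen_act_commute)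
  then show "foldr gen_act u = foldr gen_act v" by blast
qed

lemma pact_gen: "pact (gen i) x = gen_act i x"
  by transfer simp

interpretation P: positive_action pact
proof
  fix a b :: pbraid and x y :: line
  show "pact 1 x = x" by transfer simp
  show "pact (a * b) x = pact a (pact b x)" by transfer simp
  show "x < y \<Longrightarrow> pact a x < pact a y"
  proof (transfer fixing: x y)
    fix w assume "x < y"
    then show "foldr gen_act w x < foldr gen_act w y" by (induction w) (auto intro: gen_act_mono)
  qed
  show "x \<le> pact a x"
  proof (transfer fixing: x)
    fix w show "x \<le> foldr gen_act w x" by (induction w) (auto intro: gen_act_ge order_trans)
  qed
qed

section \<open>The base point and preimages under the action\<close>

lift_definition base :: line is "[1]"
  by simp

lemma base_fix: "i \<ge> 2 \<Longrightarrow> pact (gen i) base = base"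
  unfolding pact_gen by transfer (auto simp: img_def push_def)

lemma base_moved: "pact (gen 1) base \<noteq> base"
  unfolding pact_gen by transfer (auto simp: img_def push_def)

text \<open>The inverse automorphism on letters; it provides the preimages from which the points of
  negative index are built.\<close>

definition coimg :: "nat \<Rightarrow> nat \<Rightarrow> nat list" where
  "coimg i x = (if x = i then [Suc i] else if x = Suc i then [Suc i, i, Suc i] else [x])"

definition coaut :: "nat \<Rightarrow> nat list \<Rightarrow> nat list" where
  "coaut i w = foldr (\<lambda>x. pushes (coimg i x)) w []"

lemma coaut_simps [simp]: "coaut i [] = []" "coaut i (x # w) = pushes (coimg i x) (coaut i w)"
  by (simp_all add: coaut_def)

lemma coaut_red [simp]: "distinct_adj (coaut i w)"
  by (induction w) auto

lemma aut_coaut: "distinct_adj w \<Longrightarrow> aut i (coaut i w) = w"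
proof (induction w)
  case (Cons x w)
  then have w: "distinct_adj w" "hdo w \<noteq> Some x" by (auto simp: distinct_adj_hdo)
  have "aut i (coaut i (x # w)) = pushes (concat (map (img i) (coimg i x))) w"
    using Cons.IH w by (simp add: aut_pushes)
  also have "\<dots> = push x w" using w by (simp add: img_def coimg_def)
  finally show ?case using w by (simp add: push_eq_Cons)
qed simp

lemma gen_act_surj: "\<exists>y. gen_act i y = x"
proof transfer
  fix i and x :: "nat list"
  assume "distinct_adj x"
  then show "\<exists>y\<in>Collect distinct_adj. aut i y = x" using aut_coaut by (intro bexI[of _ "coaut i x"]) auto
qed

lemma pact_surj: "\<exists>y. pact a y = x"
proof (transfer fixing: x)
  fix w :: "nat list"
  show "\<exists>y. foldr gen_act w y = x"
  proof (induction w arbitrary: x)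
    case (Cons i w)
    obtain z where z: "gen_act i z = x" using gen_act_surj by blast
    obtain y where "foldr gen_act w y = z" using Cons.IH by blast
    then show ?case using z by (intro exI[of _ y]) simp
  qed simp
qed

section \<open>The central element\<close>

lemma sub_gen_iff: "a \<in> sub gen I \<longleftrightarrow> supp a \<subseteq> I"
proof
  show "a \<in> sub gen I \<Longrightarrow> supp a \<subseteq> I" by (induction rule: sub.induct) auto
  show "supp a \<subseteq> I \<Longrightarrow> a \<in> sub gen I"
  proof (induction "len a" arbitrary: a)
    case (Suc k)
    then show ?case by (cases a rule: pbraid_left_cases) auto
  qed simp
qed

definition Delta :: "nat \<Rightarrow> pbraid" where
  "Delta n = up gen 0 n ^ Suc n"

lemma braid_generators_gen: "n \<ge> 2 \<Longrightarrow> braid_generators n gen"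
  by unfold_locales (auto intro: gen_braid gen_commute)

context
  fixes n :: nat
  assumes n: "n \<ge> 2"
begin

interpretation B: braid_generators n gen by (rule braid_generators_gen[OF n])

lemma supp_power: "supp (a ^ k) \<subseteq> supp a"
  by (induction k) auto

lemma supp_Delta: "supp (Delta n) \<subseteq> {0<..n}"
proof -
  have "supp (up gen 0 n) \<subseteq> {0<..n}" using up_in_sub sub_gen_iff by blast
  then show ?thesis unfolding Delta_def using supp_power by blast
qed

lemma power_shift: "k < i \<Longrightarrow> i \<le> n \<Longrightarrow> gen i * up gen 0 n ^ k = up gen 0 n ^ k * gen (i - k)"
proof (induction k)
  case (Suc k)
  have "gen i * up gen 0 n ^ Suc k = up gen 0 n ^ k * (gen (i - k) * up gen 0 n)"
    using Suc by (simp add: power_Suc2 del: power_Suc flip: mult.assoc)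
  also have "gen (i - k) * up gen 0 n = up gen 0 n * gen (i - Suc k)"
    using B.up_shift[of 0 "i - Suc k" n] Suc.prems by (simp add: Suc_diff_Suc)
  finally show ?case by (simp add: power_Suc2 mult.assoc del: power_Suc)
qed simp

text \<open>In the group, conjugation by \<open>up gen 0 n\<close> permutes \<open>n + 1\<close>
  elements cyclically: the \<open>n\<close> generators and one more, between \<open>gen 1\<close>
  and \<open>gen n\<close>. Hence two factors are passed here, and the exponent \<open>n + 1\<close>
  makes the power central.\<close>

lemma first_shift: "gen 1 * up gen 0 n ^ 2 = up gen 0 n ^ 2 * gen n"
proof -
  let ?u = "up gen 0 n"
  have 1: "?u = gen 1 * up gen 1 n" and 2: "?u = up gen 0 (n - 1) * gen n"
    using n up_rec[of 0 n gen] up_Suc[of 0 "n - 1" gen] by auto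
  have "?u * up gen 0 (n - 1) = up gen 1 n * ?u" using B.up_mult_up[of 0 "n - 1"] n by simp
  then have "?u * ?u = up gen 1 n * ?u * gen n" by (subst (2) 2) (simp flip: mult.assoc)
  then have "gen 1 * (?u * ?u) = ?u * ?u * gen n" by (subst (3) 1) (simp add: mult.assoc)
  then show ?thesis by (simp add: power2_eq_square mult.assoc)
qed

lemma Delta_gen: "i \<in> {0<..n} \<Longrightarrow> gen i * Delta n = Delta n * gen i"
proof -
  assume i: "i \<in> {0<..n}"
  let ?u = "up gen 0 n"
  \<comment> \<open>\<open>i - 1\<close> factors take \<open>gen i\<close> to \<open>gen 1\<close>,
    two more take it to \<open>gen n\<close>, and \<open>n - i\<close> take it back to
    \<open>gen i\<close>.\<close>
  have "Suc n = (i - 1) + (2 + (n - i))" using i by auto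
  then have D: "Delta n = ?u ^ (i - 1) * (?u ^ 2 * ?u ^ (n - i))"
    unfolding Delta_def by (simp only: power_add)
  have a: "gen i * ?u ^ (i - 1) = ?u ^ (i - 1) * gen 1" using power_shift[of "i - 1" i] i by simp
  have b: "gen n * ?u ^ (n - i) = ?u ^ (n - i) * gen i" using power_shift[of "n - i" n] i by simp
  have "gen i * Delta n = ?u ^ (i - 1) * ((gen 1 * ?u ^ 2) * ?u ^ (n - i))"
    using a by (simp add: D flip: mult.assoc)
  also have "\<dots> = ?u ^ (i - 1) * (?u ^ 2 * (gen n * ?u ^ (n - i)))"
    by (simp only: first_shift mult.assoc)
  also have "\<dots> = Delta n * gen i" by (simp add: D b mult.assoc)
  finally show ?thesis .
qed

lemma Delta_commute: "supp a \<subseteq> {0<..n} \<Longrightarrow> a * Delta n = Delta n * a"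
  unfolding sub_gen_iff[symmetric]
proof (induction rule: sub.induct)
  case (step i a)
  then show ?case using Delta_gen[of i] by (metis mult.assoc)
qed simp

lemma Delta_power_commute: "supp a \<subseteq> {0<..n} \<Longrightarrow> a * Delta n ^ k = Delta n ^ k * a"
  by (induction k) (auto simp: power_Suc2 Delta_commute mult.assoc simp flip: mult.assoc[of a])

text \<open>After \<open>i - 1\<close> factors \<open>gen i\<close> has become \<open>gen 1\<close>,
  the first letter of the next factor. Deleting that letter therefore amounts to deleting a leading
  \<open>gen i\<close>.\<close>

lemma Delta_divisor:
  assumes "i \<in> {0<..n}"
  obtains c where "supp c \<subseteq> {0<..n}" "gen i * c = Delta n" "c * gen i = Delta n"
proof -
  let ?u = "up gen 0 n"
  let ?c = "?u ^ (i - 1) * (up gen 1 n * ?u ^ (Suc n - i))"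
  have "Suc n = (i - 1) + (1 + (Suc n - i))" using assms by auto
  then have D: "Delta n = ?u ^ (i - 1) * (?u * ?u ^ (Suc n - i))"
    unfolding Delta_def by (metis power_add power_one_right)
  have u: "?u = gen 1 * up gen 1 n" using n up_rec[of 0 n gen] by simp
  have a: "gen i * ?u ^ (i - 1) = ?u ^ (i - 1) * gen 1" using power_shift[of "i - 1" i] assms by simp
  have "gen i * ?c = ?u ^ (i - 1) * (gen 1 * up gen 1 n * ?u ^ (Suc n - i))"
    using a by (simp flip: mult.assoc)
  then have 1: "gen i * ?c = Delta n" unfolding u[symmetric] D by (simp add: mult.assoc)
  then have "gen i * (?c * gen i) = gen i * Delta n" using Delta_gen[OF assms] by (simp flip: mult.assoc)
  then have 2: "?c * gen i = Delta n" by (rule gen_left_cancel)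
  have "supp ?c \<subseteq> supp (Delta n)" using 1 by (metis supp_simps(2) sup_ge2)
  then show ?thesis using that[OF _ 1 2] supp_Delta by blast
qed

text \<open>The last factor is \<open>\<Delta>\<^sub>1\<close>. It fixes the base point and its
  images under the centre, on which \<open>dn\<close> followed by \<open>up\<close> therefore acts
  as the central element.\<close>

lemma Delta_factor: "Delta n = up gen 0 n * dn gen 0 n * up gen 1 n ^ n"
proof -
  have "up gen 0 n ^ k = dn gen 0 k * up gen 1 n ^ k" if "k \<le> n" for k
    using that
  proof (induction k)
    case (Suc k)
    \<comment> \<open>A further factor raises the ladder by one place, and the first letter of that
      factor fills the gap at the lower end.\<close>
    have shift: "up gen 0 n * dn gen 0 k = dn gen 1 (Suc k) * up gen 0 n" if "k < n" for k
      using that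
    proof (induction k)
      case (Suc k)
      have "up gen 0 n * dn gen 0 (Suc k) = (up gen 0 n * gen (Suc k)) * dn gen 0 k"
        by (simp add: dn_Suc mult.assoc)
      also have "\<dots> = gen (Suc (Suc k)) * (up gen 0 n * dn gen 0 k)"
        using B.up_shift[of 0 "Suc k" n] Suc.prems by (simp add: mult.assoc)
      finally show ?case using Suc by (simp add: dn_Suc[of "Suc 0" "Suc k"] mult.assoc)
    qed simp
    have "up gen 0 n ^ Suc k = (up gen 0 n * dn gen 0 k) * up gen 1 n ^ k"
      using Suc by (simp add: mult.assoc)
    also have "\<dots> = dn gen 1 (Suc k) * (gen 1 * up gen 1 n) * up gen 1 n ^ k"
      using shift[of k] Suc.prems n up_rec[of 0 n gen] by simp
    also have "\<dots> = dn gen 0 (Suc k) * up gen 1 n ^ Suc k"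
      using dn_rec[of 0 "Suc k" gen] by (simp add: mult.assoc)
    finally show ?case .
  qed simp
  from this[of n] show ?thesis by (simp add: Delta_def mult.assoc)
qed

section \<open>The orbit of the base point under the centre\<close>

definition shift :: "line \<Rightarrow> line" where
  "shift = pact (Delta n)"

lemma shift_eq [simp]: "shift x = shift y \<longleftrightarrow> x = y"
  by (simp add: shift_def)

text \<open>All integers serve as indices, so that every point has a predecessor in the
  descent.\<close>

definition centre_pt :: "int \<Rightarrow> line" where
  "centre_pt m = (if m \<ge> 0 then (shift ^^ nat m) base else (inv_into UNIV shift ^^ nat (- m)) base)"

lemma shift_inv: "shift (inv_into UNIV shift x) = x"
  using pact_surj by (metis shift_def f_inv_into_f rangeI)

lemma centre_pt_Suc: "centre_pt (m + 1) = shift (centre_pt m)"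
proof (cases "m \<ge> 0")
  case True
  then show ?thesis by (simp add: centre_pt_def nat_add_distrib)
next
  case False
  then obtain k where "m = - int (Suc k)" by (metis int_cases3 nonneg_int_cases linorder_not_le negD)
  then show ?thesis by (cases k) (auto simp: centre_pt_def shift_inv nat_add_distrib)
qed

lemma centre_pt_0 [simp]: "centre_pt 0 = base"
  by (simp add: centre_pt_def)

lemma centre_pt_nat: "centre_pt (int k) = pact (Delta n ^ k) base"
proof (induction k)
  case (Suc k)
  have "centre_pt (int (Suc k)) = centre_pt (int k + 1)" by (simp add: add.commute)
  then show ?case using Suc by (simp add: centre_pt_Suc shift_def P.act_mult)
qed simp

lemma shift_gen: "i \<in> {0<..n} \<Longrightarrow> pact (gen i) (shift x) = shift (pact (gen i) x)"
  unfolding shift_def P.act_mult[symmetric] by (simp add: Delta_gen)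

lemma centre_pt_fixed_iff:
  "i \<in> {0<..n} \<Longrightarrow> pact (gen i) (centre_pt m) = centre_pt m \<longleftrightarrow> i \<noteq> 1"
proof (induction m rule: int_induct[of _ 0])
  case base
  then show ?case using base_fix[of i] base_moved by (cases "i = 1") auto
next
  case (step1 m)
  then show ?case by (simp add: centre_pt_Suc shift_gen)
next
  case (step2 m)
  then show ?case using centre_pt_Suc[of "m - 1"] by (simp add: shift_gen)
qed

definition pt :: "int \<Rightarrow> line" where
  "pt j = (if even j then centre_pt (j div 2) else pact (dn gen 0 n) (centre_pt (j div 2)))"

lemma pt_even: "pt (2 * m) = centre_pt m" and pt_odd: "pt (2 * m + 1) = pact (dn gen 0 n) (centre_pt m)"
  by (simp_all add: pt_def)

lemma up_pt_odd: "pact (up gen 0 n) (pt (2 * m + 1)) = pt (2 * (m + 1))"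
proof -
  have "pact (up gen 1 n ^ n) (centre_pt m) = centre_pt m"
    by (rule P.act_fix[of _ gen "{1<..n}"])
      (use supp_power[of "up gen 1 n" n] up_in_sub[of gen 1 n] centre_pt_fixed_iff in \<open>auto simp: sub_gen_iff\<close>)
  then have "shift (centre_pt m) = pact (up gen 0 n) (pact (dn gen 0 n) (centre_pt m))"
    unfolding shift_def by (simp add: Delta_factor P.act_mult)
  then show ?thesis using pt_even[of "m + 1"] by (simp only: pt_odd centre_pt_Suc)
qed

lemma pt_Suc_less: "pt j < pt (j + 1)"
proof (cases "even j")
  case True
  then obtain m where m: "j = 2 * m" by blast
  have "centre_pt m < pact (gen 1) (centre_pt m)"
    using centre_pt_fixed_iff[of 1 m] n P.act_ge[of "centre_pt m" "gen 1"] by simp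
  also have "\<dots> \<le> pact (dn gen 1 n) (pact (gen 1) (centre_pt m))" by (rule P.act_ge)
  also have "\<dots> = pact (dn gen 0 n) (centre_pt m)" using dn_rec[of 0 n gen] n by (simp add: P.act_mult)
  finally show ?thesis unfolding m pt_odd pt_even .
next
  case False
  then obtain m where m: "j = 2 * m + 1" by (auto elim: oddE)
  let ?x = "pt j"
  have nxt: "pact (gen 1) (pact (up gen 1 n) ?x) = centre_pt (m + 1)"
    using up_pt_odd[of m] up_rec[of 0 n gen] n pt_even[of "m + 1"] m by (simp add: P.act_mult)
  \<comment> \<open>Equality would leave no room for any letter of the ladder to move the point, but
    \<open>gen 1\<close> moves every point of even index.\<close>
  have "?x \<noteq> centre_pt (m + 1)"
  proof
    assume eq: "?x = centre_pt (m + 1)"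
    have "?x \<le> pact (up gen 1 n) ?x" by (rule P.act_ge)
    moreover have "pact (up gen 1 n) ?x \<le> pact (gen 1) (pact (up gen 1 n) ?x)" by (rule P.act_ge)
    ultimately have "pact (up gen 1 n) ?x = ?x" using eq nxt by simp
    then show False using nxt eq centre_pt_fixed_iff[of 1 "m + 1"] n by simp
  qed
  moreover have "?x \<le> centre_pt (m + 1)"
    using P.act_ge[of ?x "up gen 1 n"] P.act_ge[of "pact (up gen 1 n) ?x" "gen 1"] nxt by simp
  moreover have "pt (j + 1) = centre_pt (m + 1)" using pt_even[of "m + 1"] m by (simp add: algebra_simps)
  ultimately show ?thesis by simp
qed

lemma int_strict_mono:
  fixes f :: "int \<Rightarrow> 'a::linorder"
  assumes "\<And>j. f j < f (j + 1)" "i \<le> j"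
  shows "f i \<le> f j"
  using assms(2)
proof (induction j rule: int_ge_induct)
  case (step j)
  then show ?case using assms(1)[of j] by simp
qed simp

lemma braid_line_gen: "braid_line pact n gen base pt"
proof -
  have even_fix: "pact (gen i) (pt (2 * m)) = pt (2 * m)" if "i \<in> {1<..n}" for i m
    using centre_pt_fixed_iff[of i m] that by (simp add: pt_even)
  have odd_fix: "pact (gen i) (pt (2 * m + 1)) = pt (2 * m + 1)" if "i \<in> {0<..<n}" for i m
  proof -
    have "pact (gen i) (pt (2 * m + 1)) = pact (gen i * dn gen 0 n) (centre_pt m)"
      by (simp add: pt_odd P.act_mult)
    also have "gen i * dn gen 0 n = dn gen 0 n * gen (Suc i)" using B.dn_shift[of 0 i n] that by simp
    finally show ?thesis using centre_pt_fixed_iff[of "Suc i" m] that by (simp add: pt_odd P.act_mult)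
  qed
  have up_odd: "pact (up gen 0 n) (pt (2 * m + 1)) = pt (2 * m + 1 + 1)" for m
    using up_pt_odd[of m] by (simp add: algebra_simps)
  show ?thesis
  proof unfold_locales
    fix j i
    show "even j \<Longrightarrow> i \<in> {1<..n} \<Longrightarrow> pact (gen i) (pt j) = pt j" using even_fix by (auto elim!: evenE)
    show "odd j \<Longrightarrow> i \<in> {0<..<n} \<Longrightarrow> pact (gen i) (pt j) = pt j" using odd_fix by (auto elim!: oddE)
    show "even j \<Longrightarrow> pact (dn gen 0 n) (pt j) = pt (j + 1)" by (auto simp: pt_odd pt_even elim!: evenE)
    show "odd j \<Longrightarrow> pact (up gen 0 n) (pt j) = pt (j + 1)" using up_odd by (auto elim!: oddE)
    show "pt j < pt (j + 1)" by (rule pt_Suc_less)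
    have "base = pt 0" by (simp add: pt_def)
    then show "base \<le> pt j \<or> pt (j + 1) \<le> base"
      using int_strict_mono[of pt 0 j, OF pt_Suc_less] int_strict_mono[of pt "j + 1" 0, OF pt_Suc_less]
      by (metis linorder_not_le zless_imp_add1_zle)
  qed
qed

end

section \<open>Fractions in the Artin group\<close>

locale artin_group =
  fixes n :: nat
  assumes n2: "n \<ge> 2"
begin

declare One_nat_def [simp del]

abbreviation G where "G \<equiv> artin_A n"
abbreviation "rels \<equiv> artin_A_relations n"
abbreviation "wrel \<equiv> word_rel {1..n} rels"
abbreviation "wc \<equiv> word_class {1..n} rels"
abbreviation "ginv \<equiv> m_inv G"
abbreviation gmult (infixl "\<cdot>" 70) where "x \<cdot> y \<equiv> x \<otimes>\<^bsub>G\<^esub> y"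
abbreviation "pword \<equiv> map (\<lambda>i :: nat. (i, True))"
abbreviation "D \<equiv> Delta n"

sublocale group G
  unfolding artin_A_def by (rule group_presented_group)

sublocale L: braid_line pact n gen base "pt n"
  by (rule braid_line_gen[OF n2])

section \<open>Embedding positive braids into the group\<close>

lemma pword_gwords: "set X \<subseteq> {1..n} \<Longrightarrow> pword X \<in> gwords {1..n}"
  by (auto simp: gwords_def)

lemma carrier_G: "carrier G = wc ` gwords {1..n}"
  unfolding artin_A_def by (rule carrier_presented_group)

lemma one_G: "\<one>\<^bsub>G\<^esub> = wc []"
  unfolding artin_A_def by (rule one_presented_group)

lemma wc_mult: "u \<in> gwords {1..n} \<Longrightarrow> v \<in> gwords {1..n} \<Longrightarrow> wc u \<cdot> wc v = wc (u @ v)"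
  unfolding artin_A_def by (rule mult_presented_group)

lemma word_rel_Cons:
  "x \<in> {1..n} \<Longrightarrow> (u, v) \<in> wrel \<Longrightarrow> ((x, b) # u, (x, b) # v) \<in> wrel"
  using word_rel.append[OF word_rel.refl, of "[(x, b)]" "{1..n}" u v rels] by (auto simp: gwords_def)

lemma peq_word_rel:
  "X \<approx> Y \<Longrightarrow> set X \<subseteq> {1..n} \<Longrightarrow> (pword X, pword Y) \<in> wrel"
proof (induction rule: peq.induct)
  case Nil
  then show ?case by (auto intro: word_rel.refl simp: gwords_def)
next
  case (same X Y i)
  then show ?case by (simp add: word_rel_Cons)
next
  case (adj i j X Z Y)
  have sets: "set Y \<subseteq> {1..n}" "set Z \<subseteq> {1..n}" "i \<in> {1..n}" "j \<in> {1..n}"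
    using adj.prems peq_set[OF adj.hyps(2)] peq_set[OF adj.hyps(3)] by auto
  have "([(i, True), (j, True), (i, True)], [(j, True), (i, True), (j, True)]) \<in> wrel"
  proof (rule word_rel.relator)
    show "([(i, True), (j, True), (i, True)], [(j, True), (i, True), (j, True)]) \<in> rels"
      using adj.hyps(1) sets unfolding artin_A_relations_def adj_def by auto
  qed (use sets in \<open>auto simp: gwords_def\<close>)
  then have rel: "([(i, True), (j, True), (i, True)] @ pword Z, [(j, True), (i, True), (j, True)] @ pword Z) \<in> wrel"
    using sets by (intro word_rel.append word_rel.refl pword_gwords)
  have "(pword (i # X), pword (i # j # i # Z)) \<in> wrel"
    "(pword (j # Y), pword (j # i # j # Z)) \<in> wrel"
    using adj.IH sets adj.prems by (simp_all add: word_rel_Cons)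
  moreover have "(pword (i # j # i # Z), pword (j # i # j # Z)) \<in> wrel"
    using rel by simp
  ultimately show ?case by (blast intro: word_rel.trans word_rel.sym)
next
  case (far i j X Z Y)
  have sets: "set Y \<subseteq> {1..n}" "set Z \<subseteq> {1..n}" "i \<in> {1..n}" "j \<in> {1..n}"
    using far.prems peq_set[OF far.hyps(2)] peq_set[OF far.hyps(3)] by auto
  have "([(i, True), (j, True)], [(j, True), (i, True)]) \<in> wrel"
  proof (rule word_rel.relator)
    show "([(i, True), (j, True)], [(j, True), (i, True)]) \<in> rels"
      using far.hyps(1) sets unfolding artin_A_relations_def far_def adj_def by auto
  qed (use sets in \<open>auto simp: gwords_def\<close>)
  then have rel: "([(i, True), (j, True)] @ pword Z, [(j, True), (i, True)] @ pword Z) \<in> wrel"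
    using sets by (intro word_rel.append word_rel.refl pword_gwords)
  have "(pword (i # X), pword (i # j # Z)) \<in> wrel"
    "(pword (j # Y), pword (j # i # Z)) \<in> wrel"
    using far.IH sets far.prems by (simp_all add: word_rel_Cons)
  moreover have "(pword (i # j # Z), pword (j # i # Z)) \<in> wrel"
    using rel by simp
  ultimately show ?case by (blast intro: word_rel.trans word_rel.sym)
qed

text \<open>A total function through a chosen word, but meaningful on \<open>Pn\<close>, where every
  representing word uses only letters of the presentation.\<close>

definition phi :: "pbraid \<Rightarrow> nat gword set" where
  "phi x = wc (pword (rep_pbraid x))"

definition Pn :: "pbraid set" where
  "Pn = {x. supp x \<subseteq> {1..n}}"

lemma Pn_simps [simp]: "1 \<in> Pn" "a * b \<in> Pn \<longleftrightarrow> a \<in> Pn \<and> b \<in> Pn" "gen i \<in> Pn \<longleftrightarrow> i \<in> {1..n}"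
  by (auto simp: Pn_def)

lemma Pn_eq: "Pn = sub gen {0<..n}"
proof -
  have eq: "{1..n} = {0<..n}" by auto
  show ?thesis unfolding Pn_def eq by (rule Set.set_eqI) (simp only: mem_Collect_eq sub_gen_iff)
qed

lemma D_Pn [simp]: "D \<in> Pn"
  using supp_Delta[OF n2] unfolding Pn_eq sub_gen_iff .

lemma D_power_Pn [simp]: "D ^ k \<in> Pn"
  by (induction k) auto

lemma D_commute: "a \<in> Pn \<Longrightarrow> a * D ^ k = D ^ k * a"
  using Delta_power_commute[OF n2, of a] unfolding Pn_eq sub_gen_iff by simp

lemma phi_abs: "set X \<subseteq> {1..n} \<Longrightarrow> phi (abs_pbraid X) = wc (pword X)"
proof -
  assume X: "set X \<subseteq> {1..n}"
  have "rep_pbraid (abs_pbraid X) \<approx> X"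
    by (simp add: Quotient3_rep_abs[OF Quotient3_pbraid])
  then have rel: "(pword X, pword (rep_pbraid (abs_pbraid X))) \<in> wrel"
    using peq_word_rel X peq_sym by blast
  then show ?thesis unfolding phi_def using word_rel_gwords[OF rel] word_class_eq_iff word_rel.sym by metis
qed

lemma Pn_abs:
  assumes "x \<in> Pn"
  obtains X where "x = abs_pbraid X" "set X \<subseteq> {1..n}"
proof -
  have "abs_pbraid (rep_pbraid x) = x" by (simp add: Quotient3_abs_rep[OF Quotient3_pbraid])
  moreover have "set (rep_pbraid x) \<subseteq> {1..n}"
    using assms calculation by (metis Pn_def mem_Collect_eq supp.abs_eq)
  ultimately show ?thesis using that by metis
qed

lemma phi_mult: "a \<in> Pn \<Longrightarrow> b \<in> Pn \<Longrightarrow> phi (a * b) = phi a \<cdot> phi b"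
proof -
  assume "a \<in> Pn" "b \<in> Pn"
  then obtain X Y where XY: "a = abs_pbraid X" "set X \<subseteq> {1..n}" "b = abs_pbraid Y" "set Y \<subseteq> {1..n}"
    using Pn_abs by metis
  then show ?thesis using phi_abs[of "X @ Y"]
    by (simp add: times_pbraid.abs_eq phi_abs wc_mult pword_gwords)
qed

lemma phi_one [simp]: "phi 1 = \<one>\<^bsub>G\<^esub>"
  using phi_abs[of "[]"] by (simp add: one_pbraid_def one_G)

lemma phi_gen: "i \<in> {1..n} \<Longrightarrow> phi (gen i) = artin_gen n i"
  using phi_abs[of "[i]"] by (simp add: gen.abs_eq artin_gen_def)

lemma phi_closed [simp]: "a \<in> Pn \<Longrightarrow> phi a \<in> carrier G"
  by (elim Pn_abs) (auto simp: phi_abs carrier_G pword_gwords)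

lemma phi_power: "phi (D ^ k) = phi D [^]\<^bsub>G\<^esub> k"
proof (induction k)
  case (Suc k)
  then show ?case by (simp add: power_Suc2 phi_mult nat_pow_Suc del: power_Suc)
qed simp

definition comp :: "nat \<Rightarrow> pbraid" where
  "comp i = (SOME c. c \<in> Pn \<and> gen i * c = D \<and> c * gen i = D)"

lemma comp: assumes "i \<in> {1..n}" shows "comp i \<in> Pn" "gen i * comp i = D" "comp i * gen i = D"
proof -
  have "i \<in> {0<..n}" using assms by auto
  then obtain c where "c \<in> Pn" "gen i * c = D" "c * gen i = D"
    using Delta_divisor[OF n2] unfolding Pn_eq sub_gen_iff by metis
  then have "comp i \<in> Pn \<and> gen i * comp i = D \<and> comp i * gen i = D"
    unfolding comp_def by (metis (mono_tags, lifting) someI_ex)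
  then show "comp i \<in> Pn" "gen i * comp i = D" "comp i * gen i = D" by auto
qed

text \<open>Inverse letters are cleared by multiplying with the central element once for each.\<close>

definition numer :: "nat gword \<Rightarrow> pbraid" where
  "numer w = prod_list (map (\<lambda>(x, b). if b then gen x else comp x) w)"

definition denom :: "nat gword \<Rightarrow> nat" where
  "denom w = length (filter (\<lambda>(x, b). \<not> b) w)"

lemma numer_simps [simp]:
  "numer [] = 1" "numer ((x, b) # w) = (if b then gen x else comp x) * numer w"
  "numer (u @ v) = numer u * numer v"
  by (simp_all add: numer_def)

lemma denom_simps [simp]:
  "denom [] = 0" "denom ((x, b) # w) = (if b then denom w else Suc (denom w))"
  "denom (u @ v) = denom u + denom v"
  by (simp_all add: denom_def)

lemma numer_Pn: "w \<in> gwords {1..n} \<Longrightarrow> numer w \<in> Pn"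
  by (induction w) (auto simp: gwords_def comp)

lemma numer_rels:
  assumes "(u, v) \<in> rels" "u \<in> gwords {1..n}"
  shows "numer u = numer v" "denom u = 0" "denom v = 0"
proof -
  from assms(1) consider i j where "\<bar>int i - int j\<bar> = 1"
      "u = [(i, True), (j, True), (i, True)]" "v = [(j, True), (i, True), (j, True)]"
    | i j where "\<bar>int i - int j\<bar> \<ge> 2" "u = [(i, True), (j, True)]" "v = [(j, True), (i, True)]"
    unfolding artin_A_relations_def by blast
  then have "numer u = numer v \<and> denom u = 0 \<and> denom v = 0"
  proof cases
    case (1 i j)
    then have "adj i j" by (auto simp: adj_def)
    then show ?thesis using 1 gen_braid[of i j] by (simp add: mult.assoc)
  next
    case (2 i j)
    then have "far i j" by (auto simp: far_def adj_def)
    then show ?thesis using 2 gen_commute[of i j] by simp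
  qed
  then show "numer u = numer v" "denom u = 0" "denom v = 0" by auto
qed

text \<open>Equality of fractions, cross-multiplied. Positive words have no denominators, so this
  invariant yields the injectivity of \<open>phi\<close>.\<close>

lemma word_rel_fraction:
  "(u, v) \<in> wrel \<Longrightarrow> numer u * D ^ denom v = numer v * D ^ denom u"
proof (induction rule: word_rel.induct)
  case (trans u v w)
  have "v \<in> gwords {1..n}" using word_rel_gwords[OF trans.hyps(1)] by simp
  \<comment> \<open>The denominator of the middle word is multiplied in and cancelled at the
    end.\<close>
  have "(numer u * D ^ denom w) * D ^ denom v = (numer u * D ^ denom v) * D ^ denom w"
    by (simp add: mult.assoc flip: power_add) (simp add: add.commute)
  also have "\<dots> = (numer v * D ^ denom w) * D ^ denom u"
    unfolding trans.IH(1) by (simp add: mult.assoc flip: power_add) (simp add: add.commute)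
  also have "\<dots> = (numer w * D ^ denom u) * D ^ denom v"
    unfolding trans.IH(2) by (simp add: mult.assoc flip: power_add) (simp add: add.commute)
  finally show ?case by (simp only: pbraid_right_cancel)
next
  case (append u u' v v')
  have g: "numer v \<in> Pn" "numer v' \<in> Pn"
    using numer_Pn word_rel_gwords[OF append.hyps(2)] by blast+
  have shift: "a * b * D ^ (k + l) = (a * D ^ k) * (b * D ^ l)" if "b \<in> Pn" for a b k l
    using D_commute[OF that, of k] by (simp add: power_add) (metis mult.assoc)
  show ?case using g by (simp add: shift append.IH)
next
  case (cancel x b)
  then show ?case using comp[of x] by auto
next
  case (relator u v)
  then show ?case using numer_rels by simp
qed simp_all

lemma numer_pword: "numer (pword X) = abs_pbraid X" "denom (pword X) = 0"
proof -
  show "numer (pword X) = abs_pbraid X"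
    by (induction X) (auto simp: one_pbraid_def gen.abs_eq times_pbraid.abs_eq)
  show "denom (pword X) = 0" by (induction X) auto
qed

lemma phi_inj: "a \<in> Pn \<Longrightarrow> b \<in> Pn \<Longrightarrow> phi a = phi b \<longleftrightarrow> a = b"
proof -
  assume "a \<in> Pn" "b \<in> Pn"
  then obtain X Y where XY: "a = abs_pbraid X" "set X \<subseteq> {1..n}" "b = abs_pbraid Y" "set Y \<subseteq> {1..n}"
    using Pn_abs by metis
  have "a = b" if "phi a = phi b"
  proof -
    have "(pword X, pword Y) \<in> wrel"
      using that XY word_class_eq_iff[OF pword_gwords pword_gwords, of X Y] by (simp add: phi_abs)
    then show ?thesis using word_rel_fraction XY by (fastforce simp: numer_pword)
  qed
  then show ?thesis by blast
qed

lemma D_power_Suc: "phi (D ^ Suc k) = phi (D ^ k) \<cdot> phi D"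
  by (simp only: phi_power nat_pow_Suc)

lemma wc_fraction:
  "w \<in> gwords {1..n} \<Longrightarrow> wc w \<cdot> phi (D ^ denom w) = phi (numer w)"
proof (induction w)
  case Nil
  then show ?case by (simp flip: one_G)
next
  case (Cons l w)
  obtain x b where l: "l = (x, b)" by (cases l)
  have x: "x \<in> {1..n}" and w: "w \<in> gwords {1..n}" and l1: "[(x, b)] \<in> gwords {1..n}"
    using Cons.prems l by (auto simp: gwords_def)
  have cl: "wc w \<in> carrier G" "wc [(x, b)] \<in> carrier G" using w l1 carrier_G by blast+
  have IH: "wc w \<cdot> phi (D ^ denom w) = phi (numer w)" using Cons.IH w by blast
  have split: "wc (l # w) = wc [(x, b)] \<cdot> wc w" using wc_mult[OF l1 w] l by simp
  show ?case
  proof (cases b)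
    case True
    have "wc [(x, b)] = phi (gen x)" using phi_gen[OF x] True by (simp add: artin_gen_def)
    then show ?thesis unfolding split using cl IH x numer_Pn[OF w] True l
      by (simp add: m_assoc phi_mult)
  next
    case False
    let ?y = "wc [(x, b)]"
    have inv: "?y \<cdot> phi (gen x) = \<one>\<^bsub>G\<^esub>"
    proof -
      have xT: "[(x, True)] \<in> gwords {1..n}" using x by (auto simp: gwords_def)
      have "([(x, False), (x, True)], []) \<in> wrel"
        using word_rel.cancel[OF x, of False rels] by simp
      then have "wc [(x, False), (x, True)] = wc []"
        using word_class_eq_iff[of "[(x, False), (x, True)]" "{1..n}" "[]" rels] x
        by (auto simp: gwords_def)
      then show ?thesis using wc_mult[OF l1 xT] phi_gen[OF x] False
        by (simp add: artin_gen_def one_G)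
    qed
    have "?y \<cdot> phi D = ?y \<cdot> (phi (gen x) \<cdot> phi (comp x))"
      using comp[OF x] phi_mult[of "gen x" "comp x"] x by simp
    also have "\<dots> = phi (comp x)" using inv cl x comp[OF x] by (simp flip: m_assoc)
    finally have y: "?y \<cdot> phi D = phi (comp x)" .
    have "wc (l # w) \<cdot> phi (D ^ denom (l # w)) =
        ?y \<cdot> (wc w \<cdot> phi (D ^ denom w)) \<cdot> phi D"
      unfolding split using cl False l D_power_Suc[of "denom w"]
      by (simp add: m_assoc del: power_Suc)
    also have "\<dots> = ?y \<cdot> phi (numer w * D)"
      using cl numer_Pn[OF w] by (simp add: IH m_assoc phi_mult)
    also have "numer w * D = D * numer w" using D_commute[OF numer_Pn[OF w], of 1] by simp
    also have "?y \<cdot> phi (D * numer w) = (?y \<cdot> phi D) \<cdot> phi (numer w)"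
      using cl numer_Pn[OF w] by (simp add: m_assoc phi_mult)
    also have "\<dots> = phi (numer (l # w))" unfolding y
      using False l numer_Pn[OF w] comp(1)[OF x] by (simp add: phi_mult)
    finally show ?thesis .
  qed
qed

text \<open>Represents \<alpha> as \<open>a\<close> over \<open>D ^ k\<close>. The fraction need not
  be reduced, so notions defined by it are checked for independence of the choice
  (\<open>frac_compare\<close>).\<close>

definition frac :: "nat gword set \<Rightarrow> pbraid \<Rightarrow> nat \<Rightarrow> bool" where
  "frac \<alpha> a k \<longleftrightarrow> \<alpha> \<in> carrier G \<and> a \<in> Pn \<and> \<alpha> \<cdot> phi (D ^ k) = phi a"

lemma frac_ex:
  assumes "\<alpha> \<in> carrier G"
  obtains a k where "frac \<alpha> a k"
proof -
  obtain w where "w \<in> gwords {1..n}" "\<alpha> = wc w" using assms carrier_G by blast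
  then have "frac \<alpha> (numer w) (denom w)"
    unfolding frac_def using assms wc_fraction numer_Pn by simp
  then show ?thesis using that by blast
qed

lemma D_powers: "phi (D ^ k) \<cdot> phi (D ^ l) = phi (D ^ (k + l))"
  by (simp add: power_add phi_mult)

lemma frac_extend: "frac \<alpha> a k \<Longrightarrow> \<alpha> \<cdot> phi (D ^ (k + l)) = phi (a * D ^ l)"
  unfolding frac_def by (simp add: phi_mult m_assoc flip: D_powers) (simp flip: m_assoc)

lemma frac_eq: "frac \<alpha> a k \<Longrightarrow> frac \<alpha> b l \<Longrightarrow> a * D ^ l = b * D ^ k"
  using frac_extend[of \<alpha> a k l] frac_extend[of \<alpha> b l k] phi_inj[of "a * D ^ l" "b * D ^ k"]
  by (simp add: frac_def add.commute)

lemma phi_D_commute: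
  assumes "\<alpha> \<in> carrier G"
  shows "phi (D ^ l) \<cdot> \<alpha> = \<alpha> \<cdot> phi (D ^ l)"
proof -
  obtain a k where f: "frac \<alpha> a k" using frac_ex assms by blast
  then have a: "a \<in> Pn" by (simp add: frac_def)
  have "phi (D ^ l) \<cdot> \<alpha> \<cdot> phi (D ^ k) = phi (D ^ l * a)"
    using f assms by (simp add: m_assoc phi_mult frac_def)
  also have "\<dots> = \<alpha> \<cdot> phi (D ^ (k + l))" using frac_extend[OF f] D_commute[OF a] by simp
  also have "\<dots> = \<alpha> \<cdot> phi (D ^ l) \<cdot> phi (D ^ k)"
    using assms by (simp add: m_assoc D_powers add.commute)
  finally show ?thesis using assms by (simp add: right_cancel)
qed

lemma frac_mult:
  assumes "frac \<alpha> a k" "frac \<beta> b l"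
  shows "frac (\<alpha> \<cdot> \<beta>) (a * b) (k + l)"
proof -
  have c: "\<alpha> \<in> carrier G" "\<beta> \<in> carrier G" "a \<in> Pn" "b \<in> Pn" using assms by (auto simp: frac_def)
  have "\<alpha> \<cdot> \<beta> \<cdot> phi (D ^ (k + l)) = \<alpha> \<cdot> (\<beta> \<cdot> phi (D ^ k)) \<cdot> phi (D ^ l)"
    using c by (simp add: m_assoc flip: D_powers)
  also have "\<dots> = (\<alpha> \<cdot> phi (D ^ k)) \<cdot> (\<beta> \<cdot> phi (D ^ l))"
    using c by (simp add: m_assoc flip: phi_D_commute[OF c(2), of k])
  also have "\<dots> = phi (a * b)" using assms c by (simp add: frac_def phi_mult)
  finally show ?thesis using c by (simp add: frac_def)
qed

lemma frac_phi: "a \<in> Pn \<Longrightarrow> frac (phi a) a 0"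
  by (simp add: frac_def)

lemma frac_inv: "frac \<alpha> a k \<Longrightarrow> frac (ginv \<alpha>) b l \<Longrightarrow> a * b = D ^ (k + l)"
proof -
  assume f: "frac \<alpha> a k" "frac (ginv \<alpha>) b l"
  then have "frac \<one>\<^bsub>G\<^esub> (a * b) (k + l)" using frac_mult[OF f] by (simp add: frac_def)
  from frac_eq[OF this frac_phi[of 1, simplified]] show ?thesis by simp
qed

abbreviation "move a \<equiv> pact a base"

text \<open>The action is only defined for positive braids; clearing the denominator turns "\<alpha>
  moves the base point down" into a comparison of two of them.\<close>

definition low :: "nat gword set \<Rightarrow> bool" where
  "low \<alpha> \<longleftrightarrow> (\<exists>a k. frac \<alpha> a k \<and> move a < move (D ^ k))"

definition level :: "nat gword set \<Rightarrow> bool" where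
  "level \<alpha> \<longleftrightarrow> (\<exists>a k. frac \<alpha> a k \<and> move a = move (D ^ k))"

lemma move_shift:
  "a \<in> Pn \<Longrightarrow> pact (D ^ l) (move a) = move (a * D ^ l)"
  by (simp add: D_commute P.act_mult)

text \<open>As for ordinary fractions, each side is multiplied by the other denominator, and powers
  of \<open>D\<close> preserve and reflect the order.\<close>

lemma frac_compare:
  assumes "frac \<alpha> a k" "frac \<alpha> b l"
  shows "move a < move (D ^ k) \<longleftrightarrow> move b < move (D ^ l)" "move a = move (D ^ k) \<longleftrightarrow> move b = move (D ^ l)"
proof -
  have c: "a \<in> Pn" "b \<in> Pn" using assms by (auto simp: frac_def)
  have 1: "pact (D ^ l) (move a) = pact (D ^ k) (move b)"
    using frac_eq[OF assms] c by (simp add: move_shift)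
  have 2: "pact (D ^ l) (move (D ^ k)) = pact (D ^ k) (move (D ^ l))"
    by (simp add: move_shift add.commute flip: power_add)
  show "move a < move (D ^ k) \<longleftrightarrow> move b < move (D ^ l)"
    using P.act_less_iff[of "D ^ l" "move a" "move (D ^ k)"] unfolding 1 2 by simp
  show "move a = move (D ^ k) \<longleftrightarrow> move b = move (D ^ l)"
    using P.act_eq_iff[of "D ^ l" "move a" "move (D ^ k)"] unfolding 1 2 by auto
qed

lemma low_iff: "frac \<alpha> a k \<Longrightarrow> low \<alpha> \<longleftrightarrow> move a < move (D ^ k)"
  and level_iff: "frac \<alpha> a k \<Longrightarrow> level \<alpha> \<longleftrightarrow> move a = move (D ^ k)"
  using frac_compare unfolding low_def level_def by blast+

lemma move_mult_less:
  assumes "a \<in> Pn" "b \<in> Pn" "move a < move (D ^ k) \<or> move a = move (D ^ k)"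
    "move b < move (D ^ l) \<or> move b = move (D ^ l)"
  shows "move (a * b) \<le> move (D ^ (k + l))"
    "move a < move (D ^ k) \<or> move b < move (D ^ l) \<Longrightarrow> move (a * b) < move (D ^ (k + l))"
    "move a = move (D ^ k) \<Longrightarrow> move b = move (D ^ l) \<Longrightarrow> move (a * b) = move (D ^ (k + l))"
proof -
  have 1: "pact a (move (D ^ l)) = pact (D ^ l) (move a)"
    using assms(1) by (simp add: move_shift) (simp add: P.act_mult)
  have 2: "pact (D ^ l) (move (D ^ k)) = move (D ^ (k + l))"
    by (simp add: move_shift flip: power_add)
  have 3: "move (a * b) = pact a (move b)" by (simp add: P.act_mult)
  have 4: "pact a (move b) \<le> pact a (move (D ^ l))" "pact (D ^ l) (move a) \<le> pact (D ^ l) (move (D ^ k))"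
    using assms by auto
  show "move (a * b) \<le> move (D ^ (k + l))" using 1 2 3 4 by simp
  show "move (a * b) < move (D ^ (k + l))" if "move a < move (D ^ k) \<or> move b < move (D ^ l)"
    using that
  proof
    assume "move a < move (D ^ k)"
    then have "pact (D ^ l) (move a) < pact (D ^ l) (move (D ^ k))" by simp
    then show ?thesis using 1 2 3 4 by simp
  next
    assume "move b < move (D ^ l)"
    then have "pact a (move b) < pact a (move (D ^ l))" by simp
    then show ?thesis using 1 2 3 4 by simp
  qed
  show "move a = move (D ^ k) \<Longrightarrow> move b = move (D ^ l) \<Longrightarrow> move (a * b) = move (D ^ (k + l))"
    using 1 2 3 by simp
qed

lemma low_mult:
  assumes "\<alpha> \<in> carrier G" "\<beta> \<in> carrier G"
  shows "low \<alpha> \<Longrightarrow> low \<beta> \<Longrightarrow> low (\<alpha> \<cdot> \<beta>)" "low \<alpha> \<Longrightarrow> level \<beta> \<Longrightarrow> low (\<alpha> \<cdot> \<beta>)"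
    "level \<alpha> \<Longrightarrow> low \<beta> \<Longrightarrow> low (\<alpha> \<cdot> \<beta>)" "level \<alpha> \<Longrightarrow> level \<beta> \<Longrightarrow> level (\<alpha> \<cdot> \<beta>)"
proof -
  obtain a k b l where f: "frac \<alpha> a k" "frac \<beta> b l" using frac_ex assms by metis
  have c: "a \<in> Pn" "b \<in> Pn" using f by (auto simp: frac_def)
  note iffs = low_iff[OF f(1)] low_iff[OF f(2)] low_iff[OF frac_mult[OF f]]
    level_iff[OF f(1)] level_iff[OF f(2)] level_iff[OF frac_mult[OF f]]
  show "low \<alpha> \<Longrightarrow> low \<beta> \<Longrightarrow> low (\<alpha> \<cdot> \<beta>)" "low \<alpha> \<Longrightarrow> level \<beta> \<Longrightarrow> low (\<alpha> \<cdot> \<beta>)"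
    "level \<alpha> \<Longrightarrow> low \<beta> \<Longrightarrow> low (\<alpha> \<cdot> \<beta>)" "level \<alpha> \<Longrightarrow> level \<beta> \<Longrightarrow> level (\<alpha> \<cdot> \<beta>)"
    unfolding iffs using move_mult_less[OF c] by blast+
qed

text \<open>Fractions of \<alpha> and its inverse satisfy \<open>a * b = D ^ (k + l)\<close>. So
  \<open>a\<close> moves the base point less far than \<open>D ^ k\<close> exactly if
  \<open>b\<close> moves it further than \<open>D ^ l\<close>.\<close>

lemma trichotomy:
  assumes "\<alpha> \<in> carrier G"
  shows "low \<alpha> \<or> low (ginv \<alpha>) \<or> level \<alpha>" "\<not> (low \<alpha> \<and> low (ginv \<alpha>))"
    "\<not> (low \<alpha> \<and> level \<alpha>)" "level \<alpha> \<longleftrightarrow> level (ginv \<alpha>)"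
proof -
  obtain a k b l where f: "frac \<alpha> a k" "frac (ginv \<alpha>) b l"
    using frac_ex assms inv_closed by metis
  have c: "a \<in> Pn" "b \<in> Pn" using f by (auto simp: frac_def)
  have ab: "move (a * b) = move (D ^ (k + l))" using frac_inv[OF f] by simp
  have 1: "pact a (move (D ^ l)) = pact (D ^ l) (move a)"
    using c(1) by (simp add: move_shift) (simp add: P.act_mult)
  have 2: "pact (D ^ l) (move (D ^ k)) = pact a (move b)"
    using ab by (simp add: move_shift P.act_mult flip: power_add)
  have less: "move a < move (D ^ k) \<longleftrightarrow> move (D ^ l) < move b"
    using P.act_less_iff[of "D ^ l" "move a" "move (D ^ k)"] P.act_less_iff[of a "move (D ^ l)" "move b"] 1 2
    by simp
  have eq: "move a = move (D ^ k) \<longleftrightarrow> move (D ^ l) = move b"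
    using P.act_eq_iff[of "D ^ l" "move a" "move (D ^ k)"] P.act_eq_iff[of a "move (D ^ l)" "move b"] 1 2
    by simp
  note iffs = low_iff[OF f(1)] low_iff[OF f(2)] level_iff[OF f(1)] level_iff[OF f(2)]
  show "low \<alpha> \<or> low (ginv \<alpha>) \<or> level \<alpha>" "\<not> (low \<alpha> \<and> low (ginv \<alpha>))"
    "\<not> (low \<alpha> \<and> level \<alpha>)" "level \<alpha> \<longleftrightarrow> level (ginv \<alpha>)"
    unfolding iffs less eq by auto
qed

section \<open>Parabolic submonoids in the group and the stabiliser of the base point\<close>

lemma sub_Pn: "a \<in> sub gen I \<Longrightarrow> I \<subseteq> {1..n} \<Longrightarrow> a \<in> Pn"
  unfolding Pn_def sub_gen_iff by blast

lemma monoid_generate_gens: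
  assumes "I \<subseteq> {1..n}"
  shows "monoid_generate G (artin_gen n ` I) = phi ` sub gen I"
proof
  have Pn: "sub gen I \<subseteq> Pn" using assms sub_Pn by blast
  show "monoid_generate G (artin_gen n ` I) \<subseteq> phi ` sub gen I"
  proof
    fix x assume "x \<in> monoid_generate G (artin_gen n ` I)"
    then show "x \<in> phi ` sub gen I"
    proof (induction rule: monoid_generate.induct)
      case one
      show ?case by (rule image_eqI[of _ _ 1]) simp_all
    next
      case (incl x)
      then obtain i where "i \<in> I" "x = artin_gen n i" by blast
      then show ?case using phi_gen[of i] assms by (intro image_eqI[of _ _ "gen i"]) auto
    next
      case (mult x y)
      then obtain a b where "a \<in> sub gen I" "b \<in> sub gen I" "x = phi a" "y = phi b" by blast
      then show ?case using phi_mult[of a b] Pn by (intro image_eqI[of _ _ "a * b"]) auto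
    qed
  qed
  show "phi ` sub gen I \<subseteq> monoid_generate G (artin_gen n ` I)"
  proof
    fix x assume "x \<in> phi ` sub gen I"
    then obtain a where "a \<in> sub gen I" "x = phi a" by blast
    then show "x \<in> monoid_generate G (artin_gen n ` I)"
    proof (induction arbitrary: x rule: sub.induct)
      case one
      then show ?case by (simp add: monoid_generate.one)
    next
      case (step i a)
      then have "x = artin_gen n i \<cdot> phi a"
        using phi_mult[of "gen i" a] phi_gen[of i] assms Pn by (auto simp: subset_iff)
      moreover have "artin_gen n i \<in> monoid_generate G (artin_gen n ` I)"
        using step.hyps(1) by (intro monoid_generate.incl imageI)
      ultimately show ?case using step.IH[of "phi a"] by (simp add: monoid_generate.mult)
    qed
  qed
qed

lemma gens_closed: "I \<subseteq> {1..n} \<Longrightarrow> artin_gen n ` I \<subseteq> carrier G"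
proof
  fix x assume "I \<subseteq> {1..n}" "x \<in> artin_gen n ` I"
  then obtain i where "i \<in> {1..n}" "x = artin_gen n i" by blast
  then show "x \<in> carrier G" using phi_closed[of "gen i"] phi_gen[of i] by simp
qed

lemma generate_closed: "\<alpha> \<in> generate G (artin_gen n ` I) \<Longrightarrow> I \<subseteq> {1..n} \<Longrightarrow> \<alpha> \<in> carrier G"
  using generate_in_carrier[OF gens_closed] by blast

lemma phi_generate: "a \<in> sub gen I \<Longrightarrow> I \<subseteq> {1..n} \<Longrightarrow> phi a \<in> generate G (artin_gen n ` I)"
proof (induction rule: sub.induct)
  case one
  then show ?case by (simp add: generate.one)
next
  case (step i a)
  then have "a \<in> Pn" "i \<in> {1..n}" using sub_Pn by blast+
  then have "phi (gen i * a) = artin_gen n i \<cdot> phi a" by (simp add: phi_mult phi_gen)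
  then show ?case using step by (auto intro: generate.eng generate.incl)
qed

lemma pt_power: "pt n (2 * int k) = move (D ^ k)"
  using pt_even[OF n2, of "int k"] centre_pt_nat[OF n2, of k] by simp

lemma pt_0: "pt n 0 = base"
  using pt_power[of 0] by simp

text \<open>If \<open>a\<close> and \<open>D ^ k\<close> move the base point equally far, they share
  the left factor \<open>ladders 0 (2 * k)\<close> and differ only by right factors from
  \<open>M\<^sub>1\<close>, whose quotient is \<alpha>.\<close>

lemma level_generate: "level \<alpha> \<longleftrightarrow> \<alpha> \<in> generate G (artin_gen n ` {2..n})" if "\<alpha> \<in> carrier G"
proof
  assume "level \<alpha>"
  then obtain a k where f: "frac \<alpha> a k" and eq: "move a = move (D ^ k)" by (auto simp: level_def)
  have par0: "par n 0 = {2..n}" by (auto simp: par_def)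
  have a: "a \<in> Pn" using f by (simp add: frac_def)
  obtain u v where uv: "u \<in> sub gen {2..n}" "a = L.ladders 0 (2 * k) * u"
      "v \<in> sub gen {2..n}" "D ^ k = L.ladders 0 (2 * k) * v"
    using L.act_eq_pt[of a 0 "2 * k"] L.act_eq_pt[of "D ^ k" 0 "2 * k"] a eq pt_power[of k]
    by (auto simp: pt_0 par0 Pn_eq[symmetric])
  have c: "u \<in> Pn" "v \<in> Pn" "L.ladders 0 (2 * k) \<in> Pn"
    using uv a sub_Pn[OF uv(1)] sub_Pn[OF uv(3)] by auto
  have "phi (D ^ k) \<cdot> \<alpha> = phi a" using f phi_D_commute that by (simp add: frac_def)
  then have "phi (L.ladders 0 (2 * k)) \<cdot> (phi v \<cdot> \<alpha>) = phi (L.ladders 0 (2 * k)) \<cdot> phi u"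
    using uv c that by (simp add: phi_mult m_assoc)
  then have "phi v \<cdot> \<alpha> = phi u" using c that by simp
  then have "\<alpha> = ginv (phi v) \<cdot> phi u" using c that inv_solve_left by (metis phi_closed)
  moreover have "phi u \<in> generate G (artin_gen n ` {2..n})" "phi v \<in> generate G (artin_gen n ` {2..n})"
    using uv by (auto intro: phi_generate)
  moreover have "artin_gen n ` {2..n} \<subseteq> carrier G"
    by (rule gens_closed) auto
  ultimately show "\<alpha> \<in> generate G (artin_gen n ` {2..n})"
    by (simp add: generate_m_inv_closed generate.eng)
next
  assume "\<alpha> \<in> generate G (artin_gen n ` {2..n})"
  then show "level \<alpha>"
  proof (induction rule: generate.induct)
    case one
    show ?case using level_iff[OF frac_phi[of 1]] by simp
  next
    case (incl h)
    then obtain i where i: "i \<in> {2..n}" "h = artin_gen n i" by blast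
    then show ?case using level_iff[OF frac_phi[of "gen i"]] phi_gen[of i] base_fix[of i] by simp
  next
    case (inv h)
    then obtain i where i: "i \<in> {2..n}" "h = artin_gen n i" by blast
    then have "level h" "h \<in> carrier G"
      using level_iff[OF frac_phi[of "gen i"]] phi_gen[of i] base_fix[of i] phi_closed[of "gen i"] by auto
    then show ?case using trichotomy(4) by blast
  next
    case (eng h1 h2)
    then show ?case using low_mult(4) generate_closed[of _ "{2..n}"] by auto
  qed
qed

end

section \<open>Alternating forms and depth\<close>

context artin_group
begin

text \<open>A list in an alternating form is a priori only a list of sets of words. The product
  of the presented group is associative on all sets of words, which makes such lists tractable.\<close>

lemma mult_sets: "A \<cdot> B = (\<Union>u\<in>A. \<Union>v\<in>B. wc (u @ v))"
  by (simp add: artin_A_def presented_group_def)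

lemma wc_iff: "x \<in> wc w \<longleftrightarrow> (w, x) \<in> wrel"
  by (simp add: word_class_def)

lemma mult_sets_iff: "x \<in> A \<cdot> B \<longleftrightarrow> (\<exists>u. u \<in> A \<and> (\<exists>v. v \<in> B \<and> (u @ v, x) \<in> wrel))"
  by (auto simp: mult_sets wc_iff)

lemma gwords_append_iff: "u @ v \<in> gwords X \<longleftrightarrow> u \<in> gwords X \<and> v \<in> gwords X"
  by (auto simp: gwords_def)

lemma mult_sets_assoc: "A \<cdot> B \<cdot> C = A \<cdot> (B \<cdot> C)"
proof -
  let ?W = "gwords {1..n}"
  have left: "(\<exists>u'. (u, u') \<in> wrel \<and> (u' @ w, x) \<in> wrel) \<longleftrightarrow> (u @ w, x) \<in> wrel" for u w x
  proof
    assume "\<exists>u'. (u, u') \<in> wrel \<and> (u' @ w, x) \<in> wrel"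
    then obtain u' where u': "(u, u') \<in> wrel" "(u' @ w, x) \<in> wrel" by blast
    then have "w \<in> ?W" using word_rel_gwords gwords_append_iff by blast
    then show "(u @ w, x) \<in> wrel"
      using word_rel.trans[OF word_rel.append[OF u'(1) word_rel.refl] u'(2)] by blast
  next
    assume "(u @ w, x) \<in> wrel"
    moreover from this have "u \<in> ?W" using word_rel_gwords gwords_append_iff by blast
    ultimately show "\<exists>u'. (u, u') \<in> wrel \<and> (u' @ w, x) \<in> wrel" using word_rel.refl by blast
  qed
  have right: "(\<exists>w'. (w, w') \<in> wrel \<and> (u @ w', x) \<in> wrel) \<longleftrightarrow> (u @ w, x) \<in> wrel" for u w x
  proof
    assume "\<exists>w'. (w, w') \<in> wrel \<and> (u @ w', x) \<in> wrel"
    then obtain w' where w': "(w, w') \<in> wrel" "(u @ w', x) \<in> wrel" by blast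
    then have "u \<in> ?W" using word_rel_gwords gwords_append_iff by blast
    then show "(u @ w, x) \<in> wrel"
      using word_rel.trans[OF word_rel.append[OF word_rel.refl w'(1)] w'(2)] by blast
  next
    assume "(u @ w, x) \<in> wrel"
    moreover from this have "w \<in> ?W" using word_rel_gwords gwords_append_iff by blast
    ultimately show "\<exists>w'. (w, w') \<in> wrel \<and> (u @ w', x) \<in> wrel" using word_rel.refl by blast
  qed
  have "x \<in> A \<cdot> B \<cdot> C \<longleftrightarrow> (\<exists>u\<in>A. \<exists>v\<in>B. \<exists>w\<in>C. (u @ v @ w, x) \<in> wrel)" for x
  proof -
    have "x \<in> A \<cdot> B \<cdot> C \<longleftrightarrow>
        (\<exists>u\<in>A. \<exists>v\<in>B. \<exists>w\<in>C. \<exists>u'. (u @ v, u') \<in> wrel \<and> (u' @ w, x) \<in> wrel)"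
      unfolding Bex_def mult_sets_iff by blast
    then show ?thesis by (simp only: left append_assoc)
  qed
  moreover have "x \<in> A \<cdot> (B \<cdot> C) \<longleftrightarrow> (\<exists>u\<in>A. \<exists>v\<in>B. \<exists>w\<in>C. (u @ v @ w, x) \<in> wrel)" for x
  proof -
    have "x \<in> A \<cdot> (B \<cdot> C) \<longleftrightarrow>
        (\<exists>u\<in>A. \<exists>v\<in>B. \<exists>w\<in>C. \<exists>w'. (v @ w, w') \<in> wrel \<and> (u @ w', x) \<in> wrel)"
      unfolding Bex_def mult_sets_iff by blast
    then show ?thesis by (simp only: right)
  qed
  ultimately show ?thesis by blast
qed

text \<open>Multiplication closes a set of words under the relation, so the unit law can fail for an
  arbitrary set. A product is closed already.\<close>

lemma mult_sets_one: "A \<cdot> B \<cdot> \<one>\<^bsub>G\<^esub> = A \<cdot> B"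
proof -
  have "B \<cdot> \<one>\<^bsub>G\<^esub> = (\<Union>v\<in>B. wc v)" for B
  proof -
    have "x \<in> B \<cdot> \<one>\<^bsub>G\<^esub> \<longleftrightarrow> (\<exists>v\<in>B. (v, x) \<in> wrel)" for x
    proof
      assume "x \<in> B \<cdot> \<one>\<^bsub>G\<^esub>"
      then obtain v e where v: "v \<in> B" "([], e) \<in> wrel" "(v @ e, x) \<in> wrel"
        by (auto simp: mult_sets one_G wc_iff)
      have "v \<in> gwords {1..n}" using word_rel_gwords[OF v(3)] by (simp add: gwords_append_iff)
      then have "(v @ [], v @ e) \<in> wrel" using v word_rel.append word_rel.refl by blast
      then show "\<exists>v\<in>B. (v, x) \<in> wrel" using v word_rel.trans by force
    next
      assume "\<exists>v\<in>B. (v, x) \<in> wrel"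
      moreover have "([], []) \<in> wrel" by (rule word_rel.refl) (simp add: gwords_def)
      ultimately show "x \<in> B \<cdot> \<one>\<^bsub>G\<^esub>" by (force simp: mult_sets one_G wc_iff)
    qed
    then show ?thesis by (auto simp: wc_iff)
  qed
  then have "A \<cdot> B \<cdot> \<one>\<^bsub>G\<^esub> = (\<Union>v\<in>A \<cdot> B. wc v)" by blast
  also have "\<dots> = A \<cdot> B"
  proof -
    have "(\<Union>v\<in>wc w. wc v) = wc w" for w
      using word_rel.trans word_rel.refl word_rel_gwords by (fastforce simp: wc_iff)
    then show ?thesis by (simp add: mult_sets)
  qed
  finally show ?thesis .
qed

lemma foldr_mult:
  assumes "z \<in> carrier G"
  shows "foldr (mult G) ys z = foldr (mult G) ys \<one>\<^bsub>G\<^esub> \<cdot> z"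
proof (induction ys)
  case (Cons y ys)
  have "foldr (mult G) (y # ys) z = y \<cdot> (foldr (mult G) ys \<one>\<^bsub>G\<^esub> \<cdot> z)"
    by (simp only: foldr_Cons o_apply Cons)
  also have "\<dots> = foldr (mult G) (y # ys) \<one>\<^bsub>G\<^esub> \<cdot> z"
    by (simp only: foldr_Cons o_apply mult_sets_assoc)
  finally show ?case .
qed (use assms in simp)

lemma list_mult_snoc: "x \<in> carrier G \<Longrightarrow> list_mult G (ys @ [x]) = list_mult G ys \<cdot> x"
  unfolding list_mult_def using foldr_mult[of x ys] by simp

lemma list_mult_solve:
  assumes "ys \<noteq> []" "x \<in> carrier G" "a \<in> carrier G"
  shows "a = list_mult G ys \<cdot> x \<longleftrightarrow> a \<cdot> ginv x = list_mult G ys"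
proof
  obtain y zs where ys: "ys = y # zs" using assms(1) by (cases ys) auto
  assume "a = list_mult G ys \<cdot> x"
  then have "a \<cdot> ginv x = list_mult G ys \<cdot> (x \<cdot> ginv x)" by (simp add: mult_sets_assoc)
  also have "\<dots> = list_mult G ys" using assms(2) ys by (simp add: list_mult_def mult_sets_one)
  finally show "a \<cdot> ginv x = list_mult G ys" .
next
  assume "a \<cdot> ginv x = list_mult G ys"
  then show "a = list_mult G ys \<cdot> x"
    using assms by (metis inv_closed m_assoc l_inv r_one)
qed

text \<open>Turns the condition on all tails of the list into a recursion that splits off one factor
  and exchanges the submonoids.\<close>

lemma alternating_Cons:
  assumes "a \<in> carrier G" "tau G M K a \<in> carrier G"
  shows "alternating_form G M K K' a (x # xs) \<longleftrightarrow> x = tau G M K a \<and>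
    (if xs = [] then x \<noteq> \<one>\<^bsub>G\<^esub> \<and> a = x else alternating_form G M K' K (a \<cdot> ginv x) xs)"
proof (cases "x = tau G M K a")
  case True
  then have x: "x \<in> carrier G" using assms by simp
  have prod: "list_mult G (rev (x # xs)) = list_mult G (rev xs) \<cdot> x" using list_mult_snoc[OF x] by simp
  define Q where "Q \<longleftrightarrow> (\<forall>i<length xs. xs ! i = tau G M (if even i then K' else K) (list_mult G (rev (drop i xs))))"
  have all: "(\<forall>i<length (x # xs). (x # xs) ! i =
      tau G M (if even i then K else K') (list_mult G (rev (drop i (x # xs))))) \<longleftrightarrow>
    x = tau G M K (list_mult G (rev (x # xs))) \<and> Q"
    unfolding Q_def by (auto simp: All_less_Suc2)
  have form: "alternating_form G M K K' a (x # xs) \<longleftrightarrow> last (x # xs) \<noteq> \<one>\<^bsub>G\<^esub> \<and>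
      a = list_mult G (rev xs) \<cdot> x \<and> x = tau G M K (list_mult G (rev xs) \<cdot> x) \<and> Q"
    unfolding alternating_form_def all prod by blast
  show ?thesis
  proof (cases "xs = []")
    case True
    then have "list_mult G (rev xs) \<cdot> x = x" Q using x by (simp_all add: list_mult_def Q_def)
    then have "alternating_form G M K K' a (x # xs) \<longleftrightarrow> x \<noteq> \<one>\<^bsub>G\<^esub> \<and> a = x \<and> x = tau G M K x"
      using form True by simp
    then show ?thesis using \<open>x = tau G M K a\<close> True by metis
  next
    case False
    have "alternating_form G M K' K (a \<cdot> ginv x) xs \<longleftrightarrow>
        last xs \<noteq> \<one>\<^bsub>G\<^esub> \<and> a \<cdot> ginv x = list_mult G (rev xs) \<and> Q"
      unfolding alternating_form_def Q_def using False by blast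
    moreover have "last (x # xs) = last xs" using False by simp
    moreover have "a = list_mult G (rev xs) \<cdot> x \<longleftrightarrow> a \<cdot> ginv x = list_mult G (rev xs)"
      using list_mult_solve[of "rev xs" x a] False x assms(1) by blast
    ultimately show ?thesis using \<open>x = tau G M K a\<close> False form by metis
  qed
next
  case False
  have "x = tau G M K a" if "alternating_form G M K K' a (x # xs)"
    using that unfolding alternating_form_def by force
  then show ?thesis using False by blast
qed

abbreviation MM where "MM \<equiv> phi ` Pn"

lemma le_R_phi:
  assumes "c \<in> Pn" "a \<in> Pn"
  shows "le_R G MM (phi c) (phi a) \<longleftrightarrow> (\<exists>y. a = y * c)"
proof
  assume "le_R G MM (phi c) (phi a)"
  then obtain y where y: "y \<in> Pn" "phi a \<cdot> ginv (phi c) = phi y" unfolding le_R_def by blast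
  then have "phi a = phi (y * c)" using assms by (metis inv_solve_right' phi_closed phi_mult)
  then show "\<exists>y. a = y * c" using phi_inj[of a "y * c"] assms y by auto
next
  assume "\<exists>y. a = y * c"
  then obtain y where y: "a = y * c" by blast
  then have "y \<in> Pn" using assms by simp
  then have "phi a \<cdot> ginv (phi c) = phi y" using y assms by (simp add: phi_mult m_assoc)
  then show "le_R G MM (phi c) (phi a)" using \<open>y \<in> Pn\<close> unfolding le_R_def by simp
qed

lemma tau_phi:
  assumes a: "a \<in> Pn" and I: "I \<subseteq> {1..n}"
  obtains y b where "tau G MM (phi ` sub gen I) (phi a) = phi b" "b \<in> sub gen I" "a = y * b"
    "\<And>z c. c \<in> sub gen I \<Longrightarrow> a = z * c \<Longrightarrow> \<exists>b'. b = b' * c"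
proof -
  let ?K = "phi ` sub gen I"
  obtain y b where b: "a = y * b" "supp b \<subseteq> I"
    "\<And>z c. supp c \<subseteq> I \<Longrightarrow> a = z * c \<Longrightarrow> \<exists>b'. b = b' * c"
    using greatest_parabolic_right_divisor by blast
  have Pn: "c \<in> Pn" if "c \<in> sub gen I" for c using sub_Pn[OF that I] .
  have bI: "b \<in> sub gen I" using b(2) by (simp add: sub_gen_iff)
  have div: "(\<exists>z. a = z * c) \<longleftrightarrow> (\<exists>z. b = z * c)" if "c \<in> sub gen I" for c
    using b(1) b(3)[of c] that by (auto simp: sub_gen_iff) (metis mult.assoc)
  have sets: "{c \<in> ?K. le_R G MM c (phi a)} = {c \<in> ?K. le_R G MM c (phi b)}"
    using div le_R_phi a Pn bI by auto
  have "tau G MM ?K (phi a) = phi b"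
    unfolding tau_def
  proof (rule the_equality)
    show "phi b \<in> ?K \<and> {c \<in> ?K. le_R G MM c (phi a)} = {c \<in> ?K. le_R G MM c (phi b)}"
      using sets bI by blast
  next
    fix \<beta> assume \<beta>: "\<beta> \<in> ?K \<and> {c \<in> ?K. le_R G MM c (phi a)} = {c \<in> ?K. le_R G MM c \<beta>}"
    then have "\<beta> \<in> ?K" by (rule conjunct1)
    then obtain b2 where b2: "b2 \<in> sub gen I" "\<beta> = phi b2" by blast
    have same: "{c \<in> ?K. le_R G MM c (phi b)} = {c \<in> ?K. le_R G MM c \<beta>}"
      using HOL.trans[OF sets[symmetric] conjunct2[OF \<beta>]] .
    have eq: "le_R G MM (phi c) (phi b) \<longleftrightarrow> le_R G MM (phi c) (phi b2)" if "c \<in> sub gen I" for c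
    proof -
      have "phi c \<in> {c \<in> ?K. le_R G MM c (phi b)} \<longleftrightarrow> phi c \<in> {c \<in> ?K. le_R G MM c \<beta>}"
        by (simp only: same)
      then show ?thesis using that unfolding b2(2) by simp
    qed
    \<comment> \<open>Elements of the submonoid with the same right divisors in it divide each
      other, and comparing lengths makes them equal.\<close>
    have "\<exists>z. b2 = z * b" "\<exists>z. b = z * b2"
      using eq[OF bI] eq[OF b2(1)] le_R_phi[OF Pn Pn] bI b2(1) by (metis mult_1_left)+
    then obtain z z' where z: "b2 = z * b" "b = z' * b2" by blast
    then have "len b = len z' + len b2" "len b2 = len z + len b" by (metis len_simps(2))+
    then have "z = 1" by simp
    then show "\<beta> = phi b" using z b2 by simp
  qed
  then show ?thesis using that[of b y] b bI by (simp add: sub_gen_iff)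
qed

text \<open>\<open>KK 0\<close> is \<open>M\<^sub>1\<close> and \<open>KK 1\<close> is
  \<open>N\<close>; the recursion exchanges them by passing from \<open>j\<close> to
  \<open>j + 1\<close>.\<close>

definition KK :: "int \<Rightarrow> nat gword set set" where
  "KK j = phi ` sub gen (par n j)"

definition alt :: "int \<Rightarrow> pbraid \<Rightarrow> nat gword set list \<Rightarrow> bool" where
  "alt j a as \<longleftrightarrow> alternating_form G MM (KK j) (KK (j + 1)) (phi a) as"

lemma par_1n: "par n j \<subseteq> {1..n}"
  by (auto simp: par_def)

lemma par_cover: "par n j \<union> par n (j + 1) = {1..n}"
  using n2 by (auto simp: par_def)

lemma alt_step:
  assumes "a \<in> Pn"
  shows "\<exists>b y. b \<in> sub gen (par n j) \<and> a = y * b \<and> y \<in> Pn \<and>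
    (\<forall>z c. c \<in> sub gen (par n j) \<longrightarrow> a = z * c \<longrightarrow> (\<exists>b'. b = b' * c)) \<and>
    (\<forall>x xs. alt j a (x # xs) \<longleftrightarrow> x = phi b \<and> (if xs = [] then b \<noteq> 1 \<and> y = 1 else alt (j + 1) y xs))"
proof -
  obtain y b where b: "tau G MM (KK j) (phi a) = phi b" "b \<in> sub gen (par n j)" "a = y * b"
    "\<And>z c. c \<in> sub gen (par n j) \<Longrightarrow> a = z * c \<Longrightarrow> \<exists>b'. b = b' * c"
    using tau_phi[OF assms par_1n] unfolding KK_def by metis
  have Pn: "y \<in> Pn" "b \<in> Pn" using b(3) assms by auto
  have KK2: "KK (j + 1 + 1) = KK j" by (simp add: KK_def par_def)
  have quot: "phi a \<cdot> ginv (phi b) = phi y" using b(3) Pn by (simp add: phi_mult m_assoc)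
  have one: "phi b = \<one>\<^bsub>G\<^esub> \<longleftrightarrow> b = 1" using phi_inj[of b 1] Pn by simp
  have eq: "phi a = phi b \<longleftrightarrow> y = 1"
    using phi_inj[of a b] Pn assms b(3) pbraid_right_cancel[of y b 1] by simp
  have tau: "tau G MM (KK j) (phi a) \<in> carrier G" unfolding b(1) using Pn by simp
  have form: "alt j a (x # xs) \<longleftrightarrow> x = phi b \<and> (if xs = [] then b \<noteq> 1 \<and> y = 1 else alt (j + 1) y xs)"
    for x xs
  proof -
    have "alt j a (x # xs) \<longleftrightarrow> x = phi b \<and> (if xs = [] then x \<noteq> \<one>\<^bsub>G\<^esub> \<and> phi a = x
        else alternating_form G MM (KK (j + 1)) (KK j) (phi a \<cdot> ginv x) xs)"
      using alternating_Cons[OF phi_closed[OF assms] tau, of "KK (j + 1)" x xs]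
      unfolding b(1) alt_def .
    also have "\<dots> \<longleftrightarrow> x = phi b \<and> (if xs = [] then phi b \<noteq> \<one>\<^bsub>G\<^esub> \<and> phi a = phi b
        else alternating_form G MM (KK (j + 1)) (KK j) (phi a \<cdot> ginv (phi b)) xs)"
      by (rule conj_cong[OF HOL.refl]) (erule ssubst, rule HOL.refl)
    finally show ?thesis unfolding quot one eq alt_def KK2 .
  qed
  have "\<forall>z c. c \<in> sub gen (par n j) \<longrightarrow> a = z * c \<longrightarrow> (\<exists>b'. b = b' * c)" using b(4) by simp
  note facts = conjI[OF b(2) conjI[OF b(3) conjI[OF Pn(1) conjI[OF this allI[OF allI[OF form]]]]]]
  show ?thesis by (rule exI[of _ b], rule exI[of _ y], rule facts)
qed

lemma alt_Nil [simp]: "\<not> alt j a []"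
  by (simp add: alt_def alternating_form_def)

lemma alt_not_one: "alt j a as \<Longrightarrow> a \<in> Pn \<Longrightarrow> a \<noteq> 1"
proof (induction as arbitrary: j a)
  case (Cons x xs)
  obtain y b where b: "b \<in> sub gen (par n j)" "a = y * b" "y \<in> Pn"
    "\<forall>z c. c \<in> sub gen (par n j) \<longrightarrow> a = z * c \<longrightarrow> (\<exists>b'. b = b' * c)"
    "\<forall>x xs. alt j a (x # xs) \<longleftrightarrow> x = phi b \<and> (if xs = [] then b \<noteq> 1 \<and> y = 1 else alt (j + 1) y xs)"
    using alt_step[OF Cons.prems(2), of j] by (elim exE conjE) (rule that)
  have "y \<noteq> 1 \<or> b \<noteq> 1" using Cons.prems(1) Cons.IH[of "j + 1" y] b(3,5) by (auto split: if_splits)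
  then have "len a \<noteq> 0" using b(2) by auto
  then show ?case by auto
qed simp

text \<open>\<open>chain\<close> grows on the left, whereas the alternating form is read from the
  right; this lemma and the next translate between the two.\<close>

lemma chain_snoc:
  "e \<in> chain gen n (j + 1) m \<Longrightarrow> c \<in> sub gen (par n j) \<Longrightarrow> e * c \<in> chain gen n j (Suc m)"
proof (induction m arbitrary: e)
  case 0
  then show ?case by auto
next
  case (Suc m)
  then obtain d w where dw: "d \<in> sub gen (par n (j + 1 + int m + 1))" "w \<in> chain gen n (j + 1) m" "e = d * w"
    by auto
  have "e * c = d * (w * c)" "w * c \<in> chain gen n j (Suc m)" using Suc dw by (auto simp: mult.assoc)
  moreover have "d \<in> sub gen (par n (j + int (Suc m) + 1))" using dw(1) by (simp add: add_ac)
  ultimately show ?case using chain.simps(2)[of gen n j "Suc m"] by blast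
qed

lemma chain_unsnoc:
  "x \<in> chain gen n j (Suc m) \<Longrightarrow> \<exists>e \<in> chain gen n (j + 1) m. \<exists>c \<in> sub gen (par n j). x = e * c"
proof (induction m arbitrary: x)
  case 0
  then show ?case by auto
next
  case (Suc m)
  then obtain d w where dw: "d \<in> sub gen (par n (j + int (Suc m) + 1))" "w \<in> chain gen n j (Suc m)" "x = d * w"
    using chain.simps(2)[of gen n j "Suc m"] by blast
  obtain e c where ec: "e \<in> chain gen n (j + 1) m" "c \<in> sub gen (par n j)" "w = e * c"
    using Suc.IH dw(2) by blast
  have "d \<in> sub gen (par n (j + 1 + int m + 1))" using dw(1) by (simp add: add_ac)
  then have "d * e \<in> chain gen n (j + 1) (Suc m)" using ec by auto
  then show ?case using ec dw by (metis mult.assoc)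
qed

text \<open>The greedy factor \<open>b\<close> is a left multiple of any other factor
  \<open>c\<close> from its submonoid with \<open>a = e * c\<close>. So \<open>y\<close> is a left
  divisor of \<open>e\<close> and needs no more factors, by
  \<open>chain_left_divisor\<close>.\<close>

lemma alt_length: "alt j a as \<Longrightarrow> a \<in> Pn \<Longrightarrow> length as \<le> Suc m \<longleftrightarrow> a \<in> chain gen n j m"
proof (induction as arbitrary: j a m)
  case (Cons x xs)
  obtain y b where b: "b \<in> sub gen (par n j)" "a = y * b" "y \<in> Pn"
    "\<forall>z c. c \<in> sub gen (par n j) \<longrightarrow> a = z * c \<longrightarrow> (\<exists>b'. b = b' * c)"
    "\<forall>x xs. alt j a (x # xs) \<longleftrightarrow> x = phi b \<and> (if xs = [] then b \<noteq> 1 \<and> y = 1 else alt (j + 1) y xs)"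
    using alt_step[OF Cons.prems(2), of j] by (elim exE conjE) (rule that)
  show ?case
  proof (cases "xs = []")
    case True
    then have "a \<in> sub gen (par n j)" using Cons.prems b by auto
    then have "a \<in> chain gen n j m" by (induction m) (auto intro: L.chain_Suc simp del: chain.simps(2))
    then show ?thesis using True by simp
  next
    case False
    then have alt: "alt (j + 1) y xs" using Cons.prems(1) b(5) by simp
    have y1: "y \<noteq> 1" using alt_not_one[OF alt b(3)] .
    show ?thesis
    proof (cases m)
      case 0
      have "a \<notin> sub gen (par n j)"
      proof
        assume "a \<in> sub gen (par n j)"
        then obtain b' where "b = b' * a" using b(4)[rule_format, of a 1] by auto
        then have "len b = len (b' * (y * b))" unfolding b(2) by (rule arg_cong)
        then have "len y = 0" unfolding len_simps by linarith
        then show False using y1 by simp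
      qed
      then show ?thesis using 0 False by (cases xs) auto
    next
      case (Suc m')
      have "a \<in> chain gen n j (Suc m') \<longleftrightarrow> y \<in> chain gen n (j + 1) m'"
      proof
        assume "a \<in> chain gen n j (Suc m')"
        then obtain e c where ec: "e \<in> chain gen n (j + 1) m'" "c \<in> sub gen (par n j)" "a = e * c"
          using chain_unsnoc by blast
        then obtain b' where "b = b' * c" using b(4)[rule_format, OF ec(2,3)] by blast
        then have "(y * b') * c = e * c" using ec(3) b(2) by (simp add: mult.assoc)
        then have "y * b' \<in> chain gen n (j + 1) m'" using ec(1) by (simp add: pbraid_right_cancel)
        then show "y \<in> chain gen n (j + 1) m'" using L.chain_left_divisor b(3) unfolding Pn_eq by blast
      next
        assume "y \<in> chain gen n (j + 1) m'"
        then show "a \<in> chain gen n j (Suc m')" using chain_snoc b(1,2) by blast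
      qed
      then show ?thesis using Cons.IH[OF alt b(3), of m'] Suc by (simp del: chain.simps)
    qed
  qed
qed simp

text \<open>The first factor may be 1, and then the length does not drop. The next factor is then
  not 1: a nontrivial element without right divisor in one submonoid has one in the other.\<close>

lemma alt_ex1: "a \<in> Pn \<Longrightarrow> a \<noteq> 1 \<Longrightarrow> \<exists>!as. alt j a as"
proof (induction "len a" arbitrary: a j rule: less_induct)
  case less
  have step: "\<exists>!as. alt j a as" if div: "\<exists>i\<in>par n j. \<exists>z. a = z * gen i" for j
  proof -
    obtain y b where b: "b \<in> sub gen (par n j)" "a = y * b" "y \<in> Pn"
      "\<forall>z c. c \<in> sub gen (par n j) \<longrightarrow> a = z * c \<longrightarrow> (\<exists>b'. b = b' * c)"
      "\<forall>x xs. alt j a (x # xs) \<longleftrightarrow> x = phi b \<and> (if xs = [] then b \<noteq> 1 \<and> y = 1 else alt (j + 1) y xs)"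
      using alt_step[OF less.prems(1), of j] by (elim exE conjE) (rule that)
    obtain i z where "i \<in> par n j" "a = z * gen i" using div by blast
    then obtain b' where "b = b' * gen i" using b(4)[rule_format, of "gen i" z] sub_gen by blast
    then have b1: "b \<noteq> 1" "len y < len a" using b(2) by (auto dest: arg_cong[of _ _ len])
    show ?thesis
    proof (cases "y = 1")
      case True
      then have "alt j a as \<longleftrightarrow> as = [phi b]" for as
        using b(5) b1 alt_not_one[of "j + 1" y] b(3) by (cases as) (auto split: if_splits)
      then show ?thesis by simp
    next
      case False
      then obtain xs where xs: "\<And>zs. alt (j + 1) y zs \<longleftrightarrow> zs = xs"
        using less.hyps[OF b1(2) b(3), of "j + 1"] by metis
      then have "xs \<noteq> []" using alt_Nil by metis
      then have "alt j a as \<longleftrightarrow> as = phi b # xs" for as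
        by (cases as) (auto simp: b(5) xs False)
      then show ?thesis by (intro ex1I[of _ "phi b # xs"]) simp_all
    qed
  qed
  show ?case
  proof (cases "\<exists>i\<in>par n j. \<exists>z. a = z * gen i")
    case True
    then show ?thesis by (rule step)
  next
    case False
    obtain y b where b: "b \<in> sub gen (par n j)" "a = y * b" "y \<in> Pn"
      "\<forall>z c. c \<in> sub gen (par n j) \<longrightarrow> a = z * c \<longrightarrow> (\<exists>b'. b = b' * c)"
      "\<forall>x xs. alt j a (x # xs) \<longleftrightarrow> x = phi b \<and> (if xs = [] then b \<noteq> 1 \<and> y = 1 else alt (j + 1) y xs)"
      using alt_step[OF less.prems(1), of j] by (elim exE conjE) (rule that)
    have b1: "b = 1"
    proof (cases b rule: pbraid_right_cases)
      case (2 i z)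
      then show ?thesis using False b(1,2) by (auto simp: sub_gen_iff) (metis mult.assoc)
    qed
    obtain i z where i: "a = z * gen i" "i \<in> supp a"
      using less.prems(2) by (cases a rule: pbraid_right_cases) auto
    then have "i \<in> par n (j + 1)" using False less.prems(1) par_cover[of j] unfolding Pn_def by blast
    then obtain xs where xs: "\<And>zs. alt (j + 1) a zs \<longleftrightarrow> zs = xs"
      using step[of "j + 1"] i by metis
    then have "xs \<noteq> []" using alt_Nil by metis
    moreover have "y = a" using b(2) b1 by simp
    ultimately have "alt j a as \<longleftrightarrow> as = phi b # xs" for as
      using b1 by (cases as) (auto simp: b(5) xs)
    then show ?thesis by (intro ex1I[of _ "phi b # xs"]) simp_all
  qed
qed

section \<open>Depth and the negative elements\<close>

abbreviation "depth \<equiv> dpt G MM (KK 0) (KK 1)"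

text \<open>For either parity the depth is half the number of factors, rounded down, so depth at
  most \<open>k\<close> means at most \<open>2 * k + 1\<close> factors.\<close>

lemma dpt_le_iff:
  assumes "a \<in> Pn"
  shows "depth (phi a) \<le> k \<longleftrightarrow> a \<in> chain gen n 0 (2 * k)"
proof (cases "a = 1")
  case True
  have "1 \<in> chain gen n 0 m" for m by (induction m) (auto intro: L.chain_Suc simp del: chain.simps(2))
  then show ?thesis using True by (simp add: dpt_def bh_def)
next
  case False
  have ex1: "\<exists>!as. alt 0 a as" using alt_ex1[OF assms False] .
  define as where "as = (THE as. alt 0 a as)"
  have as: "alt 0 a as" unfolding as_def by (rule theI'[OF ex1])
  have "(THE as. alternating_form G MM (KK 0) (KK 1) (phi a) as) = as" unfolding as_def alt_def by simp
  moreover have "phi a \<noteq> \<one>\<^bsub>G\<^esub>" using phi_inj[of a 1] assms False by simp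
  ultimately have "bh G MM (KK 0) (KK 1) (phi a) = length as" by (simp add: bh_def)
  then have "depth (phi a) = length as div 2" by (auto simp: dpt_def elim: oddE)
  then show ?thesis using alt_length[OF as assms, of "2 * k"] by (simp del: chain.simps) linarith
qed

lemma dpt_le_iff_move:
  assumes "a \<in> Pn" "0 < k"
  shows "depth (phi a) \<le> k \<longleftrightarrow> move a < move (D ^ k)"
  using L.chain_iff[of "2 * k" a 0] dpt_le_iff[OF assms(1), of k] assms pt_power[of k]
  by (simp add: pt_0 Pn_eq)

text \<open>\<open>D ^ k\<close> moves the base point exactly to the bound that depth
  \<open>k\<close> excludes, while \<open>D ^ Suc k\<close> moves it further.\<close>

lemma dpt_D_power:
  assumes "0 < k"
  shows "depth (phi (D ^ k)) = Suc k"
proof -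
  have "move (D ^ k) < move (D ^ Suc k)"
    using L.pt_mono[of "2 * int k" "2 * int (Suc k)"] unfolding pt_power by simp
  then show ?thesis
    using dpt_le_iff_move[of "D ^ k" k] dpt_le_iff_move[of "D ^ k" "Suc k"] assms
    by (simp del: power_Suc)
qed

lemma phi_D_int_pow: "phi D [^]\<^bsub>G\<^esub> (- int k) = ginv (phi (D ^ k))"
  by (simp add: phi_power int_pow_neg_int)

text \<open>Since \<open>D ^ k\<close> has depth \<open>Suc k\<close>, a smaller depth means depth
  at most \<open>k\<close>, which is a comparison of images of the base point. The \<Delta>-form is
  the reduced fraction.\<close>

lemma negative_iff_low:
  assumes "\<alpha> \<in> carrier G"
  shows "HG1_negative G MM (phi D) (KK 0) (KK 1) \<alpha> \<longleftrightarrow> low \<alpha>"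
proof
  assume "HG1_negative G MM (phi D) (KK 0) (KK 1) \<alpha>"
  then obtain \<gamma> k where k: "Delta_form G MM (phi D) \<alpha> \<gamma> (- int k)" "k \<ge> 1"
    "depth \<gamma> < depth (phi D [^]\<^bsub>G\<^esub> k)"
    unfolding HG1_negative_def by blast
  then obtain a where a: "a \<in> Pn" "\<gamma> = phi a" unfolding Delta_form_def unmovable_def by blast
  have "\<alpha> \<cdot> phi (D ^ k) = phi a"
    using k(1) a unfolding Delta_form_def by (simp add: phi_D_int_pow m_assoc)
  then have "frac \<alpha> a k" using a assms by (simp add: frac_def)
  moreover have "move a < move (D ^ k)"
    using k a dpt_D_power[of k] dpt_le_iff_move[OF a(1), of k] by (simp flip: phi_power)
  ultimately show "low \<alpha>" unfolding low_def by blast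
next
  assume "low \<alpha>"
  then obtain a k where f: "frac \<alpha> a k" "move a < move (D ^ k)" unfolding low_def by blast
  then have a: "a \<in> Pn" by (simp add: frac_def)
  let ?P = "\<lambda>e. \<exists>b. a = b * D ^ e"
  have lenD: "0 < len D" using comp[of 1] n2 by (metis atLeastAtMost_iff len_simps(2,3) add_gr_0 le_numeral_extra(4) one_le_numeral order_trans zero_less_one)
  have lenDe: "len (D ^ e) \<ge> e" for e using lenD by (induction e) auto
  have "?P 0" by simp
  moreover have "\<forall>e. ?P e \<longrightarrow> e \<le> len a" using lenDe by (metis le_add2 len_simps(2) order_trans)
  ultimately obtain e where e: "?P e" "\<And>e'. ?P e' \<Longrightarrow> e' \<le> e"
    using Nat.ex_has_greatest_nat[of ?P 0 "len a"] by blast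
  then obtain b where b: "a = b * D ^ e" by blast
  have bPn: "b \<in> Pn" using a b by simp
  \<comment> \<open>Otherwise \<open>a\<close> would have the right factor \<open>D ^ k\<close> and
    move the base point at least as far. So the reduced exponent stays positive.\<close>
  have "e < k"
  proof (rule ccontr)
    assume "\<not> e < k"
    then have "D ^ e = D ^ (e - k) * D ^ k" by (simp flip: power_add)
    then have "a = (b * D ^ (e - k)) * D ^ k" using b by (simp add: mult.assoc)
    then have "move (D ^ k) \<le> move a" using P.act_ge[of "move (D ^ k)" "b * D ^ (e - k)"] by (simp add: P.act_mult)
    then show False using f(2) by simp
  qed
  then obtain l where l: "k = l + e" "0 < l" by (metis add.commute less_imp_add_positive)
  have \<alpha>: "\<alpha> \<cdot> phi (D ^ l) = phi b"
  proof -
    have "\<alpha> \<cdot> phi (D ^ l) \<cdot> phi (D ^ e) = phi b \<cdot> phi (D ^ e)"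
      using f(1) l b bPn assms by (simp add: frac_def m_assoc D_powers phi_mult)
    then show ?thesis using assms bPn by (simp add: right_cancel)
  qed
  have "\<not> le_R G MM (phi D) (phi b)"
  proof
    assume "le_R G MM (phi D) (phi b)"
    then obtain y where "b = y * D" using le_R_phi bPn by auto
    then have "a = y * D ^ Suc e" using b by (simp add: mult.assoc)
    then show False using e(2)[of "Suc e"] by auto
  qed
  moreover have "\<alpha> = phi b \<cdot> phi D [^]\<^bsub>G\<^esub> (- int l)"
    unfolding phi_D_int_pow using \<alpha> assms by (simp flip: \<alpha> add: m_assoc)
  ultimately have form: "Delta_form G MM (phi D) \<alpha> (phi b) (- int l)"
    using bPn unfolding Delta_form_def unmovable_def by blast
  have "frac \<alpha> b l" using \<alpha> assms bPn by (simp add: frac_def)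
  then have "move b < move (D ^ l)" using low_iff \<open>low \<alpha>\<close> by blast
  then have "depth (phi b) < depth (phi D [^]\<^bsub>G\<^esub> l)"
    using dpt_le_iff_move[OF bPn l(2)] dpt_D_power[OF l(2)] by (simp flip: phi_power)
  then show "HG1_negative G MM (phi D) (KK 0) (KK 1) \<alpha>"
    unfolding HG1_negative_def using form l(2) by (intro exI[of _ "phi b"] exI[of _ l]) simp
qed

lemma phi_prod: "set xs \<subseteq> {1..n} \<Longrightarrow> list_mult G (map (artin_gen n) xs) = phi (prod_list (map gen xs))"
proof (induction xs)
  case (Cons x xs)
  have "prod_list (map gen xs) \<in> Pn" using Cons.prems by (induction xs) auto
  then show ?case using Cons phi_gen[of x] by (simp add: list_mult_def phi_mult)
qed (simp add: list_mult_def)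

lemma phi_D_eq: "list_mult G (map (artin_gen n) [1..<n+1]) [^]\<^bsub>G\<^esub> (n + 1) = phi D"
proof -
  have "up gen 0 n \<in> Pn" using sub_Pn[OF up_in_sub, of 0 n] by force
  then have pow: "phi (up gen 0 n ^ k) = phi (up gen 0 n) [^]\<^bsub>G\<^esub> k \<and> up gen 0 n ^ k \<in> Pn" for k
    by (induction k) (auto simp: power_Suc2 phi_mult nat_pow_Suc simp del: power_Suc)
  have "list_mult G (map (artin_gen n) [1..<n+1]) = phi (up gen 0 n)"
    using phi_prod[of "[1..<n+1]"] by (simp add: up_def One_nat_def atLeastLessThanSuc_atLeastAtMost del: upt_Suc)
  then show ?thesis using pow[of "Suc n"] by (simp only: Delta_def Suc_eq_plus1)
qed

lemma dehornoy:
  "dehornoy_structure G MM (phi D) H (KK 1) \<Lambda> (generate G (artin_gen n ` {2..n})) (KK 0) \<Delta>1"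
proof -
  let ?G1 = "generate G (artin_gen n ` {2..n})"
  define P where "P = HG1_positives G MM (phi D) (KK 0) (KK 1)"
  have P: "\<alpha> \<in> P \<longleftrightarrow> \<alpha> \<in> carrier G \<and> low (ginv \<alpha>)" for \<alpha>
    using negative_iff_low[OF inv_closed] unfolding P_def HG1_positives_def by blast
  have invP: "\<alpha> \<in> set_inv\<^bsub>G\<^esub> P \<longleftrightarrow> \<alpha> \<in> carrier G \<and> low \<alpha>" for \<alpha>
    using P unfolding SET_INV_def by (auto intro: bexI[of _ "ginv \<alpha>"])
  have G1: "\<alpha> \<in> ?G1 \<longleftrightarrow> \<alpha> \<in> carrier G \<and> level \<alpha>" for \<alpha>
    using level_generate generate_closed[of \<alpha> "{2..n}"] by auto
  have "P <#>\<^bsub>G\<^esub> P \<subseteq> P"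
    unfolding set_mult_def using P low_mult(1) by (auto simp: inv_mult_group)
  moreover have "?G1 <#>\<^bsub>G\<^esub> P <#>\<^bsub>G\<^esub> ?G1 \<subseteq> P"
  proof
    fix x assume "x \<in> ?G1 <#>\<^bsub>G\<^esub> P <#>\<^bsub>G\<^esub> ?G1"
    then obtain g \<alpha> h where x: "g \<in> ?G1" "\<alpha> \<in> P" "h \<in> ?G1" "x = g \<cdot> \<alpha> \<cdot> h"
      unfolding set_mult_def by blast
    then have c: "g \<in> carrier G" "\<alpha> \<in> carrier G" "h \<in> carrier G" using P G1 by auto
    have "level (ginv g)" "level (ginv h)" "low (ginv \<alpha>)"
      using x P G1 trichotomy(4) by blast+
    then have "low (ginv h \<cdot> (ginv \<alpha> \<cdot> ginv g))"
      using low_mult(2,3) c by simp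
    then show "x \<in> P" using P x c by (simp add: inv_mult_group m_assoc)
  qed
  moreover have "carrier G = P \<union> set_inv\<^bsub>G\<^esub> P \<union> ?G1"
    using P invP G1 trichotomy(1) by blast
  moreover have "P \<inter> set_inv\<^bsub>G\<^esub> P = {}" using P invP trichotomy(2) by blast
  moreover have "P \<inter> ?G1 = {}" using P G1 trichotomy(3,4) inv_closed by blast
  moreover have "set_inv\<^bsub>G\<^esub> P \<inter> ?G1 = {}" using invP G1 trichotomy(3) by blast
  ultimately show ?thesis unfolding dehornoy_structure_def P_def[symmetric] Let_def by blast
qed

end

theorem corollary4p2:
  fixes n :: nat
    and G :: "nat gword set monoid"
    and s :: "nat \<Rightarrow> nat gword set"
    and M G1 M1 H N :: "nat gword set set"
    and \<Delta> \<Delta>1 \<Lambda> :: "nat gword set"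
  assumes n: "n \<ge> 2"
    and G: "G = artin_A n"
    and s: "s = artin_gen n"
    and M: "M = monoid_generate G (s ` {1..n})"
    and \<Delta>: "\<Delta> = list_mult G (map s [1..<n+1]) [^]\<^bsub>G\<^esub> (n + 1)"
    and G1: "G1 = generate G (s ` {2..n})"
    and M1: "M1 = monoid_generate G (s ` {2..n})"
    and \<Delta>1: "\<Delta>1 = list_mult G (map s [2..<n+1]) [^]\<^bsub>G\<^esub> n"
    and H: "H = generate G (s ` {1..n-1})"
    and N: "N = monoid_generate G (s ` {1..n-1})"
    and \<Lambda>: "\<Lambda> = list_mult G (map s [1..<n]) [^]\<^bsub>G\<^esub> n"
  shows "dehornoy_structure G M \<Delta> H N \<Lambda> G1 M1 \<Delta>1"
proof -
  interpret A: artin_group n by standard (rule n)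
  have "sub gen {1..n} = A.Pn" unfolding A.Pn_def by (simp only: set_eq_iff sub_gen_iff mem_Collect_eq simp_thms)
  then have "M = A.phi ` A.Pn" using A.monoid_generate_gens[of "{1..n}"] by (simp add: M G s)
  moreover have "par n 0 = {2..n}" "par n 1 = {1..n-1}" by (auto simp: par_def)
  then have "M1 = A.KK 0" "N = A.KK 1"
    using A.monoid_generate_gens[of "{2..n}"] A.monoid_generate_gens[of "{1..n-1}"]
    by (simp_all add: M1 N G s A.KK_def)
  moreover have "\<Delta> = A.phi (Delta n)" using A.phi_D_eq by (simp add: \<Delta> G s)
  ultimately show ?thesis using A.dehornoy by (simp add: G G1 s)
qed

end
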